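(* Let $m,n$ be positive integers. For a fixed natural number $1\le\alpha\le 2(m+n)$ the set $$\mathcal E_{\alpha}=\{\hat\psi_{j\alpha}:\mathbf{Sp}(m+n)/\mathbf{Sp}(m)\times\mathbf{Sp}(n)\to\mathbb C\ |\ 1\le j\le 2(m+n),\ j\ne\alpha\}$$ is an eigenfamily on the quaternionic Grassmannian $\mathbf{Sp}(m+n)/\mathbf{Sp}(m)\times\mathbf{Sp}(n)$ such that its tension field $\tau$ and conformality operator $\kappa$ satisfy $$\tau(\hat\phi)=-2(m+n)\cdot\hat\phi\quad\text{and}\quad\kappa(\hat\phi,\hat\psi)=-\hat\phi\cdot\hat\psi$$ for all $\hat\phi,\hat\psi\in\mathcal E_{\alpha}$.
   Context: For a positive integer $N$, the quaternionic unitary group $\mathbf{Sp}(N)$ is identified with the compact group of unitary $2N\times2N$ complex matrices of the form $q=\begin{pmatrix} z & w\\ -\bar w & \bar z\end{pmatrix}$ with $z,w\in\mathbb C^{N\times N}$. It carries the bi-invariant Riemannian metric given by $g_q(qX,qY)=\operatorname{Re}(\operatorname{trace}(\bar X^t\cdot Y))$ for $X,Y$ in the Lie algebra $\mathfrak{sp}(N)\subset\mathbb C^{2N\times2N}$. Put $I_{m,n}=\begin{pmatrix} I_m&0\\0&-I_n\end{pmatrix}$ and $\tilde I_{m,n}=\begin{pmatrix} I_{m,n}&0\\0&I_{m,n}\end{pmatrix}$, a $2(m+n)\times2(m+n)$ matrix. The subgroup $\mathbf{Sp}(m)\times\mathbf{Sp}(n)$ of $\mathbf{Sp}(m+n)$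 is $\{q : \tilde I_{m,n}q\tilde I_{m,n}=q\}$, i.e. the block diagonal quaternionic matrices. The quotient carries the metric making the natural projection $\mathbf{Sp}(m+n)\to\mathbf{Sp}(m+n)/\mathbf{Sp}(m)\times\mathbf{Sp}(n)$ a Riemannian submersion. For $1\le j,\alpha\le2(m+n)$ define $$\psi_{j\alpha}:\mathbf{Sp}(m+n)\to\mathbb C,\qquad \psi_{j\alpha}(q)=\tfrac12\cdot\big(q\tilde I_{m,n}\bar q^t+I_{2(m+n)}\big)_{j\alpha}.$$ These functions are invariant under right multiplication by $\mathbf{Sp}(m)\times\mathbf{Sp}(n)$, and $\hat\psi_{j\alpha}$ denotes the induced function on the quotient. On a Riemannian manifold $(M,g)$, with $g$ extended complex-bilinearly, $\tau(f)=\operatorname{div}(\nabla f)$ and $\kappa(f,h)=g(\nabla f,\nabla h)$ for complex-valued functions $f,h$. A collection $\mathcal E$ of smooth complex-valued functions on $M$ is an eigenfamily if there are $\lambda,\mu\in\mathbb C$ with $\tau(\phi)=\lambda\cdot\phi$ and $\kappa(\phi,\psi)=\mu\cdot\phi\psi$ for all $\phi,\psi\in\mathcal E$. *)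

theory Defs
  imports "HOL-Analysis.Analysis"
begin

section \<open>Smooth maps\<close>

text \<open>The set \<open>S\<close> is meant to be open.\<close>

primrec C_k_on :: "nat \<Rightarrow> ('a::real_normed_vector \<Rightarrow> 'b::real_normed_vector) \<Rightarrow> 'a set \<Rightarrow> bool"
  where
    "C_k_on 0 f S \<longleftrightarrow> continuous_on S f"
  | "C_k_on (Suc k) f S \<longleftrightarrow>
       f differentiable_on S \<and> (\<forall>v. C_k_on k (\<lambda>x. frechet_derivative f (at x) v) S)"

definition smooth_on :: "('a::real_normed_vector \<Rightarrow> 'b::real_normed_vector) \<Rightarrow> 'a set \<Rightarrow> bool"
  where "smooth_on f S \<longleftrightarrow> (\<forall>k. C_k_on k f S)"

text \<open>Smoothness of a map defined on an embedded submanifold \<open>D\<close> of a Euclidean space: locally it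
  is the restriction of a smooth map of the ambient space.\<close>

definition smooth_on_submanifold ::
    "('a::real_normed_vector \<Rightarrow> 'b::real_normed_vector) \<Rightarrow> 'a set \<Rightarrow> bool"
  where "smooth_on_submanifold f D \<longleftrightarrow>
    (\<forall>q\<in>D. \<exists>V f'. open V \<and> q \<in> V \<and> smooth_on f' V \<and> (\<forall>x\<in>V \<inter> D. f' x = f x))"


section \<open>Riemannian manifolds\<close>

text \<open>A chart is a domain together with a coordinate map into the model space \<open>'e\<close>.  The metric is
  given by its coordinate representations: \<open>metric M c y u v\<close> is the inner product of the tangent
  vectors with coordinates \<open>u\<close> and \<open>v\<close> in the chart \<open>c\<close>, at the point with coordinates \<open>y\<close>.\<close>

type_synonym ('a, 'e) chart = "'a set \<times> ('a \<Rightarrow> 'e)"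

record ('a, 'e) riem =
  points :: "'a set"
  atlas :: "('a, 'e) chart set"
  metric :: "('a, 'e) chart \<Rightarrow> 'e \<Rightarrow> 'e \<Rightarrow> 'e \<Rightarrow> real"

definition chart_dom :: "('a, 'e) chart \<Rightarrow> 'a set" where "chart_dom c = fst c"

definition crd :: "('a, 'e) chart \<Rightarrow> 'a \<Rightarrow> 'e" where "crd c = snd c"

definition param :: "('a, 'e) chart \<Rightarrow> 'e \<Rightarrow> 'a" where "param c = inv_into (chart_dom c) (crd c)"

definition manifold_topology :: "('a, 'e::euclidean_space) riem \<Rightarrow> 'a topology"
  where "manifold_topology M =
    topology (\<lambda>W. W \<subseteq> points M \<and> (\<forall>c\<in>atlas M. open (crd c ` (chart_dom c \<inter> W))))"

definition smooth_manifold :: "('a, 'e::euclidean_space) riem \<Rightarrow> bool"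
  where "smooth_manifold M \<longleftrightarrow>
    (\<Union>c\<in>atlas M. chart_dom c) = points M \<and>
    (\<forall>c\<in>atlas M. inj_on (crd c) (chart_dom c) \<and> open (crd c ` chart_dom c)) \<and>
    (\<forall>c\<in>atlas M. \<forall>d\<in>atlas M.
        open (crd c ` (chart_dom c \<inter> chart_dom d)) \<and>
        smooth_on (crd d \<circ> param c) (crd c ` (chart_dom c \<inter> chart_dom d))) \<and>
    Hausdorff_space (manifold_topology M) \<and> second_countable (manifold_topology M)"

definition riemannian_manifold :: "('a, 'e::euclidean_space) riem \<Rightarrow> bool"
  where "riemannian_manifold M \<longleftrightarrow>
    smooth_manifold M \<and>
    (\<forall>c\<in>atlas M. \<forall>y\<in>crd c ` chart_dom c.
        bilinear (metric M c y) \<and>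
        (\<forall>u v. metric M c y u v = metric M c y v u) \<and>
        (\<forall>u. u \<noteq> 0 \<longrightarrow> metric M c y u u > 0)) \<and>
    (\<forall>c\<in>atlas M. \<forall>u v. smooth_on (\<lambda>y. metric M c y u v) (crd c ` chart_dom c)) \<and>
    (\<forall>c\<in>atlas M. \<forall>d\<in>atlas M. \<forall>y\<in>crd c ` (chart_dom c \<inter> chart_dom d). \<forall>u v.
        metric M c y u v =
        metric M d (crd d (param c y))
          (frechet_derivative (crd d \<circ> param c) (at y) u)
          (frechet_derivative (crd d \<circ> param c) (at y) v))"

definition smooth_function ::
    "('a, 'e::euclidean_space) riem \<Rightarrow> ('a \<Rightarrow> complex) \<Rightarrow> bool"
  where "smooth_function M f \<longleftrightarrow> (\<forall>c\<in>atlas M. smooth_on (f \<circ> param c) (crd c ` chart_dom c))"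


subsection \<open>Gradient, Levi-Civita connection and divergence in a chart\<close>

definition grad :: "('a, 'e::euclidean_space) riem \<Rightarrow> ('a, 'e) chart \<Rightarrow> ('a \<Rightarrow> real) \<Rightarrow> 'e \<Rightarrow> 'e"
  where "grad M c f y =
    (THE u. \<forall>v. metric M c y u v = frechet_derivative (f \<circ> param c) (at y) v)"

definition metric_deriv ::
    "('a, 'e::euclidean_space) riem \<Rightarrow> ('a, 'e) chart \<Rightarrow> 'e \<Rightarrow> 'e \<Rightarrow> 'e \<Rightarrow> 'e \<Rightarrow> real"
  where "metric_deriv M c y w u v = frechet_derivative (\<lambda>z. metric M c z u v) (at y) w"

text \<open>Koszul's formula for vector fields with constant coordinates, whose brackets vanish.\<close>

definition christoffel ::
    "('a, 'e::euclidean_space) riem \<Rightarrow> ('a, 'e) chart \<Rightarrow> 'e \<Rightarrow> 'e \<Rightarrow> 'e \<Rightarrow> 'e"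
  where "christoffel M c y u v =
    (THE z. \<forall>w. 2 * metric M c y z w =
       metric_deriv M c y u v w + metric_deriv M c y v u w - metric_deriv M c y w u v)"

definition cov_deriv ::
    "('a, 'e::euclidean_space) riem \<Rightarrow> ('a, 'e) chart \<Rightarrow> 'e \<Rightarrow> ('e \<Rightarrow> 'e) \<Rightarrow> 'e \<Rightarrow> 'e"
  where "cov_deriv M c v X y = frechet_derivative X (at y) v + christoffel M c y v (X y)"

text \<open>The trace of the endomorphism \<open>v \<mapsto> \<nabla>\<^sub>v X\<close>.\<close>

definition divergence ::
    "('a, 'e::euclidean_space) riem \<Rightarrow> ('a, 'e) chart \<Rightarrow> ('e \<Rightarrow> 'e) \<Rightarrow> 'e \<Rightarrow> real"
  where "divergence M c X y = (\<Sum>b\<in>Basis. cov_deriv M c b X y \<bullet> b)"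


subsection \<open>Tension field, conformality operator and eigenfamilies\<close>

text \<open>Both operators do not depend on the chart used; an arbitrary one around the point is taken.\<close>

definition chart_at :: "('a, 'e::euclidean_space) riem \<Rightarrow> 'a \<Rightarrow> ('a, 'e) chart"
  where "chart_at M x = (SOME c. c \<in> atlas M \<and> x \<in> chart_dom c)"

text \<open>A complex tangent vector \<open>u + \<i> u'\<close> is represented by the pair of its real and imaginary part.\<close>

definition grad_complex ::
    "('a, 'e::euclidean_space) riem \<Rightarrow> ('a, 'e) chart \<Rightarrow> ('a \<Rightarrow> complex) \<Rightarrow> 'e \<Rightarrow> 'e \<times> 'e"
  where "grad_complex M c f y = (grad M c (Re \<circ> f) y, grad M c (Im \<circ> f) y)"

definition divergence_complex ::
    "('a, 'e::euclidean_space) riem \<Rightarrow> ('a, 'e) chart \<Rightarrow> ('e \<Rightarrow> 'e \<times> 'e) \<Rightarrow> 'e \<Rightarrow> complex"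
  where "divergence_complex M c X y =
    Complex (divergence M c (fst \<circ> X) y) (divergence M c (snd \<circ> X) y)"

definition metric_complex ::
    "('a, 'e::euclidean_space) riem \<Rightarrow> ('a, 'e) chart \<Rightarrow> 'e \<Rightarrow> 'e \<times> 'e \<Rightarrow> 'e \<times> 'e \<Rightarrow> complex"
  where "metric_complex M c y X Y =
    Complex (metric M c y (fst X) (fst Y) - metric M c y (snd X) (snd Y))
            (metric M c y (fst X) (snd Y) + metric M c y (snd X) (fst Y))"

definition tension :: "('a, 'e::euclidean_space) riem \<Rightarrow> ('a \<Rightarrow> complex) \<Rightarrow> 'a \<Rightarrow> complex"
  where "tension M f x =
    (let c = chart_at M x in divergence_complex M c (grad_complex M c f) (crd c x))"

definition conformality ::
    "('a, 'e::euclidean_space) riem \<Rightarrow> ('a \<Rightarrow> complex) \<Rightarrow> ('a \<Rightarrow> complex) \<Rightarrow> 'a \<Rightarrow> complex"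
  where "conformality M f h x =
    (let c = chart_at M x; y = crd c x
     in metric_complex M c y (grad_complex M c f y) (grad_complex M c h y))"

definition eigenfamily :: "('a, 'e::euclidean_space) riem \<Rightarrow> ('a \<Rightarrow> complex) set \<Rightarrow> bool"
  where "eigenfamily M E \<longleftrightarrow>
    (\<forall>f\<in>E. smooth_function M f) \<and>
    (\<exists>lam mu. \<forall>f\<in>E. \<forall>h\<in>E. \<forall>x\<in>points M.
        tension M f x = lam * f x \<and> conformality M f h x = mu * (f x * h x))"


subsection \<open>Riemannian submersions\<close>

text \<open>Here the total space is a submanifold \<open>S\<close> of a Euclidean space, with tangent spaces \<open>T q\<close>
  (linear subspaces of the ambient space) and metric \<open>h q\<close> on \<open>T q\<close>.  A derivative \<open>L\<close> within \<open>S\<close> is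
  determined by the map only on \<open>T q\<close>, and there it is the differential; only these values of \<open>L\<close>
  are used.\<close>

definition riemannian_submersion ::
    "'v::euclidean_space set \<Rightarrow> ('v \<Rightarrow> 'v set) \<Rightarrow> ('v \<Rightarrow> 'v \<Rightarrow> 'v \<Rightarrow> real) \<Rightarrow>
     ('v \<Rightarrow> 'a) \<Rightarrow> ('a, 'e::euclidean_space) riem \<Rightarrow> bool"
  where "riemannian_submersion S T h p M \<longleftrightarrow>
    p ` S = points M \<and>
    (\<forall>c\<in>atlas M.
       let D = {q \<in> S. p q \<in> chart_dom c} in
       openin (top_of_set S) D \<and>
       smooth_on_submanifold (crd c \<circ> p) D \<and>
       (\<forall>q\<in>D. \<exists>L.
          ((crd c \<circ> p) has_derivative L) (at q within D) \<and>
          L ` T q = UNIV \<and>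
          (let horizontal = {v \<in> T q. \<forall>u\<in>T q. L u = 0 \<longrightarrow> h q v u = 0} in
           \<forall>v\<in>horizontal. \<forall>w\<in>horizontal.
             metric M c (crd c (p q)) (L v) (L w) = h q v w)))"


section \<open>The quaternionic unitary group\<close>

text \<open>Indices of \<open>2N \<times> 2N\<close> matrices are taken from \<open>'k + 'k\<close> with \<open>N = CARD('k)\<close>.\<close>

definition block ::
    "'t^'c^'a \<Rightarrow> 't^'d^'a \<Rightarrow> 't^'c^'b \<Rightarrow> 't^'d^'b \<Rightarrow> 't^('c::finite + 'd::finite)^('a::finite + 'b::finite)"
  where "block A B C D = (\<chi> i j.
    case i of
      Inl a \<Rightarrow> (case j of Inl c \<Rightarrow> A $ a $ c | Inr d \<Rightarrow> B $ a $ d)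
    | Inr b \<Rightarrow> (case j of Inl c \<Rightarrow> C $ b $ c | Inr d \<Rightarrow> D $ b $ d))"

definition conj_mat :: "complex^'n^'m \<Rightarrow> complex^'n^'m"
  where "conj_mat A = (\<chi> i j. cnj (A $ i $ j))"

definition adj :: "complex^'n^'m \<Rightarrow> complex^'m^'n"
  where "adj A = transpose (conj_mat A)"

definition quaternionic :: "(complex^('k::finite + 'k)^('k + 'k)) set"
  where "quaternionic = {block z w (- conj_mat w) (conj_mat z) | z w. True}"

definition Sp :: "(complex^('k::finite + 'k)^('k + 'k)) set"
  where "Sp = {q \<in> quaternionic. adj q ** q = mat 1 \<and> q ** adj q = mat 1}"

definition sp_algebra :: "(complex^('k::finite + 'k)^('k + 'k)) set"
  where "sp_algebra = {X \<in> quaternionic. adj X = - X}"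

definition Sp_tangent ::
    "complex^('k::finite + 'k)^('k + 'k) \<Rightarrow> (complex^('k + 'k)^('k + 'k)) set"
  where "Sp_tangent q = (\<lambda>X. q ** X) ` sp_algebra"

text \<open>For \<open>v = q X\<close> with \<open>q\<close> unitary, \<open>X = adj q ** v\<close>.\<close>

definition Sp_metric ::
    "complex^('k::finite + 'k)^('k + 'k) \<Rightarrow> complex^('k + 'k)^('k + 'k) \<Rightarrow>
     complex^('k + 'k)^('k + 'k) \<Rightarrow> real"
  where "Sp_metric q v w = Re (trace (adj (adj q ** v) ** (adj q ** w)))"


section \<open>The quaternionic Grassmannian\<close>

type_synonym ('m, 'n) qmat = "complex^(('m + 'n) + ('m + 'n))^(('m + 'n) + ('m + 'n))"

definition I_mn :: "complex^('m::finite + 'n::finite)^('m + 'n)"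
  where "I_mn = block (mat 1) 0 0 (- mat 1)"

definition I_tilde :: "('m::finite, 'n::finite) qmat"
  where "I_tilde = block I_mn 0 0 I_mn"

definition Sp_Sp :: "('m::finite, 'n::finite) qmat set"
  where "Sp_Sp = {k \<in> Sp. I_tilde ** k ** I_tilde = k}"

definition natural_proj :: "('m::finite, 'n::finite) qmat \<Rightarrow> ('m, 'n) qmat set"
  where "natural_proj q = (\<lambda>k. q ** k) ` Sp_Sp"

definition Sp_quotient :: "('m::finite, 'n::finite) qmat set set"
  where "Sp_quotient = natural_proj ` Sp"

text \<open>The smooth structure and the metric of the quotient are determined by the requirement that
  the natural projection is a Riemannian submersion.\<close>

definition quaternionic_grassmannian ::
    "(('m::finite, 'n::finite) qmat set, 'e::euclidean_space) riem \<Rightarrow> bool"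
  where "quaternionic_grassmannian M \<longleftrightarrow>
    points M = Sp_quotient \<and> riemannian_manifold M \<and>
    riemannian_submersion Sp Sp_tangent Sp_metric natural_proj M"

definition psi ::
    "('m::finite + 'n::finite) + ('m + 'n) \<Rightarrow> ('m + 'n) + ('m + 'n) \<Rightarrow> ('m, 'n) qmat \<Rightarrow> complex"
  where "psi j \<alpha> q = 1 / 2 * (q ** I_tilde ** adj q + mat 1) $ j $ \<alpha>"

text \<open>The function induced by \<open>psi j \<alpha>\<close>, which is constant on each coset.\<close>

definition psi_hat ::
    "('m::finite + 'n::finite) + ('m + 'n) \<Rightarrow> ('m + 'n) + ('m + 'n) \<Rightarrow> ('m, 'n) qmat set \<Rightarrow> complex"
  where "psi_hat j \<alpha> x = the_elem (psi j \<alpha> ` x)"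

definition E_family ::
    "('m::finite + 'n::finite) + ('m + 'n) \<Rightarrow> (('m, 'n) qmat set \<Rightarrow> complex) set"
  where "E_family \<alpha> = {psi_hat j \<alpha> | j. j \<noteq> \<alpha>}"

end

theory Submission
  imports Defs
begin

text \<open>
  The map \<open>q \<mapsto> q \<cdot> I_tilde \<cdot> adj q\<close> embeds the quaternionic Grassmannian into the quaternionic
  Hermitian matrices \<open>P\<close> with \<open>P\<^sup>2 = 1\<close>; let \<open>\<Phi>\<close> be this embedding in a chart.  If \<open>X\<close> is
  horizontal at \<open>q\<close>, then \<open>d\<Phi>\<close> maps it to \<open>2 q X I_tilde (adj q)\<close>, so the metric is a quarter of the
  Euclidean one pulled back along \<open>\<Phi>\<close>.  The Hessian of \<open>\<Phi>\<close> is therefore the normal part of its second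
  derivative, and differentiating \<open>\<Phi>\<^sup>2 = 1\<close> twice shows that it is
  \<open>- (d\<Phi> u d\<Phi> v + d\<Phi> v d\<Phi> u) \<Phi> / 2\<close>.  Both operators on the functions \<open>\<Phi> \<bullet> N\<close> thus reduce to the
  orthogonal projection onto the tangent space at \<open>P\<close>, which is an explicit combination of \<open>M\<close>, its adjoint,
  their quaternionic conjugates and the products \<open>P M P\<close>.
\<close>

section \<open>Calculus of finitely often differentiable maps\<close>

text \<open>The manifold \<open>M\<close> is not constructed: it is any Riemannian structure on the
  cosets for which the projection is a Riemannian submersion, so its charts are unknown. Even
  smoothness of \<open>\<Phi>\<close> must be extracted from the submersion, which calls for smooth
  local sections and hence a smooth inverse function theorem for the recursive
  \<open>C_k_on\<close>. Gradients and Christoffel symbols are definite descriptions, so unique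
  solvability against the metric comes before any computation with them.

  The two constants have separate origins. Summing products over dual frames of the tangent space at
  \<open>P\<close> gives the matrix size times \<open>mat 1\<close> minus the trace times
  \<open>P\<close>. After multiplication by \<open>P\<close> the size becomes the tension
  eigenvalue, and the trace only leaves a multiple of \<open>mat 1\<close>, which entries off the
  diagonal do not see. For the conformality operator the common column \<open>\<alpha>\<close> is
  decisive: a Hermitian quaternionic matrix vanishes at the entry (\<open>swp \<alpha>\<close>,
  \<open>\<alpha>\<close>), after which only a product of two entries of that column
  survives.\<close>

lemma C_k_on_Suc_has_derivative:
  assumes "open S" "C_k_on (Suc k) f S" "x \<in> S"
  shows "(f has_derivative frechet_derivative f (at x)) (at x)"
  using assms by (metis C_k_on.simps(2) at_within_open differentiable_on_def frechet_derivative_works)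

lemma C_k_on_frechet_derivative:
  "C_k_on (Suc k) f S \<Longrightarrow> C_k_on k (\<lambda>x. frechet_derivative f (at x) v) S"
  by (drule iffD1[OF C_k_on.simps(2)]) (erule conjE, erule spec)

lemma C_k_on_cong:
  assumes "open S" "\<And>x. x \<in> S \<Longrightarrow> f x = g x" "C_k_on k f S"
  shows "C_k_on k g S"
  using assms(2,3)
proof (induction k arbitrary: f g)
  case 0
  then show ?case by (simp cong: continuous_on_cong)
next
  case (Suc k)
  have g: "(g has_derivative frechet_derivative f (at x)) (at x)" if "x \<in> S" for x
    using has_derivative_transform_within_open[OF C_k_on_Suc_has_derivative[OF assms(1) Suc.prems(2) that] assms(1) that]
      Suc.prems(1) by blast
  have eq: "frechet_derivative f (at x) v = frechet_derivative g (at x) v" if "x \<in> S" for x v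
    using frechet_derivative_at[OF g[OF that]] by simp
  have "C_k_on k (\<lambda>x. frechet_derivative g (at x) v) S" for v
    by (rule Suc.IH[OF eq]) (use Suc.prems in \<open>simp_all only: C_k_on.simps\<close>)
  moreover have "g differentiable_on S"
    using g by (meson differentiable_at_imp_differentiable_on differentiable_def)
  ultimately show ?case by (intro iffD2[OF C_k_on.simps(2)] conjI allI)
qed

text \<open>On an open set derivatives are unique, so any explicit formula may replace
  \<open>frechet_derivative\<close>. The closure properties below use this to run a plain induction
  on \<open>k\<close>.\<close>

lemma C_k_on_SucI:
  assumes "open S" "\<And>x. x \<in> S \<Longrightarrow> (f has_derivative f' x) (at x)"
    and "\<And>v. C_k_on k (\<lambda>x. f' x v) S"
  shows "C_k_on (Suc k) f S"
proof -
  have "f' x v = frechet_derivative f (at x) v" if "x \<in> S" for x v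
    using frechet_derivative_at[OF assms(2)[OF that]] by simp
  then have "C_k_on k (\<lambda>x. frechet_derivative f (at x) v) S" for v
    by (rule C_k_on_cong[OF assms(1) _ assms(3)])
  moreover have "f differentiable_on S"
    using assms(2) by (meson differentiable_at_imp_differentiable_on differentiable_def)
  ultimately show ?thesis by (intro iffD2[OF C_k_on.simps(2)] conjI allI)
qed

lemma C_k_on_SucD: "C_k_on (Suc k) f S \<Longrightarrow> C_k_on k f S"
proof (induction k arbitrary: f)
  case 0
  then show ?case by (simp add: differentiable_imp_continuous_on)
next
  case (Suc k)
  have "C_k_on k (\<lambda>x. frechet_derivative f (at x) v) S" for v
    by (rule Suc.IH) (use Suc.prems[unfolded C_k_on.simps(2)[of "Suc k"]] in blast)
  moreover have "f differentiable_on S" using Suc.prems unfolding C_k_on.simps(2)[of "Suc k"] by (rule conjunct1)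
  ultimately show ?case unfolding C_k_on.simps(2)[of k] by blast
qed

lemma C_k_on_subset: "C_k_on k f S \<Longrightarrow> T \<subseteq> S \<Longrightarrow> C_k_on k f T"
  by (induction k arbitrary: f) (auto intro: continuous_on_subset differentiable_on_subset)

text \<open>Serves for \<open>\<Phi>\<close>, whose regularity is only accessible near one point at
  a time, through a local section chosen there.\<close>

lemma C_k_on_local:
  assumes "\<And>x. x \<in> S \<Longrightarrow> \<exists>T. open T \<and> x \<in> T \<and> C_k_on k f T"
  shows "C_k_on k f S"
  using assms
proof (induction k arbitrary: f)
  case 0
  show ?case
  proof (simp add: continuous_on_eq_continuous_within, rule)
    fix x assume "x \<in> S"
    then obtain T where "open T" "x \<in> T" "continuous_on T f" using 0 by auto
    then show "continuous (at x within S) f"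
      by (meson continuous_at_imp_continuous_at_within continuous_on_eq_continuous_at)
  qed
next
  case (Suc k)
  have "f differentiable_on S"
    unfolding differentiable_on_def
  proof
    fix x assume "x \<in> S"
    then obtain T where "open T" "x \<in> T" "C_k_on (Suc k) f T" using Suc.prems by blast
    then have "f differentiable (at x)"
      using C_k_on_Suc_has_derivative differentiableI by blast
    then show "f differentiable (at x within S)"
      by (rule differentiable_at_withinI)
  qed
  moreover have "C_k_on k (\<lambda>x. frechet_derivative f (at x) v) S" for v
    proof (rule Suc.IH)
    show "\<exists>T. open T \<and> x \<in> T \<and> C_k_on k (\<lambda>x. frechet_derivative f (at x) v) T" if "x \<in> S" for x
      using Suc.prems[OF that] by (auto simp only: C_k_on.simps)
  qed
  ultimately show ?case by simp
qed

lemma C_k_on_const: "C_k_on k (\<lambda>x. c) S"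
  by (induction k arbitrary: c) (auto intro: continuous_on_const differentiable_on_const)

lemma C_k_on_bounded_linear:
  assumes "open S" "bounded_linear T" "C_k_on k f S"
  shows "C_k_on k (\<lambda>x. T (f x)) S"
  using assms(3)
proof (induction k arbitrary: f)
  case 0
  then show ?case
    using assms(2) by (auto intro: bounded_linear.continuous_on)
next
  case (Suc k)
  show ?case
  proof (rule C_k_on_SucI[OF assms(1)])
    fix x assume "x \<in> S"
    show "((\<lambda>x. T (f x)) has_derivative (\<lambda>v. T (frechet_derivative f (at x) v))) (at x)"
      by (intro bounded_linear.has_derivative[OF assms(2)] C_k_on_Suc_has_derivative[OF assms(1) Suc.prems \<open>x \<in> S\<close>])
  qed (use Suc.prems Suc.IH in \<open>auto simp only: C_k_on.simps\<close>)
qed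

lemma C_k_on_continuous: "C_k_on k f S \<Longrightarrow> continuous_on S f"
proof (induction k)
  case (Suc k)
  then show ?case using C_k_on_SucD by blast
qed simp

lemma C_k_on_id: "open S \<Longrightarrow> C_k_on k (\<lambda>x. x) S"
  by (cases k) (simp_all add: C_k_on_const differentiable_on_ident)

lemma C_k_on_linear: "open S \<Longrightarrow> bounded_linear T \<Longrightarrow> C_k_on k T S"
  using C_k_on_bounded_linear[OF _ _ C_k_on_id] by blast

lemma C_k_on_add:
  assumes "open S" "C_k_on k f S" "C_k_on k g S"
  shows "C_k_on k (\<lambda>x. f x + g x) S"
  using assms(2,3)
proof (induction k arbitrary: f g)
  case 0
  then show ?case by (auto intro: continuous_intros)
next
  case (Suc k)
  show ?case
  proof (rule C_k_on_SucI[OF assms(1)])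
    fix x assume "x \<in> S"
    show "((\<lambda>x. f x + g x) has_derivative
        (\<lambda>v. frechet_derivative f (at x) v + frechet_derivative g (at x) v)) (at x)"
      by (intro has_derivative_add C_k_on_Suc_has_derivative[OF assms(1) _ \<open>x \<in> S\<close>]) (fact Suc.prems)+
  qed (intro Suc.IH C_k_on_frechet_derivative Suc.prems)
qed

lemma C_k_on_sum:
  assumes "open S" "\<And>i. i \<in> I \<Longrightarrow> C_k_on k (f i) S"
  shows "C_k_on k (\<lambda>x. \<Sum>i\<in>I. f i x) S"
  using assms(2)
  by (induction I rule: infinite_finite_induct)
    (auto intro: C_k_on_const C_k_on_add[OF assms(1)])

lemma C_k_on_bilinear:
  assumes "open S" "bounded_bilinear B" "C_k_on k f S" "C_k_on k g S"
  shows "C_k_on k (\<lambda>x. B (f x) (g x)) S"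
  using assms(3,4)
proof (induction k arbitrary: f g)
  case 0
  then show ?case using bounded_bilinear.continuous_on[OF assms(2)] by auto
next
  case (Suc k)
  show ?case
  proof (rule C_k_on_SucI[OF assms(1)])
    fix x assume "x \<in> S"
    show "((\<lambda>x. B (f x) (g x)) has_derivative
        (\<lambda>v. B (f x) (frechet_derivative g (at x) v) + B (frechet_derivative f (at x) v) (g x))) (at x)"
      by (intro bounded_bilinear.FDERIV[OF assms(2)] C_k_on_Suc_has_derivative[OF assms(1) _ \<open>x \<in> S\<close>])
        (fact Suc.prems)+
  next
    fix v
    show "C_k_on k (\<lambda>x. B (f x) (frechet_derivative g (at x) v) + B (frechet_derivative f (at x) v) (g x)) S"
      by (intro C_k_on_add[OF assms(1)] Suc.IH C_k_on_frechet_derivative Suc.prems C_k_on_SucD[OF Suc.prems(1)]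
          C_k_on_SucD[OF Suc.prems(2)])
  qed
qed

text \<open>\<open>C_k_on\<close> controls derivatives in fixed directions only. A derivative in a
  direction depending on \<open>x\<close> is therefore expanded over \<open>Basis\<close>, which
  produces sums of this shape.\<close>

lemma C_k_on_inner_scaleR_sum:
  assumes S: "open S" and "C_k_on k f S" "\<And>b. b \<in> Basis \<Longrightarrow> C_k_on k (g b) S"
  shows "C_k_on k (\<lambda>x. \<Sum>b\<in>Basis. (f x \<bullet> b) *\<^sub>R g b x) S"
proof (rule C_k_on_sum[OF S])
  fix b :: 'b assume b: "b \<in> Basis"
  have "C_k_on k (\<lambda>x. f x \<bullet> b) S"
    by (rule C_k_on_bounded_linear[OF S bounded_linear_inner_left assms(2)])
  then show "C_k_on k (\<lambda>x. (f x \<bullet> b) *\<^sub>R g b x) S"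
    by (rule C_k_on_bilinear[OF S bounded_bilinear_scaleR]) (rule assms(3)[OF b])
qed

lemma linear_euclidean_sum:
  fixes f :: "'a::euclidean_space \<Rightarrow> 'b::real_vector"
  assumes "linear f"
  shows "f x = (\<Sum>b\<in>Basis. (x \<bullet> b) *\<^sub>R f b)"
proof -
  have "f x = f (\<Sum>b\<in>Basis. (x \<bullet> b) *\<^sub>R b)" by (simp add: euclidean_representation)
  also have "\<dots> = (\<Sum>b\<in>Basis. (x \<bullet> b) *\<^sub>R f b)"
    by (simp add: linear_sum[OF assms] linear_scale[OF assms])
  finally show ?thesis .
qed

lemma C_k_on_compose:
  fixes f :: "'a::euclidean_space \<Rightarrow> 'b::real_normed_vector"
  assumes "open S" "open T" "C_k_on k f T" "C_k_on k g S" "g ` S \<subseteq> T"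
  shows "C_k_on k (\<lambda>x. f (g x)) S"
  using assms(3,4)
proof (induction k arbitrary: f)
  case 0
  have "continuous_on T f" "continuous_on S g"
    using 0 by (auto dest: C_k_on_continuous)
  then show ?case unfolding C_k_on.simps
    by (rule continuous_on_compose2) (rule assms(5))
next
  case (Suc k)
  have g: "C_k_on k g S" by (rule C_k_on_SucD[OF Suc.prems(2)])
  show ?case
  proof (rule C_k_on_SucI[OF assms(1)])
    fix x assume x: "x \<in> S"
    then have gx: "g x \<in> T" using assms(5) by auto
    have df: "(f has_derivative frechet_derivative f (at (g x))) (at (g x))"
      by (rule C_k_on_Suc_has_derivative[OF assms(2) Suc.prems(1) gx])
    \<comment> \<open>The chain rule applies the derivative of \<open>f\<close> to a direction that
      varies with \<open>x\<close>; expanding it over \<open>Basis\<close> leaves fixed directions,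
      to which the induction hypothesis applies.\<close>
    show "((\<lambda>x. f (g x)) has_derivative (\<lambda>v. \<Sum>b\<in>Basis.
        (frechet_derivative g (at x) v \<bullet> b) *\<^sub>R frechet_derivative f (at (g x)) b)) (at x)"
      by (rule has_derivative_eq_rhs[OF has_derivative_compose[OF
          C_k_on_Suc_has_derivative[OF assms(1) Suc.prems(2) x] df]])
        (rule ext, rule linear_euclidean_sum[OF has_derivative_linear[OF df]])
  next
    fix v
    show "C_k_on k (\<lambda>x. \<Sum>b\<in>Basis. (frechet_derivative g (at x) v \<bullet> b) *\<^sub>R
        frechet_derivative f (at (g x)) b) S"
    proof (rule C_k_on_inner_scaleR_sum[OF assms(1)])
      show "C_k_on k (\<lambda>x. frechet_derivative g (at x) v) S"
        by (rule C_k_on_frechet_derivative[OF Suc.prems(2)])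
      show "C_k_on k (\<lambda>x. frechet_derivative f (at (g x)) b) S" for b
        by (rule Suc.IH[OF C_k_on_frechet_derivative[OF Suc.prems(1)] g])
    qed
  qed
qed

section \<open>Inverses of families of linear maps\<close>

lemma linear_two_sided_inverse:
  assumes "linear f" "\<And>v. f (g v) = v" "\<And>v. g (f v) = v"
  shows "linear g"
proof (rule linearI)
  fix a b c
  have "g (f (g a) + f (g b)) = g a + g b"
    by (simp only: linear_add[OF assms(1), symmetric] assms(3))
  then show "g (a + b) = g a + g b" by (simp only: assms(2))
  have "g (c *\<^sub>R f (g a)) = c *\<^sub>R g a"
    by (simp only: linear_scale[OF assms(1), symmetric] assms(3))
  then show "g (c *\<^sub>R a) = c *\<^sub>R g a" by (simp only: assms(2))
qed

text \<open>\<open>A a\<close> is bounded below by some \<open>m > 0\<close>. Where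
  \<open>A x\<close> differs from it by less than \<open>m / 2\<close> in norm, \<open>A x\<close>
  is bounded below by \<open>m / 2\<close>, and applying this to \<open>B x u - B a u\<close>, whose
  image is \<open>u - A x (B a u)\<close>, bounds the difference of the inverses.\<close>

lemma continuous_on_inverse_family:
  fixes A B :: "'c::real_normed_vector \<Rightarrow> 'b::euclidean_space \<Rightarrow> 'b"
  assumes lA: "\<And>x. x \<in> S \<Longrightarrow> linear (A x)"
    and AB: "\<And>x v. x \<in> S \<Longrightarrow> A x (B x v) = v" and BA: "\<And>x v. x \<in> S \<Longrightarrow> B x (A x v) = v"
    and "open S" "\<And>v. continuous_on S (\<lambda>x. A x v)"
  shows "continuous_on S (\<lambda>x. B x u)"
proof -
  have "isCont (\<lambda>x. B x u) a" if a: "a \<in> S" for a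
  proof -
    obtain m where m: "m > 0" "\<And>v. norm (A a v) \<ge> m * norm v"
      using linear_inj_bounded_below_pos[OF lA[OF a] inj_on_inverseI[of UNIV "B a", OF BA[OF a]]] by blast
    \<comment> \<open>A bound for the operator norm of \<open>A x - A a\<close> that tends to 0 by
      continuity on the finitely many basis vectors alone.\<close>
    define D where "D x = (\<Sum>b\<in>Basis. norm (A x b - A a b))" for x
    have D: "norm (A x v - A a v) \<le> D x * norm v" if "x \<in> S" for x v
    proof -
      have "A x v - A a v = (\<Sum>b\<in>Basis. (v \<bullet> b) *\<^sub>R (A x b - A a b))"
        unfolding linear_euclidean_sum[OF lA[OF that], of v] linear_euclidean_sum[OF lA[OF a], of v]
        by (simp add: scaleR_right_diff_distrib sum_subtractf)
      also have "norm \<dots> \<le> (\<Sum>b\<in>Basis. norm v * norm (A x b - A a b))"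
        by (intro order.trans[OF norm_sum] sum_mono) (auto intro!: mult_right_mono Basis_le_norm)
      finally show ?thesis by (simp add: D_def sum_distrib_left mult.commute)
    qed
    have cA: "isCont (\<lambda>x. A x v) a" for v
      using assms(4,5) a by (simp add: continuous_on_eq_continuous_at)
    have "(D \<longlongrightarrow> (\<Sum>b\<in>Basis. norm (A a b - A a b))) (at a)"
      unfolding D_def by (intro tendsto_intros isContD cA)
    then have D0: "(D \<longlongrightarrow> 0) (at a)" by simp
    have evS: "\<forall>\<^sub>F x in at a. x \<in> S"
      using assms(4) a by (simp add: eventually_at_topological) blast
    have "\<forall>\<^sub>F x in at a. D x < m / 2"
      using order_tendstoD(2)[OF D0, of "m / 2"] m by simp
    then have "\<forall>\<^sub>F x in at a. norm (B x u - B a u) \<le> (2 / m) * norm (A x (B a u) - u)"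
      using evS
    proof eventually_elim
      case (elim x)
      define z where "z = B x u - B a u"
      have "m * norm z \<le> norm (A a z)" by (rule m)
      also have "\<dots> \<le> norm (A x z) + norm (A x z - A a z)"
        using norm_triangle_sub[of "A a z" "A x z"] by (simp add: norm_minus_commute)
      also have "\<dots> \<le> norm (A x z) + m / 2 * norm z"
        using D[OF elim(2), of z] elim(1) mult_right_mono[of "D x" "m/2" "norm z"] by simp
      finally have "m / 2 * norm z \<le> norm (A x z)" by simp
      moreover have "A x z = u - A x (B a u)"
        unfolding z_def using lA[OF elim(2)] AB[OF elim(2)] by (simp add: linear_diff)
      ultimately have "m / 2 * norm (B x u - B a u) \<le> norm (A x (B a u) - u)"
        by (simp add: z_def norm_minus_commute)
      then show ?case using m(1) by (simp add: field_simps)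
    qed
    moreover have "((\<lambda>x. (2 / m) * norm (A x (B a u) - u)) \<longlongrightarrow> (2/m) * norm (A a (B a u) - u)) (at a)"
      by (intro tendsto_intros isContD cA)
    ultimately have "((\<lambda>x. B x u - B a u) \<longlongrightarrow> 0) (at a)"
      using Lim_null_comparison by (fastforce simp: AB[OF a])
    then show ?thesis by (simp add: isCont_def LIM_zero_iff)
  qed
  then show ?thesis by (simp add: continuous_at_imp_continuous_on)
qed

text \<open>A product rule in which \<open>g\<close> need only be continuous: as \<open>f\<close>
  vanishes at \<open>a\<close>, the increments of \<open>g\<close> contribute only a product of two
  small factors.\<close>

lemma has_derivative_scaleR_vanishing:
  fixes f :: "'a::real_normed_vector \<Rightarrow> real" and g :: "'a \<Rightarrow> 'b::real_normed_vector"
  assumes f: "(f has_derivative f') (at a)" "f a = 0" and g: "isCont g a"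
  shows "((\<lambda>x. f x *\<^sub>R g x) has_derivative (\<lambda>h. f' h *\<^sub>R g a)) (at a)"
proof -
  have lf: "bounded_linear f'" using f(1) by (rule has_derivative_bounded_linear)
  then obtain K where K: "\<And>h. norm (f' h) \<le> norm h * K" "K \<ge> 0"
    using bounded_linear.nonneg_bounded by blast
  have *: "((\<lambda>h. norm (f (a + h) - f a - f' h) / norm h) \<longlongrightarrow> 0) (at 0)"
    using f(1) by (simp add: has_derivative_at)
  have gc: "((\<lambda>h. g (a + h)) \<longlongrightarrow> g a) (at 0)"
    using g by (simp add: isCont_iff LIM_offset_zero_iff)
  have "((\<lambda>h. norm (f (a + h) - f a - f' h) / norm h * norm (g (a + h)) + K * norm (g (a + h) - g a))
      \<longlongrightarrow> 0 * norm (g a) + K * norm (g a - g a)) (at 0)"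
    by (intro tendsto_intros * gc)
  then have lim: "((\<lambda>h. norm (f (a + h) - f a - f' h) / norm h * norm (g (a + h)) + K * norm (g (a + h) - g a))
      \<longlongrightarrow> 0) (at 0)" by simp
  have "((\<lambda>h. norm (f (a + h) *\<^sub>R g (a + h) - f a *\<^sub>R g a - f' h *\<^sub>R g a) / norm h) \<longlongrightarrow> 0) (at 0)"
  proof (rule Lim_null_comparison[OF always_eventually lim], rule)
    fix h
    show "norm (norm (f (a + h) *\<^sub>R g (a + h) - f a *\<^sub>R g a - f' h *\<^sub>R g a) / norm h)
      \<le> norm (f (a + h) - f a - f' h) / norm h * norm (g (a + h)) + K * norm (g (a + h) - g a)"
    proof (cases "h = 0")
      case False
      have "f (a + h) *\<^sub>R g (a + h) - f a *\<^sub>R g a - f' h *\<^sub>R g a =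
        (f (a + h) - f a - f' h) *\<^sub>R g (a + h) + f' h *\<^sub>R (g (a + h) - g a)"
        using f(2) by (simp add: algebra_simps)
      then have "norm (f (a + h) *\<^sub>R g (a + h) - f a *\<^sub>R g a - f' h *\<^sub>R g a) \<le>
        norm (f (a + h) - f a - f' h) * norm (g (a + h)) + norm (f' h) * norm (g (a + h) - g a)"
        by (metis norm_scaleR norm_triangle_ineq real_norm_def)
      also have "\<dots> \<le> norm (f (a + h) - f a - f' h) * norm (g (a + h)) + norm h * K * norm (g (a + h) - g a)"
        by (intro add_left_mono mult_right_mono K) auto
      finally show ?thesis using False by (simp add: field_simps)
    qed (auto simp: K(2))
  qed
  moreover have "bounded_linear (\<lambda>h. f' h *\<^sub>R g a)"
    by (rule bounded_linear_scaleR_const[OF lf])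
  ultimately show ?thesis by (simp add: has_derivative_at)
qed

text \<open>With the residual \<open>r x = A x (B a u) - u\<close> one has
  \<open>B x u = B a u - B x (r x)\<close>. Since \<open>r a = 0\<close>, the last term can be
  differentiated although \<open>B\<close> is so far known to be continuous only.\<close>

lemma has_derivative_inverse_family:
  fixes A B :: "'c::real_normed_vector \<Rightarrow> 'b::euclidean_space \<Rightarrow> 'b"
  assumes lA: "\<And>x. x \<in> S \<Longrightarrow> linear (A x)"
    and AB: "\<And>x v. x \<in> S \<Longrightarrow> A x (B x v) = v" and BA: "\<And>x v. x \<in> S \<Longrightarrow> B x (A x v) = v"
    and S: "open S" and cA: "\<And>v. continuous_on S (\<lambda>x. A x v)"
    and a: "a \<in> S" and dA: "((\<lambda>x. A x (B a u)) has_derivative A') (at a)"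
  shows "((\<lambda>x. B x u) has_derivative (\<lambda>h. - B a (A' h))) (at a)"
proof -
  have lB: "linear (B x)" if "x \<in> S" for x
    using linear_two_sided_inverse[OF lA AB BA] that by blast
  note B_sum = linear_euclidean_sum[OF lB, symmetric]
  define r where "r x = A x (B a u) - u" for x
  have r: "(r has_derivative A') (at a)"
    unfolding r_def using has_derivative_diff[OF dA has_derivative_const[of u]] by simp
  have "isCont (\<lambda>x. B x b) a" for b
    using continuous_on_inverse_family[OF lA AB BA S cA] a S
    by (simp add: continuous_on_eq_continuous_at)
  then have "((\<lambda>x. \<Sum>b\<in>Basis. (r x \<bullet> b) *\<^sub>R B x b) has_derivative (\<lambda>h. \<Sum>b\<in>Basis. (A' h \<bullet> b) *\<^sub>R B a b)) (at a)"
    using AB[OF a] by (intro has_derivative_sum has_derivative_scaleR_vanishing has_derivative_inner_left r)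
      (auto simp: r_def)
  then have "((\<lambda>x. \<Sum>b\<in>Basis. (r x \<bullet> b) *\<^sub>R B x b) has_derivative (\<lambda>h. B a (A' h))) (at a)"
    by (simp only: B_sum[OF a])
  then have "((\<lambda>x. B x (r x)) has_derivative (\<lambda>h. B a (A' h))) (at a)"
    by (rule has_derivative_transform_within_open[OF _ S a]) (rule B_sum)
  then have "((\<lambda>x. B a u - B x (r x)) has_derivative (\<lambda>h. 0 - B a (A' h))) (at a)"
    by (intro has_derivative_diff has_derivative_const)
  then have "((\<lambda>x. B x u) has_derivative (\<lambda>h. 0 - B a (A' h))) (at a)"
    by (rule has_derivative_transform_within_open[OF _ S a]) (simp add: r_def linear_diff[OF lB] BA)
  then show ?thesis by simp
qed

text \<open>Bootstrapping: the derivative of the inverse is \<open>- B A' B\<close>, which involves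
  no derivative of \<open>B\<close> and so inherits the regularity already known for
  \<open>B\<close>.\<close>

lemma C_k_on_inverse_family:
  fixes A B :: "'c::real_normed_vector \<Rightarrow> 'b::euclidean_space \<Rightarrow> 'b"
  assumes lA: "\<And>x. x \<in> S \<Longrightarrow> linear (A x)"
    and AB: "\<And>x v. x \<in> S \<Longrightarrow> A x (B x v) = v" and BA: "\<And>x v. x \<in> S \<Longrightarrow> B x (A x v) = v"
    and S: "open S" and "\<And>v. C_k_on k (\<lambda>x. A x v) S"
  shows "C_k_on k (\<lambda>x. B x u) S"
  using assms(5)
proof (induction k arbitrary: u)
  case 0
  have "continuous_on S (\<lambda>x. A x v)" for v
    by (rule C_k_on_continuous[OF 0])
  with continuous_on_inverse_family[of S A B, OF lA AB BA S] show ?case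
    unfolding C_k_on.simps by blast
next
  case (Suc k)
  have lB: "linear (B x)" if "x \<in> S" for x
    using linear_two_sided_inverse[OF lA AB BA] that by blast
  note B_sum = linear_euclidean_sum[OF lB, symmetric]
  have cA: "continuous_on S (\<lambda>x. A x v)" for v
    by (rule C_k_on_continuous[OF Suc.prems])
  have Bk: "C_k_on k (\<lambda>x. B x v) S" for v
    by (rule Suc.IH[OF C_k_on_SucD[OF Suc.prems]])
  define dA where "dA x v h = frechet_derivative (\<lambda>x. A x v) (at x) h" for x v h
  have dA: "((\<lambda>x. A x v) has_derivative dA x v) (at x)" if "x \<in> S" for x v
    unfolding dA_def by (rule C_k_on_Suc_has_derivative[OF S Suc.prems that])
  \<comment> \<open>Linearity of the derivative in the argument \<open>v\<close>, needed because
    \<open>dA\<close> is next evaluated at the moving vector \<open>B x u\<close>.\<close>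
  have dA_lin: "dA x v h = (\<Sum>b\<in>Basis. (v \<bullet> b) *\<^sub>R dA x b h)" if "x \<in> S" for x v h
  proof -
    have "((\<lambda>x. \<Sum>b\<in>Basis. (v \<bullet> b) *\<^sub>R A x b) has_derivative (\<lambda>h. \<Sum>b\<in>Basis. (v \<bullet> b) *\<^sub>R dA x b h)) (at x)"
      by (intro has_derivative_sum has_derivative_scaleR_right dA that)
    then have "((\<lambda>x. A x v) has_derivative (\<lambda>h. \<Sum>b\<in>Basis. (v \<bullet> b) *\<^sub>R dA x b h)) (at x)"
      by (rule has_derivative_transform_within_open[OF _ S that]) (rule linear_euclidean_sum[OF lA, symmetric])
    then have "dA x v = (\<lambda>h. \<Sum>b\<in>Basis. (v \<bullet> b) *\<^sub>R dA x b h)"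
      using dA[OF that] has_derivative_unique by blast
    then show ?thesis by meson
  qed
  show ?case
  proof (rule C_k_on_SucI[OF S])
    fix x assume x: "x \<in> S"
    show "((\<lambda>x. B x u) has_derivative (\<lambda>h. - B x (dA x (B x u) h))) (at x)"
      by (rule has_derivative_inverse_family[OF lA AB BA S cA x dA[OF x]])
  next
    fix h
    have "C_k_on k (\<lambda>x. dA x b h) S" for b
      unfolding dA_def by (intro C_k_on_frechet_derivative Suc.prems)
    then have "C_k_on k (\<lambda>x. \<Sum>b\<in>Basis. (B x u \<bullet> b) *\<^sub>R dA x b h) S"
      by (intro C_k_on_inner_scaleR_sum[OF S Bk])
    then have dk: "C_k_on k (\<lambda>x. dA x (B x u) h) S"
    proof (rule C_k_on_cong[OF S, rotated])
      show "(\<Sum>b\<in>Basis. (B x u \<bullet> b) *\<^sub>R dA x b h) = dA x (B x u) h" if "x \<in> S" for x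
        by (rule dA_lin[OF that, symmetric])
    qed
    show "C_k_on k (\<lambda>x. - B x (dA x (B x u) h)) S"
    proof (rule C_k_on_cong[OF S])
      show "C_k_on k (\<lambda>x. - (\<Sum>b\<in>Basis. (dA x (B x u) h \<bullet> b) *\<^sub>R B x b)) S"
        by (rule C_k_on_bounded_linear[OF S bounded_linear_minus[OF bounded_linear_ident]
          C_k_on_inner_scaleR_sum[OF S dk Bk]])
    qed (simp only: B_sum)
  qed
qed

section \<open>The smooth inverse function theorem\<close>

lemma smooth_on_has_derivative:
  assumes "open S" "smooth_on f S" "x \<in> S"
  shows "(f has_derivative frechet_derivative f (at x)) (at x)"
  using assms(2) C_k_on_Suc_has_derivative[OF assms(1) _ assms(3), where k = 0]
  unfolding smooth_on_def by blast

lemma smooth_on_frechet_derivative: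
  assumes "smooth_on f S"
  shows "smooth_on (\<lambda>x. frechet_derivative f (at x) v) S"
  unfolding smooth_on_def
  by (rule allI, rule C_k_on_frechet_derivative) (rule spec[OF assms[unfolded smooth_on_def]])

text \<open>The inverse function theorem yields a differentiable local inverse \<open>g\<close>
  whose derivative at \<open>y\<close> inverts that of \<open>f\<close> at \<open>g y\<close>. If
  \<open>g\<close> is \<open>C_k_on k\<close>, so is this family of inverses, whence
  \<open>g\<close> is \<open>C_k_on (Suc k)\<close>.\<close>

lemma smooth_on_local_inverse:
  fixes f :: "'a::euclidean_space \<Rightarrow> 'a"
  assumes S: "open S" "a \<in> S" and f: "smooth_on f S"
    and f': "(f has_derivative f') (at a)" and h: "bounded_linear h" "\<And>v. h (f' v) = v"
  obtains U V g where "open U" "U \<subseteq> S" "a \<in> U" "open V" "f a \<in> V" "\<And>y. y \<in> V \<Longrightarrow> g y \<in> U"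
    "\<And>y. y \<in> V \<Longrightarrow> f (g y) = y" "smooth_on g V"
proof -
  define D where "D x = Blinfun (frechet_derivative f (at x))" for x
  have D: "blinfun_apply (D x) = frechet_derivative f (at x)" if "x \<in> S" for x
    unfolding D_def
    using smooth_on_has_derivative[OF S(1) f that] bounded_linear_Blinfun_apply has_derivative_bounded_linear by blast
  have "continuous_on S (\<lambda>x. frechet_derivative f (at x) v)" for v
    using C_k_on_continuous smooth_on_frechet_derivative[OF f] unfolding smooth_on_def by blast
  then have "continuous_on S (\<lambda>x. blinfun_apply (D x) v)" for v
    by (simp add: D cong: continuous_on_cong_simp)
  then have contD: "continuous_on S D"
    by (rule continuous_on_blinfun_componentwise)
  have inv: "Blinfun h o\<^sub>L D a = id_blinfun"
    using h D[OF S(2)] frechet_derivative_at[OF f']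
    by (auto intro!: blinfun_eqI simp: bounded_linear_Blinfun_apply)
  have derD: "(f has_derivative blinfun_apply (D x)) (at x)" if "x \<in> S" for x
    using smooth_on_has_derivative[OF S(1) f that] by (simp add: D that)
  obtain U V g g' where U: "open U" "U \<subseteq> S" "a \<in> U" "open V" "f a \<in> V" "homeomorphism U V f g"
    and g: "\<And>y. y \<in> V \<Longrightarrow> (g has_derivative (g' y)) (at y)"
    and g': "\<And>y. y \<in> V \<Longrightarrow> g' y = inv (blinfun_apply (D (g y)))"
    and bij: "\<And>y. y \<in> V \<Longrightarrow> bij (blinfun_apply (D (g y)))"
    using inverse_function_theorem[OF S(1) derD contD S(2) inv] by blast
  have gU: "g y \<in> U" if "y \<in> V" for y
    using U(6) that by (auto simp: homeomorphism_def)
  have "C_k_on k g V" for k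
  proof (induction k)
    case 0
    show ?case
      unfolding C_k_on.simps by (rule has_derivative_continuous_on[OF has_derivative_at_withinI[OF g]])
  next
    case (Suc k)
    define A where "A y = frechet_derivative f (at (g y))" for y
    have A: "A y = blinfun_apply (D (g y))" if "y \<in> V" for y
      using D gU[OF that] U(2) by (auto simp: A_def)
    have lA: "linear (A y)" if "y \<in> V" for y
      unfolding A[OF that] by (simp add: blinfun.bounded_linear_right bounded_linear.linear)
    have AB: "A y (g' y v) = v" "g' y (A y v) = v" if "y \<in> V" for y v
      unfolding A[OF that] g'[OF that] using bij[OF that]
      by (simp_all add: bij_def surj_f_inv_f)
    have Ak: "C_k_on k (\<lambda>y. A y v) V" for v
      unfolding A_def
      by (rule C_k_on_compose[OF U(4) S(1) _ Suc.IH])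
        (use smooth_on_frechet_derivative[OF f, of v, unfolded smooth_on_def] gU U(2) in auto)
    show ?case
      by (rule C_k_on_SucI[OF U(4) g C_k_on_inverse_family[OF lA AB U(4) Ak]])
  qed
  then have "smooth_on g V" by (simp add: smooth_on_def)
  moreover have "f (g y) = y" if "y \<in> V" for y
    using U(6) that by (auto simp: homeomorphism_def)
  ultimately show thesis using that U gU by blast
qed

section \<open>Symmetry of second derivatives\<close>

lemma has_real_derivative_along_line:
  fixes f :: "'a::real_normed_vector \<Rightarrow> real"
  assumes "(f has_derivative f') (at (p + s *\<^sub>R u))"
  shows "((\<lambda>s. f (p + s *\<^sub>R u)) has_real_derivative f' u) (at s)"
proof -
  have "((\<lambda>s. p + s *\<^sub>R u) has_derivative (\<lambda>h. h *\<^sub>R u)) (at s)"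
    by (auto intro!: derivative_eq_intros)
  from has_derivative_compose[OF this assms]
  have "((\<lambda>s. f (p + s *\<^sub>R u)) has_derivative (\<lambda>h. f' (h *\<^sub>R u))) (at s)" .
  moreover have "f' (h *\<^sub>R u) = f' u * h" for h
    using linear_scale[OF has_derivative_linear[OF assms]] by (simp add: mult.commute)
  ultimately show ?thesis by (simp add: has_field_derivative_def)
qed

text \<open>The mean value theorem is applied twice: along \<open>u\<close> to the difference of
  \<open>f\<close> across \<open>t *\<^sub>R v\<close>, then along \<open>v\<close> to the
  derivative in direction \<open>u\<close>.\<close>

lemma second_difference_mean_value:
  fixes f :: "'a::real_normed_vector \<Rightarrow> real"
  assumes S: "open S" and f: "C_k_on 2 f S" and "t > 0"
    and inS: "\<And>s r. 0 \<le> s \<Longrightarrow> s \<le> t \<Longrightarrow> 0 \<le> r \<Longrightarrow> r \<le> t \<Longrightarrow> x + s *\<^sub>R u + r *\<^sub>R v \<in> S"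
  shows "\<exists>s r. 0 \<le> s \<and> s \<le> t \<and> 0 \<le> r \<and> r \<le> t \<and>
    f (x + t *\<^sub>R u + t *\<^sub>R v) - f (x + t *\<^sub>R u) - f (x + t *\<^sub>R v) + f x =
    t * t * frechet_derivative (\<lambda>z. frechet_derivative f (at z) u) (at (x + s *\<^sub>R u + r *\<^sub>R v)) v"
proof -
  have f2: "C_k_on (Suc (Suc 0)) f S" using f by (simp only: numeral_2_eq_2)
  note df = C_k_on_Suc_has_derivative[OF S f2]
  note ddf = C_k_on_Suc_has_derivative[OF S C_k_on_frechet_derivative[OF f2, of u]]
  define \<phi> where "\<phi> s = f ((x + t *\<^sub>R v) + s *\<^sub>R u) - f (x + s *\<^sub>R u)" for s
  define \<phi>' where "\<phi>' s = frechet_derivative f (at ((x + t *\<^sub>R v) + s *\<^sub>R u)) u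
    - frechet_derivative f (at (x + s *\<^sub>R u)) u" for s
  have "DERIV \<phi> s :> \<phi>' s" if "0 \<le> s" "s \<le> t" for s
    unfolding \<phi>_def \<phi>'_def using inS[OF that, of t] inS[OF that, of 0] \<open>t > 0\<close>
    by (intro DERIV_diff has_real_derivative_along_line df) (simp_all add: algebra_simps)
  from MVT2[OF \<open>t > 0\<close> this] obtain s where s: "0 < s" "s < t" "\<phi> t - \<phi> 0 = t * \<phi>' s" by auto
  define \<psi> where "\<psi> r = frechet_derivative f (at ((x + s *\<^sub>R u) + r *\<^sub>R v)) u" for r
  define \<psi>' where "\<psi>' r = frechet_derivative (\<lambda>z. frechet_derivative f (at z) u) (at ((x + s *\<^sub>R u) + r *\<^sub>R v)) v" for r
  have "DERIV \<psi> r :> \<psi>' r" if "0 \<le> r" "r \<le> t" for r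
    unfolding \<psi>_def \<psi>'_def using inS[OF _ _ that, of s] s
    by (intro has_real_derivative_along_line ddf) simp_all
  from MVT2[OF \<open>t > 0\<close> this] obtain r where r: "0 < r" "r < t" "\<psi> t - \<psi> 0 = t * \<psi>' r" by auto
  have "\<phi>' s = \<psi> t - \<psi> 0"
    by (simp add: \<phi>'_def \<psi>_def algebra_simps)
  then have "\<phi> t - \<phi> 0 = t * t * \<psi>' r" using s r by simp
  moreover have "\<phi> t - \<phi> 0 = f (x + t *\<^sub>R u + t *\<^sub>R v) - f (x + t *\<^sub>R u) - f (x + t *\<^sub>R v) + f x"
    by (simp add: \<phi>_def algebra_simps)
  ultimately show ?thesis using s r unfolding \<psi>'_def by (metis less_imp_le)
qed

text \<open>The second difference is symmetric in \<open>u\<close> and \<open>v\<close>, so values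
  of both mixed derivatives at points near \<open>x\<close> agree; continuity moves these points to
  \<open>x\<close>.\<close>

lemma symmetric_second_derivative:
  fixes f :: "'a::real_normed_vector \<Rightarrow> real"
  assumes S: "open S" and f: "C_k_on 2 f S" and x: "x \<in> S"
  shows "frechet_derivative (\<lambda>z. frechet_derivative f (at z) u) (at x) v =
    frechet_derivative (\<lambda>z. frechet_derivative f (at z) v) (at x) u"
proof -
  define D where "D u v z = frechet_derivative (\<lambda>z. frechet_derivative f (at z) u) (at z) v" for u v z
  have f2: "C_k_on (Suc (Suc 0)) f S" using f by (simp only: numeral_2_eq_2)
  have "continuous_on S (D u v)" for u v
    unfolding D_def by (rule C_k_on_continuous[OF C_k_on_frechet_derivative[OF C_k_on_frechet_derivative[OF f2]]])
  then have cont: "isCont (D u v) x" for u v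
    using S x by (simp add: continuous_on_eq_continuous_at)
  have le: "\<bar>D u v x - D v u x\<bar> \<le> 2 * e" if "e > 0" for e
  proof -
    obtain d1 where d1: "d1 > 0" "\<And>z. dist z x < d1 \<Longrightarrow> dist (D u v z) (D u v x) < e"
      using cont[of u v] \<open>e > 0\<close> unfolding continuous_at_eps_delta by blast
    obtain d2 where d2: "d2 > 0" "\<And>z. dist z x < d2 \<Longrightarrow> dist (D v u z) (D v u x) < e"
      using cont[of v u] \<open>e > 0\<close> unfolding continuous_at_eps_delta by blast
    obtain d3 where d3: "d3 > 0" "ball x d3 \<subseteq> S" using S x openE by blast
    define d where "d = min d1 (min d2 d3)"
    have "d > 0" using d1 d2 d3 by (simp add: d_def)
    \<comment> \<open>Small enough for the whole parallelogram spanned by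
      \<open>t *\<^sub>R u\<close> and \<open>t *\<^sub>R v\<close> at \<open>x\<close> to stay
      within distance \<open>d\<close>; the summand 1 keeps the denominator positive.\<close>
    define t where "t = d / (norm u + norm v + 1)"
    have pos: "norm u + norm v + 1 > 0" by (smt (verit) norm_ge_zero)
    then have t: "t > 0" using \<open>d > 0\<close> by (simp add: t_def)
    have near: "dist (x + s *\<^sub>R u + r *\<^sub>R v) x < d" if "0 \<le> s" "s \<le> t" "0 \<le> r" "r \<le> t" for s r
    proof -
      have "dist (x + s *\<^sub>R u + r *\<^sub>R v) x = norm (s *\<^sub>R u + r *\<^sub>R v)"
        by (simp add: dist_norm)
      also have "\<dots> \<le> s * norm u + r * norm v"
        using norm_triangle_ineq[of "s *\<^sub>R u" "r *\<^sub>R v"] that by simp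
      also have "\<dots> \<le> t * norm u + t * norm v"
        using that by (intro add_mono mult_right_mono) auto
      also have "\<dots> < t * (norm u + norm v + 1)"
        using t by (simp add: algebra_simps)
      also have "\<dots> = d" using pos by (simp add: t_def)
      finally show ?thesis .
    qed
    have inS: "x + s *\<^sub>R u + r *\<^sub>R v \<in> S" if "0 \<le> s" "s \<le> t" "0 \<le> r" "r \<le> t" for s r
      using near[OF that] d3(2) by (auto simp: d_def dist_commute subset_iff)
    have inS': "x + s *\<^sub>R v + r *\<^sub>R u \<in> S" if "0 \<le> s" "s \<le> t" "0 \<le> r" "r \<le> t" for s r
      using inS[OF that(3,4,1,2)] by (simp add: algebra_simps)
    define \<Delta> where "\<Delta> = f (x + t *\<^sub>R u + t *\<^sub>R v) - f (x + t *\<^sub>R u) - f (x + t *\<^sub>R v) + f x"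
    obtain s r where 1: "0 \<le> s" "s \<le> t" "0 \<le> r" "r \<le> t" "\<Delta> = t * t * D u v (x + s *\<^sub>R u + r *\<^sub>R v)"
      using second_difference_mean_value[OF S f t inS] unfolding D_def \<Delta>_def by blast
    obtain s' r' where 2: "0 \<le> s'" "s' \<le> t" "0 \<le> r'" "r' \<le> t"
        "f (x + t *\<^sub>R v + t *\<^sub>R u) - f (x + t *\<^sub>R v) - f (x + t *\<^sub>R u) + f x =
          t * t * D v u (x + s' *\<^sub>R v + r' *\<^sub>R u)"
      using second_difference_mean_value[OF S f t inS'] unfolding D_def by blast
    have "\<Delta> = t * t * D v u (x + r' *\<^sub>R u + s' *\<^sub>R v)"
      using 2(5) by (simp add: \<Delta>_def algebra_simps)
    then have eq: "D u v (x + s *\<^sub>R u + r *\<^sub>R v) = D v u (x + r' *\<^sub>R u + s' *\<^sub>R v)"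
      using 1(5) t by simp
    have "\<bar>D u v (x + s *\<^sub>R u + r *\<^sub>R v) - D u v x\<bar> < e"
      using d1(2) near[OF 1(1-4)] by (simp add: d_def dist_real_def)
    moreover have "\<bar>D v u (x + r' *\<^sub>R u + s' *\<^sub>R v) - D v u x\<bar> < e"
      using d2(2) near[OF 2(3,4,1,2)] by (simp add: d_def dist_real_def)
    ultimately show ?thesis using eq by linarith
  qed
  have "\<bar>D u v x - D v u x\<bar> \<le> 0"
  proof (rule field_le_epsilon)
    fix e :: real assume "e > 0"
    then show "\<bar>D u v x - D v u x\<bar> \<le> 0 + e" using le[of "e / 2"] by simp
  qed
  then show ?thesis by (simp add: D_def)
qed

section \<open>Quaternionic matrices\<close>

text \<open>Supplies real bilinearity and the product rule \<open>mm.FDERIV\<close> for matrix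
  multiplication.\<close>

interpretation mm: bounded_bilinear "(**) :: complex^'b^'a \<Rightarrow> complex^'c^'b \<Rightarrow> complex^'c^'a"
proof (rule bilinear_conv_bounded_bilinear[THEN iffD1])
  show "bilinear ((**) :: complex^'b^'a \<Rightarrow> complex^'c^'b \<Rightarrow> complex^'c^'a)"
    unfolding bilinear_def
    by (auto intro!: linearI simp: matrix_matrix_mult_def vec_eq_iff algebra_simps sum.distrib scaleR_sum_right)
qed

lemma adj_nth: "adj A $ i $ j = cnj (A $ j $ i)"
  by (simp add: adj_def conj_mat_def transpose_def)

lemma bounded_linear_adj: "bounded_linear (adj :: complex^'b^'a \<Rightarrow> complex^'a^'b)"
  by (intro linear_conv_bounded_linear[THEN iffD1] linearI) (simp_all add: vec_eq_iff adj_nth)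

lemmas adj_add = linear_add[OF bounded_linear.linear[OF bounded_linear_adj]]
  and adj_diff = linear_diff[OF bounded_linear.linear[OF bounded_linear_adj]]
  and adj_scaleR = linear_scale[OF bounded_linear.linear[OF bounded_linear_adj]]
  and adj_sum = linear_sum[OF bounded_linear.linear[OF bounded_linear_adj]]

lemma adj_adj [simp]: "adj (adj A) = A"
  by (simp add: vec_eq_iff adj_nth)

lemma adj_mat_1 [simp]: "adj (mat 1 :: complex^'n^'n) = mat 1"
  by (simp add: vec_eq_iff adj_nth mat_def)

lemma adj_mult: "adj (A ** B) = adj B ** adj A"
  by (simp add: vec_eq_iff adj_nth matrix_matrix_mult_def mult.commute)

lemma inner_complex_Re: "(x::complex) \<bullet> y = Re (cnj x * y)"
  by (simp add: inner_complex_def)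

lemma inner_matrix_sum: "(A::complex^'b^'a) \<bullet> B = (\<Sum>i\<in>UNIV. \<Sum>j\<in>UNIV. Re (cnj (A $ i $ j) * B $ i $ j))"
  by (simp add: inner_vec_def inner_complex_Re)

text \<open>Identifies the Euclidean inner product of the ambient matrix space with the trace form
  behind \<open>Sp_metric\<close>.\<close>

lemma inner_eq_Re_trace: "A \<bullet> B = Re (trace (adj A ** B))"
  for A B :: "complex^'n^'m"
  unfolding inner_matrix_sum trace_def
  by (subst sum.swap) (simp add: matrix_matrix_mult_def adj_nth)

lemma inner_mult_left: "(A ** B) \<bullet> C = B \<bullet> (adj A ** C)"
  for C :: "complex^'n^'m"
  by (simp add: inner_eq_Re_trace adj_mult matrix_mul_assoc)

lemma inner_adj: "adj A \<bullet> adj B = A \<bullet> B"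
  unfolding inner_matrix_sum by (subst sum.swap) (simp add: adj_nth)

lemma inner_mult_right: "(A ** B) \<bullet> C = A \<bullet> (C ** adj B)"
proof -
  have "(A ** B) \<bullet> C = (adj B ** adj A) \<bullet> adj C"
    by (metis adj_mult inner_adj)
  also have "\<dots> = adj A \<bullet> (B ** adj C)" by (simp add: inner_mult_left)
  also have "\<dots> = A \<bullet> (C ** adj B)" by (metis adj_mult adj_adj inner_adj)
  finally show ?thesis .
qed

section \<open>Quaternionic conjugation\<close>

definition swp :: "'k + 'k \<Rightarrow> 'k + 'k"
  where "swp i = (case i of Inl a \<Rightarrow> Inr a | Inr a \<Rightarrow> Inl a)"

text \<open>Together with \<open>swp\<close> this encodes
  \<open>J = block 0 (mat 1) (- mat 1) 0\<close>: the only nonzero entry of its row \<open>i\<close>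
  is \<open>sgi i\<close>, in column \<open>swp i\<close>.\<close>

definition sgi :: "'k + 'k \<Rightarrow> complex"
  where "sgi i = (case i of Inl a \<Rightarrow> 1 | Inr a \<Rightarrow> - 1)"

text \<open>This is \<open>J \<cdot> conj_mat M \<cdot> J\<^sup>-\<^sup>1\<close> with \<open>J = block 0 (mat 1) (- mat 1) 0\<close>.\<close>

definition qconj :: "complex^('k::finite + 'k)^('k + 'k) \<Rightarrow> complex^('k + 'k)^('k + 'k)"
  where "qconj M = (\<chi> i j. sgi i * sgi j * cnj (M $ swp i $ swp j))"

lemma swp_simps [simp]:
  "swp (Inl a) = Inr a" "swp (Inr a) = Inl a" "sgi (Inl a) = 1" "sgi (Inr a) = - 1"
  by (simp_all add: swp_def sgi_def)

lemma swp_swp [simp]: "swp (swp i) = i"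
  by (cases i) simp_all

lemma swp_neq [simp]: "swp i \<noteq> i" "i \<noteq> swp i"
  by (cases i; simp)+

lemma sgi_swp [simp]: "sgi (swp i) = - sgi i"
  by (cases i) simp_all

lemma sgi_mult_self [simp]: "sgi i * sgi i = 1" "sgi i * (sgi i * x) = x" "sgi i * (sgi j * (sgi i * sgi j)) = 1"
  by (cases i; cases j; simp)+

lemma cnj_sgi [simp]: "cnj (sgi i) = sgi i"
  by (cases i) simp_all

lemma bij_swp: "bij swp"
  by (rule o_bij[of swp]) (simp_all add: fun_eq_iff)

lemma sum_swp: "(\<Sum>i\<in>UNIV. f (swp i)) = (\<Sum>i\<in>UNIV. f i)"
  by (rule sum.reindex_bij_betw[OF bij_swp])

lemma bounded_linear_qconj: "bounded_linear (qconj :: complex^('k::finite + 'k)^('k + 'k) \<Rightarrow> _)"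
  by (intro linear_conv_bounded_linear[THEN iffD1] linearI) (simp_all add: vec_eq_iff qconj_def algebra_simps)

lemmas qconj_add = linear_add[OF bounded_linear.linear[OF bounded_linear_qconj]]
  and qconj_diff = linear_diff[OF bounded_linear.linear[OF bounded_linear_qconj]]
  and qconj_scaleR = linear_scale[OF bounded_linear.linear[OF bounded_linear_qconj]]
  and qconj_sum = linear_sum[OF bounded_linear.linear[OF bounded_linear_qconj]]

lemma qconj_qconj [simp]: "qconj (qconj A) = A"
  by (simp add: vec_eq_iff qconj_def mult_ac)

lemma qconj_mult: "qconj (A ** B) = qconj A ** qconj B"
proof -
  have "(\<Sum>k\<in>UNIV. sgi i * sgi j * (cnj (A $ swp i $ k) * cnj (B $ k $ swp j))) =
    (\<Sum>k\<in>UNIV. sgi i * sgi j * (cnj (A $ swp i $ swp k) * cnj (B $ swp k $ swp j)))" for i j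
    by (rule sum_swp[symmetric])
  moreover have "sgi i * sgi j * (x * y) = sgi i * sgi k * x * (sgi k * sgi j * y)" for i j k :: "'a + 'a" and x y
    by (cases k) simp_all
  ultimately have "(\<Sum>k\<in>UNIV. sgi i * sgi j * (cnj (A $ swp i $ k) * cnj (B $ k $ swp j))) =
    (\<Sum>k\<in>UNIV. sgi i * sgi k * cnj (A $ swp i $ swp k) * (sgi k * sgi j * cnj (B $ swp k $ swp j)))" for i j
    by (metis (no_types, lifting) sum.cong)
  then show ?thesis
    by (simp add: vec_eq_iff qconj_def matrix_matrix_mult_def sum_distrib_left)
qed

lemma qconj_mat_1 [simp]: "qconj (mat 1) = mat 1"
proof -
  have "swp i = swp j \<longleftrightarrow> i = j" for i j :: "'a + 'a" by (metis swp_swp)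
  then show ?thesis by (simp add: vec_eq_iff qconj_def mat_def)
qed

lemma qconj_adj: "qconj (adj A) = adj (qconj A)"
  by (simp add: vec_eq_iff qconj_def adj_nth mult.commute)

lemma inner_qconj: "qconj A \<bullet> qconj B = A \<bullet> B"
proof -
  have "Re (cnj (sgi i * sgi j * cnj x) * (sgi i * sgi j * cnj y)) = Re (cnj x * y)" for i j :: "'a + 'a" and x y
    by (cases i; cases j) simp_all
  then have "qconj A \<bullet> qconj B = (\<Sum>i\<in>UNIV. \<Sum>j\<in>UNIV. Re (cnj (A $ swp i $ swp j) * B $ swp i $ swp j))"
    unfolding inner_matrix_sum qconj_def vec_lambda_beta by (simp only:)
  also have "\<dots> = (\<Sum>i\<in>UNIV. \<Sum>j\<in>UNIV. Re (cnj (A $ swp i $ j) * B $ swp i $ j))"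
    by (simp only: sum_swp[of "\<lambda>j. Re (cnj (A $ swp _ $ j) * B $ swp _ $ j)"])
  also have "\<dots> = (\<Sum>i\<in>UNIV. \<Sum>j\<in>UNIV. Re (cnj (A $ i $ j) * B $ i $ j))"
    by (rule sum_swp)
  also have "\<dots> = A \<bullet> B"
    by (rule inner_matrix_sum[symmetric])
  finally show ?thesis .
qed

text \<open>Replaces the existential block form by the fixed-point equation of a real-linear,
  multiplicative map commuting with \<open>adj\<close>; from here on blocks are avoided.\<close>

lemma quaternionic_iff: "M \<in> quaternionic \<longleftrightarrow> qconj M = M"
proof
  assume "M \<in> quaternionic"
  then obtain z w where "M = block z w (- conj_mat w) (conj_mat z)"
    by (auto simp: quaternionic_def)
  then show "qconj M = M"
    by (auto simp: vec_eq_iff qconj_def block_def conj_mat_def split: sum.split)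
next
  assume M: "qconj M = M"
  then have M': "sgi i * sgi j * cnj (M $ swp i $ swp j) = M $ i $ j" for i j
    by (metis (no_types, lifting) qconj_def vec_lambda_beta)
  define z where "z = (\<chi> a b. M $ Inl a $ Inl b)"
  define w where "w = (\<chi> a b. M $ Inl a $ Inr b)"
  have "M = block z w (- conj_mat w) (conj_mat z)"
    using M'[of "Inr _" "Inr _"] M'[of "Inr _" "Inl _"]
    by (auto simp: vec_eq_iff block_def conj_mat_def z_def w_def split: sum.split)
  then show "M \<in> quaternionic" by (auto simp: quaternionic_def)
qed

lemma Sp_iff: "q \<in> Sp \<longleftrightarrow> qconj q = q \<and> adj q ** q = mat 1 \<and> q ** adj q = mat 1"
  by (simp add: Sp_def quaternionic_iff)

lemma sp_algebra_iff: "X \<in> sp_algebra \<longleftrightarrow> qconj X = X \<and> adj X = - X"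
  by (simp add: sp_algebra_def quaternionic_iff)

lemma sp_algebra_add: "X \<in> sp_algebra \<Longrightarrow> Y \<in> sp_algebra \<Longrightarrow> X + Y \<in> sp_algebra"
  by (simp add: sp_algebra_iff qconj_add adj_add)

lemma sp_algebra_scaleR: "X \<in> sp_algebra \<Longrightarrow> c *\<^sub>R X \<in> sp_algebra"
  by (simp add: sp_algebra_iff qconj_scaleR adj_scaleR)

lemma sp_algebra_sum: "(\<And>i. i \<in> I \<Longrightarrow> f i \<in> sp_algebra) \<Longrightarrow> sum f I \<in> sp_algebra"
  by (simp add: sp_algebra_iff qconj_sum adj_sum sum_negf)

subsection \<open>The tangent projection of the space of involutions\<close>

definition involution :: "complex^('k::finite + 'k)^('k + 'k) \<Rightarrow> bool"
  where "involution P \<longleftrightarrow> qconj P = P \<and> adj P = P \<and> P ** P = mat 1"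

text \<open>For an involution \<open>P\<close> the last equation is
  \<open>P ** A + A ** P = 0\<close>, the linearisation of \<open>P ** P = mat 1\<close>, multiplied
  by \<open>P\<close> from the right.\<close>

definition tangent_space :: "complex^('k::finite + 'k)^('k + 'k) \<Rightarrow> (complex^('k + 'k)^('k + 'k)) set"
  where "tangent_space P = {A. qconj A = A \<and> adj A = A \<and> P ** A ** P = - A}"

text \<open>The constant is \<open>1 / 4\<close> times \<open>1 / 2\<close>: an average over the
  four maps generated by \<open>qconj\<close> and \<open>adj\<close>, then the part that changes
  sign under conjugation by \<open>P\<close>.\<close>

definition tangent_proj :: "complex^('k::finite + 'k)^('k + 'k) \<Rightarrow> complex^('k + 'k)^('k + 'k) \<Rightarrow> complex^('k + 'k)^('k + 'k)"
  where "tangent_proj P M = (let S = M + qconj M + adj M + qconj (adj M)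
    in (1 / 8) *\<^sub>R (S - P ** S ** P))"

lemma tangent_proj_in_tangent_space:
  assumes "involution P"
  shows "tangent_proj P M \<in> tangent_space P"
proof -
  define S where "S = M + qconj M + adj M + qconj (adj M)"
  have P: "qconj P = P" "adj P = P" "P ** P = mat 1"
    using assms by (auto simp: involution_def)
  have S: "qconj S = S" "adj S = S"
    by (simp_all add: S_def qconj_add adj_add qconj_adj)
  have "P ** (P ** S ** P) ** P = (P ** P) ** S ** (P ** P)"
    by (simp only: matrix_mul_assoc)
  also have "\<dots> = S" by (simp add: P)
  finally have PP: "P ** (P ** S ** P) ** P = S" .
  show ?thesis
    unfolding tangent_space_def tangent_proj_def S_def[symmetric] Let_def mem_Collect_eq
    by (simp add: qconj_scaleR qconj_diff qconj_mult adj_scaleR adj_diff adj_mult P S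
        mm.scaleR_left mm.scaleR_right mm.diff_left mm.diff_right PP)
      (simp add: matrix_mul_assoc scaleR_diff_right)
qed

text \<open>All maps used in \<open>tangent_proj\<close> are symmetric for the inner product, so
  they can be moved onto \<open>A\<close>, where each acts as plus or minus the identity.\<close>

lemma inner_tangent_proj:
  assumes "involution P" "A \<in> tangent_space P"
  shows "tangent_proj P M \<bullet> A = M \<bullet> A"
proof -
  have P: "qconj P = P" "adj P = P" "P ** P = mat 1"
    using assms by (auto simp: involution_def)
  have A: "qconj A = A" "adj A = A" "P ** A ** P = - A"
    using assms by (auto simp: tangent_space_def)
  define S where "S = M + qconj M + adj M + qconj (adj M)"
  have "qconj B \<bullet> A = B \<bullet> A" "adj B \<bullet> A = B \<bullet> A" for B
    using inner_qconj[of B A] inner_adj[of B A] by (simp_all add: A)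
  then have S: "S \<bullet> A = 4 * (M \<bullet> A)" by (simp add: S_def inner_add_left)
  have "(P ** S ** P) \<bullet> A = (P ** S) \<bullet> (A ** P)"
    by (simp only: inner_mult_right P)
  also have "\<dots> = S \<bullet> (P ** A ** P)"
    by (simp only: inner_mult_left P matrix_mul_assoc)
  finally have "(P ** S ** P) \<bullet> A = S \<bullet> (P ** A ** P)" .
  then have "(P ** S ** P) \<bullet> A = - (S \<bullet> A)" by (simp add: A)
  then show ?thesis
    unfolding tangent_proj_def S_def[symmetric] Let_def by (simp add: inner_diff_left S)
qed

text \<open>Pairing with it for \<open>c = 1\<close> and \<open>c = \<i>\<close> gives the real and
  the imaginary part of an entry.\<close>

definition unit_mat :: "complex \<Rightarrow> 'a::finite \<Rightarrow> 'b::finite \<Rightarrow> complex^'b^'a"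
  where "unit_mat c i j = (\<chi> k l. if k = i \<and> l = j then c else 0)"

lemma inner_unit_mat: "A \<bullet> unit_mat c i j = Re (cnj (A $ i $ j) * c)"
proof -
  have "A \<bullet> unit_mat c i j = (\<Sum>k\<in>UNIV. \<Sum>l\<in>UNIV. if k = i then if l = j then Re (cnj (A $ i $ j) * c) else 0 else 0)"
    unfolding inner_matrix_sum unit_mat_def by (intro sum.cong refl) auto
  also have "\<dots> = (\<Sum>k\<in>UNIV. if k = i then Re (cnj (A $ i $ j) * c) else 0)"
    by (intro sum.cong refl) auto
  finally show ?thesis by simp
qed

lemma mult_unit_mat_mult: "(A ** unit_mat c i j ** B) $ k $ l = A $ k $ i * c * B $ j $ l"
proof -
  have "(A ** unit_mat c i j) $ k $ b = (if b = j then A $ k $ i * c else 0)" for b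
  proof -
    have "(A ** unit_mat c i j) $ k $ b = (\<Sum>a\<in>UNIV. if a = i then if b = j then A $ k $ i * c else 0 else 0)"
      unfolding matrix_matrix_mult_def unit_mat_def vec_lambda_beta by (intro sum.cong refl) auto
    then show ?thesis by simp
  qed
  then have "(A ** unit_mat c i j ** B) $ k $ l = (\<Sum>b\<in>UNIV. (if b = j then A $ k $ i * c else 0) * B $ b $ l)"
    unfolding matrix_matrix_mult_def[of "A ** unit_mat c i j"] by simp
  also have "\<dots> = (\<Sum>b\<in>UNIV. if b = j then A $ k $ i * c * B $ j $ l else 0)"
    by (intro sum.cong) auto
  finally show ?thesis by simp
qed

text \<open>In \<open>tangent_proj P M + \<i> \<cdot> tangent_proj P (\<i> M)\<close> only the conjugate-linear terms of the
  projection survive, doubled.\<close>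

lemma tangent_proj_unit_mat:
  fixes P :: "complex^('k::finite + 'k)^('k + 'k)"
  shows "tangent_proj P (unit_mat 1 a j) $ k $ c + \<i> * tangent_proj P (unit_mat \<i> a j) $ k $ c =
    1 / 4 * (sgi a * sgi j * (if k = swp a \<and> c = swp j then 1 else 0) + (if k = j \<and> c = a then 1 else 0)
      - sgi a * sgi j * P $ k $ swp a * P $ swp j $ c - P $ k $ j * P $ a $ c)"
proof -
  have swp_eq: "swp x = y \<longleftrightarrow> x = swp y" for x y :: "'k + 'k" by (metis swp_swp)
  have adjE: "adj (unit_mat x i l) = unit_mat (cnj x) l i" for x and i l :: "'k + 'k"
    by (auto simp: vec_eq_iff adj_nth unit_mat_def)
  have qE: "qconj (unit_mat x i l) = unit_mat (sgi i * sgi l * cnj x) (swp i) (swp l)" for x and i l :: "'k + 'k"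
    by (auto simp: vec_eq_iff qconj_def unit_mat_def swp_eq)
  \<comment> \<open>Naming the four Kronecker deltas turns the claim into a polynomial identity
    without case splits. In it \<open>d1\<close> and \<open>d4\<close> drop out, since their
    coefficients are linear in \<open>x\<close> and \<open>1 + \<i> * \<i> = 0\<close>.\<close>
  define d1 d2 d3 d4 :: complex
    where "d1 = (if k = a \<and> c = j then 1 else 0)" and "d2 = (if k = swp a \<and> c = swp j then 1 else 0)"
      and "d3 = (if k = j \<and> c = a then 1 else 0)" and "d4 = (if k = swp j \<and> c = swp a then 1 else 0)"
  have U: "unit_mat x a j $ k $ c = x * d1" "unit_mat x (swp a) (swp j) $ k $ c = x * d2"
    "unit_mat x j a $ k $ c = x * d3" "unit_mat x (swp j) (swp a) $ k $ c = x * d4" for x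
    by (simp_all add: unit_mat_def d1_def d2_def d3_def d4_def)
  have T: "tangent_proj P (unit_mat x a j) $ k $ c =
    (1 / 8) *\<^sub>R ((unit_mat x a j $ k $ c + unit_mat (sgi a * sgi j * cnj x) (swp a) (swp j) $ k $ c
      + unit_mat (cnj x) j a $ k $ c + unit_mat (sgi j * sgi a * x) (swp j) (swp a) $ k $ c)
     - (P $ k $ a * x * P $ j $ c + P $ k $ swp a * (sgi a * sgi j * cnj x) * P $ swp j $ c
        + P $ k $ j * cnj x * P $ a $ c + P $ k $ swp j * (sgi j * sgi a * x) * P $ swp a $ c))" for x
    unfolding tangent_proj_def Let_def adjE qE complex_cnj_cnj
    by (simp add: mm.add_left mm.add_right mult_unit_mat_mult)
  show ?thesis
    unfolding T U d2_def[symmetric] d3_def[symmetric]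
    by (simp add: scaleR_conv_of_real field_simps del: mult_eq_0_iff if_split)
qed

text \<open>Composing the quaternionic with the Hermitian symmetry removes the complex conjugation,
  leaving linear relations between entries. One of them equates \<open>P $ swp i $ i\<close> with
  its own negative.\<close>

lemma involution_swp_entry:
  assumes "involution P"
  shows "P $ swp i $ i = 0" "P $ swp i $ swp j = sgi i * sgi j * P $ j $ i"
proof -
  have *: "P $ swp k $ l = - (sgi k * sgi l * P $ swp l $ k)" for k l
  proof -
    have "P $ swp k $ l = qconj P $ swp k $ l" using assms by (simp add: involution_def)
    also have "\<dots> = - (sgi k * sgi l * cnj (P $ k $ swp l))" by (simp add: qconj_def)
    also have "cnj (P $ k $ swp l) = adj P $ swp l $ k" by (simp add: adj_nth)
    also have "\<dots> = P $ swp l $ k" using assms by (simp add: involution_def)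
    finally show ?thesis .
  qed
  show "P $ swp i $ i = 0" using *[of i i] by (simp add: eq_neg_iff_add_eq_0)
  show "P $ swp i $ swp j = sgi i * sgi j * P $ j $ i" using *[of i "swp j"] by simp
qed

text \<open>Three of the four terms of the general formula vanish when both entries lie in column
  \<open>a\<close>: the deltas because \<open>swp a \<noteq> a\<close> and
  \<open>j \<noteq> a\<close>, the mixed product because \<open>P $ swp a $ a = 0\<close>.\<close>

lemma tangent_proj_column:
  fixes P :: "complex^('k::finite + 'k)^('k + 'k)"
  assumes "involution P" "j \<noteq> a"
  shows "tangent_proj P (unit_mat 1 j a) $ k $ a + \<i> * tangent_proj P (unit_mat \<i> j a) $ k $ a =
    - (1 / 4) * P $ k $ a * P $ j $ a"
  unfolding tangent_proj_unit_mat using assms(2)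
  by (simp add: involution_swp_entry(1)[OF assms(1)])

text \<open>The two terms with \<open>swp\<close> sum to minus and plus \<open>mat 1\<close> and
  cancel, the second by \<open>P ** P = mat 1\<close>. The size comes from the delta that holds for
  every \<open>j\<close> when \<open>c = a\<close>, the trace from the diagonal factors
  \<open>P $ j $ j\<close>.\<close>

lemma sum_tangent_proj_unit_mat:
  fixes P :: "complex^('k::finite + 'k)^('k + 'k)"
  assumes "involution P"
  shows "(\<Sum>j\<in>UNIV. tangent_proj P (unit_mat 1 a j) $ j $ c + \<i> * tangent_proj P (unit_mat \<i> a j) $ j $ c) =
    1 / 4 * (of_nat CARD('k + 'k) * (mat 1 :: complex^('k + 'k)^('k + 'k)) $ a $ c - trace P * P $ a $ c)"
proof -
  have s: "sgi a * sgi j * P $ j $ swp a = - P $ a $ swp j" for j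
    using involution_swp_entry(2)[OF assms, of "swp j" a] by (simp add: mult_ac)
  have "(\<Sum>j\<in>UNIV. sgi a * sgi j * (if j = swp a \<and> c = swp j then 1 else 0)) =
      (\<Sum>j\<in>UNIV. if j = swp a then if c = a then - 1 else 0 else (0::complex))"
    by (intro sum.cong) auto
  then have 1: "(\<Sum>j\<in>UNIV. sgi a * sgi j * (if j = swp a \<and> c = swp j then 1 else 0)) = - (mat 1 :: complex^('k + 'k)^('k + 'k)) $ a $ c"
    by (simp add: mat_def)
  have 2: "(\<Sum>j\<in>(UNIV::('k + 'k) set). if j = j \<and> c = a then 1 else 0) =
      of_nat CARD('k + 'k) * (mat 1 :: complex^('k + 'k)^('k + 'k)) $ a $ c"
    by (simp add: mat_def)
  have "(\<Sum>j\<in>UNIV. sgi a * sgi j * P $ j $ swp a * P $ swp j $ c) = (\<Sum>j\<in>UNIV. - (P $ a $ swp j * P $ swp j $ c))"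
    by (simp add: s)
  also have "\<dots> = - (\<Sum>j\<in>UNIV. P $ a $ j * P $ j $ c)"
    by (simp only: sum_negf sum_swp[of "\<lambda>j. P $ a $ j * P $ j $ c"])
  also have "\<dots> = - (P ** P) $ a $ c" by (simp add: matrix_matrix_mult_def)
  finally have 3: "(\<Sum>j\<in>UNIV. sgi a * sgi j * P $ j $ swp a * P $ swp j $ c) = - (mat 1 :: complex^('k + 'k)^('k + 'k)) $ a $ c"
    using assms by (simp add: involution_def)
  have 4: "(\<Sum>j\<in>UNIV. P $ j $ j * P $ a $ c) = trace P * P $ a $ c"
    by (simp add: trace_def sum_distrib_right)
  show ?thesis
    unfolding tangent_proj_unit_mat sum_distrib_left[symmetric] sum.distrib sum_subtractf 1 2 3 4
    by simp
qed

subsection \<open>The Cayley transform\<close>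

definition half_resolvent :: "complex^'n^'n \<Rightarrow> complex^'n^'n"
  where "half_resolvent X = matrix_inv (mat 1 - (1 / 2) *\<^sub>R X)"

text \<open>A rational substitute for the exponential map from the Lie algebra to the group; the
  factors \<open>1 / 2\<close> make its derivative at 0 the identity.\<close>

definition cayley :: "complex^'n^'n \<Rightarrow> complex^'n^'n"
  where "cayley X = (mat 1 + (1 / 2) *\<^sub>R X) ** half_resolvent X"

text \<open>Multiplication by a skew matrix is skew for the real inner product, so
  \<open>X ** M\<close> is orthogonal to \<open>M\<close>. This makes
  \<open>mat 1 - (1 / 2) *\<^sub>R X\<close> injective.\<close>

lemma skew_mult_eq_self:
  fixes M :: "complex^'m^'n"
  assumes "adj X = - X" "M = c *\<^sub>R (X ** M)"
  shows "M = 0"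
proof -
  have "(X ** M) \<bullet> M = - ((X ** M) \<bullet> M)"
    using inner_mult_left[of X M M] assms(1) by (simp add: mm.minus_left inner_commute)
  then have "(X ** M) \<bullet> M = 0" by simp
  moreover have "M \<bullet> M = c * ((X ** M) \<bullet> M)"
    using assms(2) by (metis inner_scaleR_left)
  ultimately show ?thesis by simp
qed

lemma half_resolvent:
  fixes X :: "complex^'n^'n"
  assumes "adj X = - X"
  shows "(mat 1 - (1 / 2) *\<^sub>R X) ** half_resolvent X = mat 1"
    and "half_resolvent X ** (mat 1 - (1 / 2) *\<^sub>R X) = mat 1"
proof -
  define U where "U = mat 1 - (1 / 2) *\<^sub>R X"
  have lin: "linear (\<lambda>M :: complex^'n^'n. U ** M)"
    by (rule bounded_linear.linear[OF mm.bounded_linear_right])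
  have "M = 0" if "U ** M = 0" for M :: "complex^'n^'n"
  proof (rule skew_mult_eq_self[OF assms])
    show "M = (1 / 2) *\<^sub>R (X ** M)"
      using that by (simp add: U_def mm.diff_left mm.scaleR_left)
  qed
  then have "inj (\<lambda>M :: complex^'n^'n. U ** M)"
    using linear_injective_0[OF lin] by blast
  then have "surj (\<lambda>M :: complex^'n^'n. U ** M)"
    by (rule linear_injective_imp_surjective[OF lin]) simp
  then obtain R where "mat 1 = U ** R" by (rule surjE)
  then have "\<exists>R. U ** R = mat 1 \<and> R ** U = mat 1"
    using matrix_left_right_inverse by metis
  then have "U ** matrix_inv U = mat 1 \<and> matrix_inv U ** U = mat 1"
    unfolding matrix_inv_def by (rule someI_ex)
  then show "(mat 1 - (1 / 2) *\<^sub>R X) ** half_resolvent X = mat 1"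
    and "half_resolvent X ** (mat 1 - (1 / 2) *\<^sub>R X) = mat 1"
    by (simp_all add: U_def half_resolvent_def)
qed

lemma half_resolvent_unique:
  assumes "adj X = - X" "(mat 1 - (1 / 2) *\<^sub>R X) ** R = mat 1"
  shows "R = half_resolvent X"
proof -
  have "R = half_resolvent X ** ((mat 1 - (1 / 2) *\<^sub>R X) ** R)"
    by (simp add: matrix_mul_assoc half_resolvent(2)[OF assms(1)])
  then show ?thesis by (simp add: assms(2))
qed

lemma half_resolvent_0 [simp]: "half_resolvent 0 = mat 1"
  by (rule half_resolvent_unique[symmetric]) (simp_all add: linear_0[OF bounded_linear.linear[OF bounded_linear_adj]])

lemma cayley_0 [simp]: "cayley 0 = mat 1"
  by (simp add: cayley_def)

lemma half_resolvent_commute: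
  assumes "adj X = - X" "Z ** X = X ** Z"
  shows "Z ** half_resolvent X = half_resolvent X ** Z"
proof -
  define U R where "U = mat 1 - (1 / 2) *\<^sub>R X" and "R = half_resolvent X"
  have UR: "U ** R = mat 1" "R ** U = mat 1"
    using half_resolvent[OF assms(1)] by (simp_all add: U_def R_def)
  have ZU: "Z ** U = U ** Z"
    by (simp add: U_def mm.diff_left mm.diff_right mm.scaleR_left mm.scaleR_right assms(2))
  have "Z ** R = R ** (U ** Z) ** R" by (simp add: matrix_mul_assoc UR)
  also have "\<dots> = R ** Z ** (U ** R)" by (simp add: ZU[symmetric] matrix_mul_assoc)
  finally have "Z ** R = R ** Z" by (simp only: UR matrix_mul_rid)
  then show ?thesis by (simp only: R_def)
qed

text \<open>With \<open>Z = I_tilde\<close>, this keeps Cayley curves in vertical directions inside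
  the isotropy group.\<close>

lemma cayley_commute:
  assumes "adj X = - X" "Z ** X = X ** Z"
  shows "Z ** cayley X = cayley X ** Z"
proof -
  have "Z ** (mat 1 + (1 / 2) *\<^sub>R X) = (mat 1 + (1 / 2) *\<^sub>R X) ** Z"
    by (simp add: mm.add_left mm.add_right mm.scaleR_left mm.scaleR_right assms(2))
  then have "Z ** cayley X = (mat 1 + (1 / 2) *\<^sub>R X) ** (Z ** half_resolvent X)"
    unfolding cayley_def by (simp only: matrix_mul_assoc)
  then show ?thesis
    by (simp only: half_resolvent_commute[OF assms] cayley_def matrix_mul_assoc)
qed

text \<open>Taking adjoints interchanges \<open>U\<close> and \<open>W\<close>, and these commute;
  hence \<open>adj (W ** R) ** (W ** R)\<close> regroups to
  \<open>adj (U ** R) ** (U ** R)\<close>.\<close>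

lemma cayley_in_Sp:
  assumes "X \<in> sp_algebra"
  shows "cayley X \<in> Sp"
proof -
  have X: "qconj X = X" "adj X = - X" using assms by (auto simp: sp_algebra_iff)
  define U W R where "U = mat 1 - (1 / 2) *\<^sub>R X" and "W = mat 1 + (1 / 2) *\<^sub>R X" and "R = half_resolvent X"
  have UR: "U ** R = mat 1" "R ** U = mat 1"
    using half_resolvent[OF X(2)] by (simp_all add: U_def R_def)
  have "W = mat 1 + mat 1 - U" by (simp add: U_def W_def)
  then have UW: "U ** W = W ** U"
    by (simp only: mm.add_left mm.add_right mm.diff_left mm.diff_right matrix_mul_lid matrix_mul_rid)
  have aU: "adj U = W" "adj W = U"
    by (simp_all add: U_def W_def adj_add adj_diff adj_scaleR X)
  have "qconj R = R"
  proof -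
    have "U ** qconj R = qconj (U ** R)"
      by (simp add: qconj_mult) (simp add: U_def qconj_diff qconj_scaleR X)
    then show ?thesis unfolding R_def U_def[symmetric]
      by (intro half_resolvent_unique X) (simp add: UR U_def[symmetric] R_def[symmetric])
  qed
  then have "qconj (W ** R) = W ** R"
    by (simp add: qconj_mult) (simp add: W_def qconj_add qconj_scaleR X)
  moreover have "adj (W ** R) ** (W ** R) = mat 1"
  proof -
    have "adj (W ** R) ** (W ** R) = adj R ** (U ** W) ** R"
      by (simp add: adj_mult aU matrix_mul_assoc)
    also have "\<dots> = (adj R ** W) ** (U ** R)" unfolding UW by (simp only: matrix_mul_assoc)
    also have "adj R ** W = adj (U ** R)" by (simp add: adj_mult aU)
    finally show ?thesis by (simp add: UR)
  qed
  ultimately show ?thesis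
    using matrix_left_right_inverse by (auto simp: Sp_iff cayley_def W_def R_def)
qed

text \<open>An instance of the inverse families above, for the operators of left multiplication by
  \<open>mat 1 - (1 / 2) *\<^sub>R l e\<close> on matrices.\<close>

lemma half_resolvent_family:
  fixes l :: "'c::real_normed_vector \<Rightarrow> complex^'n^'n" and u :: "complex^'n^'n"
  assumes l: "bounded_linear l" and skew: "\<And>e. adj (l e) = - l e"
  shows "C_k_on k (\<lambda>e. half_resolvent (l e) ** u) UNIV"
    and "((\<lambda>e. half_resolvent (l e) ** u) has_derivative (\<lambda>h. (1 / 2) *\<^sub>R (l h ** u))) (at 0)"
proof -
  define A where "A e M = (mat 1 - (1 / 2) *\<^sub>R l e) ** M" for e and M :: "complex^'n^'n"
  have lA: "linear (A e)" for e
    unfolding A_def by (rule bounded_linear.linear[OF mm.bounded_linear_right])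
  have AB: "A e (half_resolvent (l e) ** M) = M" "half_resolvent (l e) ** A e M = M" for e M
    by (simp_all add: A_def matrix_mul_assoc half_resolvent[OF skew])
  have Ck: "C_k_on k (\<lambda>e. A e M) UNIV" for k M
  proof -
    have bl: "bounded_linear (\<lambda>e. - ((1 / 2) *\<^sub>R (l e ** M)))"
      by (intro bounded_linear_minus bounded_linear_scaleR_right[THEN bounded_linear_compose]
          bounded_linear_compose[OF mm.bounded_linear_left l])
    have "C_k_on k (\<lambda>e. M + - ((1 / 2) *\<^sub>R (l e ** M))) UNIV"
      by (rule C_k_on_add[OF open_UNIV C_k_on_const C_k_on_linear[OF open_UNIV bl]])
    then show ?thesis by (simp add: A_def mm.diff_left mm.scaleR_left)
  qed
  show "C_k_on k (\<lambda>e. half_resolvent (l e) ** u) UNIV"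
    by (rule C_k_on_inverse_family[OF lA AB open_UNIV Ck])
  have l0: "l 0 = 0" by (rule linear_0[OF bounded_linear.linear[OF l]])
  have "((\<lambda>e. A e u) has_derivative (\<lambda>h. - ((1 / 2) *\<^sub>R (l h ** u)))) (at 0)"
    unfolding A_def mm.diff_left mm.scaleR_left
    by (rule derivative_eq_intros refl bounded_linear.has_derivative[OF mm.bounded_linear_left]
        bounded_linear_imp_has_derivative[OF l] | simp)+
  then have dA: "((\<lambda>e. A e (half_resolvent (l 0) ** u)) has_derivative (\<lambda>h. - ((1 / 2) *\<^sub>R (l h ** u)))) (at 0)"
    by (simp add: l0)
  have "((\<lambda>e. half_resolvent (l e) ** u) has_derivative (\<lambda>h. - (half_resolvent (l 0) ** - ((1 / 2) *\<^sub>R (l h ** u))))) (at 0)"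
    by (rule has_derivative_inverse_family[OF lA AB open_UNIV C_k_on_continuous[OF Ck] UNIV_I dA])
  then show "((\<lambda>e. half_resolvent (l e) ** u) has_derivative (\<lambda>h. (1 / 2) *\<^sub>R (l h ** u))) (at 0)"
    by (simp add: l0)
qed

lemma cayley_family:
  fixes l :: "'c::real_normed_vector \<Rightarrow> complex^'n^'n"
  assumes l: "bounded_linear l" and skew: "\<And>e. adj (l e) = - l e"
  shows C_k_on_cayley: "C_k_on k (\<lambda>e. cayley (l e)) UNIV"
    and has_derivative_cayley: "((\<lambda>e. cayley (l e)) has_derivative l) (at 0)"
proof -
  note R = half_resolvent_family[OF l skew, where u = "mat 1", unfolded matrix_mul_rid]
  have l0: "l 0 = 0" by (rule linear_0[OF bounded_linear.linear[OF l]])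
  have bl: "bounded_linear (\<lambda>e. (1 / 2) *\<^sub>R l e)"
    by (rule bounded_linear_compose[OF bounded_linear_scaleR_right l])
  have W: "C_k_on k (\<lambda>e. mat 1 + (1 / 2) *\<^sub>R l e) UNIV"
    by (rule C_k_on_add[OF open_UNIV C_k_on_const C_k_on_linear[OF open_UNIV bl]])
  show "C_k_on k (\<lambda>e. cayley (l e)) UNIV"
    unfolding cayley_def by (rule C_k_on_bilinear[OF open_UNIV mm.bounded_bilinear_axioms W R(1)])
  have "((\<lambda>e. mat 1 + (1 / 2) *\<^sub>R l e) has_derivative (\<lambda>h. 0 + (1 / 2) *\<^sub>R l h)) (at 0)"
    by (intro has_derivative_add has_derivative_const bounded_linear_imp_has_derivative bl)
  from mm.FDERIV[OF this R(2)] show "((\<lambda>e. cayley (l e)) has_derivative l) (at 0)"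
    by (simp add: cayley_def[abs_def] l0 scaleR_add_left[symmetric])
qed

section \<open>Riemannian geometry of a space of involutions in a chart\<close>

text \<open>Justifies the definite descriptions in \<open>grad\<close> and
  \<open>christoffel\<close>.\<close>

lemma positive_bilinear_riesz:
  fixes g :: "'e::euclidean_space \<Rightarrow> 'e \<Rightarrow> real"
  assumes g: "bilinear g" "\<And>u. u \<noteq> 0 \<Longrightarrow> g u u > 0" and f: "linear f"
  shows "\<exists>!u. \<forall>v. g u v = f v"
proof -
  have lin: "linear (\<lambda>u. g u v)" "linear (g u)" for u v
    using g(1) by (auto simp: bilinear_def)
  have zero: "u = 0" if "\<And>v. g u v = 0" for u
    using g(2)[of u] that by force
  define T where "T u = (\<Sum>b\<in>Basis. g u b *\<^sub>R b)" for u
  have T: "linear T"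
    by (rule linearI)
      (simp_all add: T_def linear_add[OF lin(1)] linear_scale[OF lin(1)] scaleR_add_left sum.distrib scaleR_sum_right)
  have gT: "g u v = v \<bullet> T u" for u v
    unfolding linear_euclidean_sum[OF lin(2), of u v]
    by (simp add: T_def inner_sum_right mult.commute)
  have "inj T"
    unfolding linear_injective_0[OF T] using zero gT by (metis inner_zero_right)
  then have "surj T"
    by (rule linear_injective_imp_surjective[OF T]) simp
  then obtain u where "(\<Sum>b\<in>Basis. f b *\<^sub>R b) = T u" by (rule surjE)
  then have u: "g u v = f v" for v
    unfolding gT linear_euclidean_sum[OF f, of v] by (simp add: inner_sum_right mult.commute flip: \<open>_ = T u\<close>)
  moreover have "w = u" if "\<forall>v. g w v = f v" for w
  proof -
    have "g (w - u) v = 0" for v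
      using that u by (simp add: linear_diff[OF lin(1)])
    then show ?thesis using zero[of "w - u"] by simp
  qed
  ultimately show ?thesis by blast
qed

text \<open>A product rule for a moving linear map applied to a moving vector, when only the values
  on fixed vectors are known to be differentiable.\<close>

lemma has_derivative_linear_family:
  fixes A :: "'c::real_normed_vector \<Rightarrow> 'b::euclidean_space \<Rightarrow> 'd::real_normed_vector"
  assumes S: "open S" "a \<in> S" and lA: "\<And>x. x \<in> S \<Longrightarrow> linear (A x)"
    and dA: "\<And>v. ((\<lambda>x. A x v) has_derivative A' v) (at a)" and X: "(X has_derivative X') (at a)"
  shows "((\<lambda>x. A x (X x)) has_derivative (\<lambda>h. A' (X a) h + A a (X' h))) (at a)"
proof -
  note A_sum = linear_euclidean_sum[OF lA, symmetric]
  have *: "((\<lambda>x. A x (Y x)) has_derivative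
      (\<lambda>h. \<Sum>b\<in>Basis. (Y a \<bullet> b) *\<^sub>R A' b h + (Y' h \<bullet> b) *\<^sub>R A a b)) (at a)"
    if Y: "(Y has_derivative Y') (at a)" for Y Y'
  proof (rule has_derivative_transform_within_open[OF _ S])
    show "((\<lambda>x. \<Sum>b\<in>Basis. (Y x \<bullet> b) *\<^sub>R A x b) has_derivative
        (\<lambda>h. \<Sum>b\<in>Basis. (Y a \<bullet> b) *\<^sub>R A' b h + (Y' h \<bullet> b) *\<^sub>R A a b)) (at a)"
      by (intro has_derivative_sum has_derivative_scaleR has_derivative_inner_left Y dA)
  qed (rule A_sum)
  \<comment> \<open>Expanding the constant vector \<open>X a\<close> over \<open>Basis\<close> shows
    that \<open>A'\<close> is compatible with this expansion, by uniqueness of derivatives.\<close>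
  have "A' (X a) = (\<lambda>h. \<Sum>b\<in>Basis. (X a \<bullet> b) *\<^sub>R A' b h + (0 \<bullet> b) *\<^sub>R A a b)"
    by (rule has_derivative_unique[OF dA[of "X a"] *[OF has_derivative_const[of "X a"]]])
  then have "(\<Sum>b\<in>Basis. (X a \<bullet> b) *\<^sub>R A' b h) = A' (X a) h" for h
    by (simp only: inner_zero_left scaleR_zero_left add_0_right)
  then have "(\<Sum>b\<in>Basis. (X a \<bullet> b) *\<^sub>R A' b h + (X' h \<bullet> b) *\<^sub>R A a b) = A' (X a) h + A a (X' h)" for h
    by (simp only: sum.distrib A_sum[OF S(2)])
  then show ?thesis by (intro has_derivative_eq_rhs[OF *[OF X]] ext)
qed

lemma scaleR_matrix_nth: "(r *\<^sub>R A) $ i $ j = of_real r * A $ i $ j" for A :: "complex^'n^'m"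
  by (subst vector_scaleR_component, subst vector_scaleR_component, rule scaleR_conv_of_real)

text \<open>An entry of \<open>X b\<close> is its pairing with \<open>unit_mat 1\<close> plus
  \<open>\<i>\<close> times that with \<open>unit_mat \<i>\<close>. So \<open>frame\<close> rewrites
  the sum of products as a sum of projected unit matrices, and its 4 cancels the
  \<open>1 / 4\<close> found there.\<close>

lemma sum_mult_of_tangent_frame:
  fixes P :: "complex^('k::finite + 'k)^('k + 'k)"
  assumes P: "involution P" "trace P = of_real t"
    and frame: "\<And>M. (\<Sum>b\<in>I. (X b \<bullet> M) *\<^sub>R Y b) = 4 *\<^sub>R tangent_proj P M"
  shows "(\<Sum>b\<in>I. X b ** Y b) = real CARD('k + 'k) *\<^sub>R mat 1 - t *\<^sub>R P"
proof -
  have entry: "of_real (A \<bullet> unit_mat 1 a j) + \<i> * of_real (A \<bullet> unit_mat \<i> a j) = A $ a $ j"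
    for A :: "complex^('k + 'k)^('k + 'k)" and a j
    by (simp add: inner_unit_mat complex_eq_iff)
  have frame': "(\<Sum>b\<in>I. of_real (X b \<bullet> M) * Y b $ j $ c) = 4 * tangent_proj P M $ j $ c" for M j c
    using arg_cong[OF frame[of M], of "\<lambda>A. A $ j $ c"] by (simp only: sum_component scaleR_matrix_nth) simp
  have "(\<Sum>b\<in>I. X b ** Y b) $ a $ c = (real CARD('k + 'k) *\<^sub>R mat 1 - t *\<^sub>R P) $ a $ c" for a c
  proof -
    have "(\<Sum>b\<in>I. X b ** Y b) $ a $ c = (\<Sum>j\<in>UNIV. \<Sum>b\<in>I. X b $ a $ j * Y b $ j $ c)"
      unfolding sum_component by (subst sum.swap) (simp add: matrix_matrix_mult_def)
    also have "\<dots> = (\<Sum>j\<in>UNIV. 4 * (tangent_proj P (unit_mat 1 a j) $ j $ c + \<i> * tangent_proj P (unit_mat \<i> a j) $ j $ c))"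
    proof (rule sum.cong[OF refl])
      fix j
      have "(\<Sum>b\<in>I. X b $ a $ j * Y b $ j $ c) =
          (\<Sum>b\<in>I. of_real (X b \<bullet> unit_mat 1 a j) * Y b $ j $ c) + \<i> * (\<Sum>b\<in>I. of_real (X b \<bullet> unit_mat \<i> a j) * Y b $ j $ c)"
      proof -
        have "X b $ a $ j * Y b $ j $ c = of_real (X b \<bullet> unit_mat 1 a j) * Y b $ j $ c
            + \<i> * (of_real (X b \<bullet> unit_mat \<i> a j) * Y b $ j $ c)" for b
          by (subst entry[symmetric]) (simp only: distrib_right mult.assoc)
        then show ?thesis by (simp only: sum.distrib sum_distrib_left)
      qed
      then show "(\<Sum>b\<in>I. X b $ a $ j * Y b $ j $ c) =
          4 * (tangent_proj P (unit_mat 1 a j) $ j $ c + \<i> * tangent_proj P (unit_mat \<i> a j) $ j $ c)"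
        unfolding frame' by (simp add: algebra_simps)
    qed
    also have "\<dots> = of_nat CARD('k + 'k) * (mat 1 :: complex^('k + 'k)^('k + 'k)) $ a $ c - trace P * P $ a $ c"
      by (simp only: sum_distrib_left[symmetric] sum_tangent_proj_unit_mat[OF P(1)]) simp
    finally show ?thesis
      by (simp only: P(2) vector_minus_component scaleR_matrix_nth of_real_of_nat_eq)
  qed
  then show ?thesis by (simp add: vec_eq_iff)
qed

text \<open>All that the analysis of both operators takes from the quotient: an isometric immersion,
  up to the factor \<open>1 / 4\<close>, that fills the tangent spaces of the space of
  involutions.\<close>

locale involution_chart =
  fixes M :: "('a, 'e::euclidean_space) riem" and c :: "('a, 'e) chart" and U :: "'e set"
    and \<Phi> :: "'e \<Rightarrow> complex^('k::finite + 'k)^('k + 'k)" and t :: real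
  assumes open_U: "open U"
    and smooth: "smooth_on \<Phi> U"
    and involution: "\<And>y. y \<in> U \<Longrightarrow> involution (\<Phi> y)"
    and trace_\<Phi>: "\<And>y. y \<in> U \<Longrightarrow> trace (\<Phi> y) = of_real t"
    and metric: "\<And>y u v. y \<in> U \<Longrightarrow>
      metric M c y u v = 1 / 4 * (frechet_derivative \<Phi> (at y) u \<bullet> frechet_derivative \<Phi> (at y) v)"
    and metric_pos: "\<And>y u. y \<in> U \<Longrightarrow> u \<noteq> 0 \<Longrightarrow> metric M c y u u > 0"
    and range_derivative: "\<And>y. y \<in> U \<Longrightarrow> range (frechet_derivative \<Phi> (at y)) = tangent_space (\<Phi> y)"
begin

definition A where "A y u = frechet_derivative \<Phi> (at y) u"

definition B where "B y u v = frechet_derivative (\<lambda>z. A z u) (at y) v"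

lemma \<Phi>_derivative: "y \<in> U \<Longrightarrow> (\<Phi> has_derivative A y) (at y)"
  unfolding A_def by (rule smooth_on_has_derivative[OF open_U smooth])

lemma smooth_A: "smooth_on (\<lambda>y. A y u) U"
  unfolding A_def by (rule smooth_on_frechet_derivative[OF smooth])

lemma A_derivative: "y \<in> U \<Longrightarrow> ((\<lambda>z. A z u) has_derivative B y u) (at y)"
  unfolding B_def by (rule smooth_on_has_derivative[OF open_U smooth_A])

lemma linear_A: "y \<in> U \<Longrightarrow> linear (A y)"
  by (rule has_derivative_linear[OF \<Phi>_derivative])

lemma metric_eq: "y \<in> U \<Longrightarrow> metric M c y u v = 1 / 4 * (A y u \<bullet> A y v)"
  unfolding A_def by (rule metric)

lemma bilinear_metric: "y \<in> U \<Longrightarrow> bilinear (metric M c y)"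
  unfolding bilinear_def
  by (auto intro!: linearI simp: metric_eq linear_add[OF linear_A] linear_scale[OF linear_A] inner_add_left inner_add_right algebra_simps)

lemma metric_riesz: "y \<in> U \<Longrightarrow> linear f \<Longrightarrow> \<exists>!u. \<forall>v. metric M c y u v = f v"
  by (rule positive_bilinear_riesz[OF bilinear_metric metric_pos])

lemma A_tangent: "y \<in> U \<Longrightarrow> A y u \<in> tangent_space (\<Phi> y)"
  using range_derivative[of y] by (auto simp: A_def)

text \<open>The difference \<open>Z - W\<close> is itself a value of \<open>A y\<close>, hence
  orthogonal to itself.\<close>

lemma tangent_eqI:
  assumes "y \<in> U" "Z \<in> tangent_space (\<Phi> y)" "W \<in> tangent_space (\<Phi> y)" "\<And>v. Z \<bullet> A y v = W \<bullet> A y v"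
  shows "Z = W"
proof -
  obtain z w where "Z = A y z" "W = A y w"
    using assms(2,3) unfolding range_derivative[OF assms(1), symmetric] A_def by auto
  then have "Z - W = A y (z - w)" by (simp add: linear_diff[OF linear_A[OF assms(1)]])
  moreover have "(Z - W) \<bullet> A y (z - w) = 0" using assms(4) by (simp add: inner_diff_left)
  ultimately have "(Z - W) \<bullet> (Z - W) = 0" by (simp only:)
  then show ?thesis by simp
qed

lemma B_symmetric:
  assumes y: "y \<in> U"
  shows "B y u v = B y v u"
proof -
  have "B y u v \<bullet> N = B y v u \<bullet> N" for N
  proof -
    define f where "f z = \<Phi> z \<bullet> N" for z
    have df: "(f has_derivative (\<lambda>u. A z u \<bullet> N)) (at z)" if "z \<in> U" for z
      unfolding f_def by (rule has_derivative_inner_left[OF \<Phi>_derivative[OF that]])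
    have ddf: "frechet_derivative (\<lambda>z. frechet_derivative f (at z) u) (at y) v = B y u v \<bullet> N" for u v
    proof -
      have "((\<lambda>z. A z u \<bullet> N) has_derivative (\<lambda>v. B y u v \<bullet> N)) (at y)"
        by (rule has_derivative_inner_left[OF A_derivative[OF y]])
      then have "((\<lambda>z. frechet_derivative f (at z) u) has_derivative (\<lambda>v. B y u v \<bullet> N)) (at y)"
        by (rule has_derivative_transform_within_open[OF _ open_U y]) (simp add: frechet_derivative_at[OF df, symmetric])
      from fun_cong[OF frechet_derivative_at[OF this], of v] show ?thesis by (rule sym)
    qed
    have "C_k_on 2 f U"
      unfolding f_def
      by (rule C_k_on_bounded_linear[OF open_U bounded_linear_inner_left]) (use smooth in \<open>auto simp: smooth_on_def\<close>)
    from symmetric_second_derivative[OF open_U this y] show ?thesis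
      unfolding ddf by (simp add: ddf)
  qed
  then show ?thesis by (metis vector_eq_ldot inner_commute)
qed

lemma A_anticommutes:
  assumes y: "y \<in> U"
  shows "\<Phi> y ** A y u + A y u ** \<Phi> y = 0"
proof -
  have "((\<lambda>z. \<Phi> z ** \<Phi> z) has_derivative (\<lambda>u. \<Phi> y ** A y u + A y u ** \<Phi> y)) (at y)"
    by (rule mm.FDERIV[OF \<Phi>_derivative[OF y] \<Phi>_derivative[OF y]])
  moreover have "((\<lambda>z. \<Phi> z ** \<Phi> z) has_derivative (\<lambda>u. 0)) (at y)"
    by (rule has_derivative_transform_within_open[OF has_derivative_const[of "mat 1"] open_U y])
      (use involution in \<open>simp add: involution_def\<close>)
  ultimately show ?thesis by (rule fun_cong[OF has_derivative_unique])
qed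

text \<open>\<open>B y u v\<close> inherits both symmetries of \<open>\<Phi>\<close>, so the
  four-term sum in \<open>tangent_proj\<close> is four times it. What is missing is its conjugate by
  \<open>\<Phi> y\<close>, obtained by differentiating \<open>A_anticommutes\<close> and multiplying
  by \<open>\<Phi> y\<close>.\<close>

lemma B_normal_part:
  assumes y: "y \<in> U"
  shows "B y u v - tangent_proj (\<Phi> y) (B y u v) = - (1 / 2) *\<^sub>R ((A y v ** A y u + A y u ** A y v) ** \<Phi> y)"
proof -
  have inv: "qconj (\<Phi> z) = \<Phi> z" "adj (\<Phi> z) = \<Phi> z" "\<Phi> z ** \<Phi> z = mat 1" if "z \<in> U" for z
    using involution[OF that] by (auto simp: involution_def)
  have A: "qconj (A z u) = A z u" "adj (A z u) = A z u" if "z \<in> U" for z u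
    using A_tangent[OF that] by (auto simp: tangent_space_def)
  have "((\<lambda>z. qconj (A z u)) has_derivative (\<lambda>v. qconj (B y u v))) (at y)"
    by (rule bounded_linear.has_derivative[OF bounded_linear_qconj A_derivative[OF y]])
  then have "((\<lambda>z. A z u) has_derivative (\<lambda>v. qconj (B y u v))) (at y)"
    by (rule has_derivative_transform_within_open[OF _ open_U y]) (simp add: A)
  then have qB: "qconj (B y u v) = B y u v"
    using has_derivative_unique[OF A_derivative[OF y]] by metis
  have "((\<lambda>z. adj (A z u)) has_derivative (\<lambda>v. adj (B y u v))) (at y)"
    by (rule bounded_linear.has_derivative[OF bounded_linear_adj A_derivative[OF y]])
  then have "((\<lambda>z. A z u) has_derivative (\<lambda>v. adj (B y u v))) (at y)"
    by (rule has_derivative_transform_within_open[OF _ open_U y]) (simp add: A)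
  then have aB: "adj (B y u v) = B y u v"
    using has_derivative_unique[OF A_derivative[OF y]] by metis
  define C where "C = A y v ** A y u + A y u ** A y v"
  have "((\<lambda>z. \<Phi> z ** A z u + A z u ** \<Phi> z) has_derivative
      (\<lambda>v. (\<Phi> y ** B y u v + A y v ** A y u) + (A y u ** A y v + B y u v ** \<Phi> y))) (at y)"
    by (intro has_derivative_add mm.FDERIV \<Phi>_derivative A_derivative y)
  moreover have "((\<lambda>z. \<Phi> z ** A z u + A z u ** \<Phi> z) has_derivative (\<lambda>v. 0)) (at y)"
    by (rule has_derivative_transform_within_open[OF has_derivative_const[of 0] open_U y])
      (simp add: A_anticommutes)
  ultimately have "(\<Phi> y ** B y u v + A y v ** A y u) + (A y u ** A y v + B y u v ** \<Phi> y) = 0"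
    by (rule fun_cong[OF has_derivative_unique])
  moreover have "x = - ((p + q) + z)" if "(x + p) + (q + z) = 0" for x p q z :: "complex^('k + 'k)^('k + 'k)"
  proof -
    have "x + ((p + q) + z) = 0" using that by (simp only: add_ac)
    then show ?thesis by (simp only: eq_neg_iff_add_eq_0)
  qed
  ultimately have "\<Phi> y ** B y u v = - (C + B y u v ** \<Phi> y)"
    unfolding C_def by blast
  then have "\<Phi> y ** B y u v ** \<Phi> y = - (C ** \<Phi> y + B y u v ** (\<Phi> y ** \<Phi> y))"
    by (simp only: mm.minus_left mm.add_left matrix_mul_assoc)
  then have PBP: "\<Phi> y ** B y u v ** \<Phi> y = - (C ** \<Phi> y) - B y u v"
    by (simp add: inv[OF y])
  have "B y u v + B y u v + B y u v + B y u v = 4 *\<^sub>R B y u v"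
    by (simp add: scaleR_left.add[of 2 2, simplified] scaleR_2)
  then have "tangent_proj (\<Phi> y) (B y u v) = (1 / 8) *\<^sub>R (4 *\<^sub>R B y u v - 4 *\<^sub>R (- (C ** \<Phi> y) - B y u v))"
    unfolding tangent_proj_def Let_def qB aB by (simp add: mm.scaleR_left mm.scaleR_right PBP)
  also have "\<dots> = (1 / 2 + 1 / 2) *\<^sub>R B y u v + (1 / 2) *\<^sub>R (C ** \<Phi> y)"
    unfolding scaleR_add_left by (simp add: scaleR_diff_right scaleR_add_right)
  finally show ?thesis unfolding C_def[symmetric] by simp
qed

lemma metric_deriv_eq:
  assumes y: "y \<in> U"
  shows "metric_deriv M c y w u v = 1 / 4 * (A y u \<bullet> B y v w + B y u w \<bullet> A y v)"
proof -
  have "((\<lambda>z. 1 / 4 * (A z u \<bullet> A z v)) has_derivative (\<lambda>w. 1 / 4 * (A y u \<bullet> B y v w + B y u w \<bullet> A y v))) (at y)"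
    by (intro has_derivative_mult_right has_derivative_inner A_derivative y)
  then have "((\<lambda>z. metric M c z u v) has_derivative (\<lambda>w. 1 / 4 * (A y u \<bullet> B y v w + B y u w \<bullet> A y v))) (at y)"
    by (rule has_derivative_transform_within_open[OF _ open_U y]) (simp add: metric_eq)
  from fun_cong[OF frechet_derivative_at[OF this], of w] show ?thesis by (simp only: metric_deriv_def)
qed

text \<open>The Gauss formula: the Christoffel symbol is the tangential part of the second
  derivative. In Koszul's formula four of the six terms cancel because \<open>B\<close> is
  symmetric.\<close>

lemma A_christoffel:
  assumes y: "y \<in> U"
  shows "A y (christoffel M c y u v) \<bullet> A y w = B y u v \<bullet> A y w"
proof -
  have rhs: "metric_deriv M c y u v w + metric_deriv M c y v u w - metric_deriv M c y w u v = 1 / 2 * (B y u v \<bullet> A y w)" for w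
    unfolding metric_deriv_eq[OF y] B_symmetric[OF y, of w] B_symmetric[OF y, of v u]
    by (simp add: inner_commute algebra_simps)
  have "linear (\<lambda>w. 1 / 4 * (B y u v \<bullet> A y w))"
    by (rule linearI) (simp_all add: linear_add[OF linear_A[OF y]] linear_scale[OF linear_A[OF y]] inner_add_right algebra_simps)
  from metric_riesz[OF y this] have ex: "\<exists>!z. \<forall>w. metric M c y z w = 1 / 4 * (B y u v \<bullet> A y w)" by simp
  have halve: "2 * x = 1 / 2 * z \<longleftrightarrow> x = 1 / 4 * z" for x z :: real by auto
  have "christoffel M c y u v = (THE z. \<forall>w. metric M c y z w = 1 / 4 * (B y u v \<bullet> A y w))"
    unfolding christoffel_def rhs halve ..
  with theI'[OF ex] have "metric M c y (christoffel M c y u v) w = 1 / 4 * (B y u v \<bullet> A y w)" by simp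
  then show ?thesis by (simp add: metric_eq[OF y])
qed

subsection \<open>Functions that are affine in the involution\<close>

definition affine :: "('a \<Rightarrow> real) \<Rightarrow> complex^('k + 'k)^('k + 'k) \<Rightarrow> bool"
  where "affine r N \<longleftrightarrow> (\<exists>d. \<forall>y\<in>U. (r \<circ> param c) y = \<Phi> y \<bullet> N + d)"

lemma affine_derivative:
  assumes "affine r N" and y: "y \<in> U"
  shows "frechet_derivative (r \<circ> param c) (at y) v = A y v \<bullet> N"
proof -
  obtain d where d: "\<And>y. y \<in> U \<Longrightarrow> (r \<circ> param c) y = \<Phi> y \<bullet> N + d"
    using assms(1) by (auto simp: affine_def)
  have "((\<lambda>y. \<Phi> y \<bullet> N + d) has_derivative (\<lambda>v. A y v \<bullet> N + 0)) (at y)"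
    by (intro has_derivative_add has_derivative_inner_left has_derivative_const \<Phi>_derivative y)
  then have "((r \<circ> param c) has_derivative (\<lambda>v. A y v \<bullet> N + 0)) (at y)"
    by (rule has_derivative_transform_within_open[OF _ open_U y]) (simp only: d)
  from fun_cong[OF frechet_derivative_at[OF this], of v] show ?thesis by simp
qed

lemma metric_grad:
  assumes "affine r N" and y: "y \<in> U"
  shows "metric M c y (grad M c r y) v = A y v \<bullet> N"
proof -
  have "linear (\<lambda>v. A y v \<bullet> N)"
    by (rule linearI) (simp_all add: linear_add[OF linear_A[OF y]] linear_scale[OF linear_A[OF y]] inner_add_left)
  from metric_riesz[OF y this] have ex: "\<exists>!u. \<forall>v. metric M c y u v = A y v \<bullet> N" by simp
  show ?thesis
    using theI'[OF ex] unfolding grad_def affine_derivative[OF assms] by blast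
qed

text \<open>The factor 4 undoes the \<open>1 / 4\<close> of the metric.\<close>

lemma A_grad:
  assumes "affine r N" and y: "y \<in> U"
  shows "A y (grad M c r y) = 4 *\<^sub>R tangent_proj (\<Phi> y) N"
proof (rule tangent_eqI[OF y A_tangent[OF y]])
  show "4 *\<^sub>R tangent_proj (\<Phi> y) N \<in> tangent_space (\<Phi> y)"
    using tangent_proj_in_tangent_space[OF involution[OF y], of N]
    by (simp add: tangent_space_def qconj_scaleR adj_scaleR mm.scaleR_left mm.scaleR_right)
  show "A y (grad M c r y) \<bullet> A y v = 4 *\<^sub>R tangent_proj (\<Phi> y) N \<bullet> A y v" for v
    using metric_grad[OF assms, of v] inner_tangent_proj[OF involution[OF y] A_tangent[OF y, of v], of N]
    by (simp add: metric_eq[OF y] inner_commute)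
qed

lemma metric_grad_grad:
  assumes "affine r N" "affine s N'" and y: "y \<in> U"
  shows "metric M c y (grad M c r y) (grad M c s y) = 4 * (tangent_proj (\<Phi> y) N \<bullet> N')"
proof -
  have "metric M c y (grad M c s y) (grad M c r y) = 4 * (tangent_proj (\<Phi> y) N \<bullet> N')"
    by (simp add: metric_grad[OF assms(2) y] A_grad[OF assms(1) y])
  then show ?thesis by (simp add: metric_eq[OF y] inner_commute)
qed

text \<open>The definite description \<open>grad\<close> is expressed by the inverse Gram operator
  applied to the differential, both of which depend smoothly on the point.\<close>

lemma grad_derivative:
  assumes r: "affine r N" and y: "y \<in> U"
  shows "(grad M c r has_derivative frechet_derivative (grad M c r) (at y)) (at y)"
proof -
  \<comment> \<open>The Gram operator: the metric in the chart, represented through the Euclidean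
    inner product of the model space.\<close>
  define G where "G z u = (\<Sum>b\<in>Basis. (1 / 4 * (A z u \<bullet> A z b)) *\<^sub>R b)" for z u
  have G: "G z u \<bullet> v = metric M c z u v" if "z \<in> U" for z u v
  proof -
    have "linear (metric M c z u)" using bilinear_metric[OF that] by (simp add: bilinear_def)
    then have "metric M c z u v = (\<Sum>b\<in>Basis. (v \<bullet> b) *\<^sub>R metric M c z u b)"
      by (rule linear_euclidean_sum)
    also have "\<dots> = (\<Sum>b\<in>Basis. (1 / 4 * (A z u \<bullet> A z b)) * (b \<bullet> v))"
      by (intro sum.cong refl) (simp add: metric_eq[OF that] inner_commute[of v])
    finally show ?thesis by (simp only: G_def inner_sum_left inner_scaleR_left)
  qed
  have lG: "linear (G z)" if "z \<in> U" for z
    by (rule linearI) (simp_all add: G_def linear_add[OF linear_A[OF that]] linear_scale[OF linear_A[OF that]]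
        inner_add_left scaleR_add_left algebra_simps sum.distrib scaleR_sum_right)
  have inj: "inj (G z)" if "z \<in> U" for z
    unfolding linear_injective_0[OF lG[OF that]]
    using G[OF that] metric_pos[OF that] by (metis inner_zero_left less_irrefl)
  then have surj: "surj (G z)" if "z \<in> U" for z
    using linear_injective_imp_surjective[OF lG[OF that]] that by simp
  have CA: "C_k_on k (\<lambda>z. A z u) U" for k u
    using smooth_A by (simp add: smooth_on_def)
  have CG: "C_k_on k (\<lambda>z. G z u) U" for k u
    unfolding G_def
  proof (rule C_k_on_sum[OF open_U])
    fix b :: 'e
    have "C_k_on k (\<lambda>z. A z u \<bullet> A z b) U"
      by (rule C_k_on_bilinear[OF open_U bounded_bilinear_inner CA CA])
    moreover have "bounded_linear (\<lambda>x. (1 / 4 * x) *\<^sub>R b)"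
      by (intro bounded_linear_scaleR_const bounded_linear_mult_right)
    ultimately show "C_k_on k (\<lambda>z. (1 / 4 * (A z u \<bullet> A z b)) *\<^sub>R b) U"
      using C_k_on_bounded_linear[OF open_U] by blast
  qed
  define R where "R z = inv (G z)" for z
  have GR: "G z (R z v) = v" "R z (G z v) = v" if "z \<in> U" for z v
    using inj[OF that] surj[OF that] by (simp_all add: R_def surj_f_inv_f)
  have CR: "C_k_on k (\<lambda>z. R z u) U" for k u
    by (rule C_k_on_inverse_family[OF lG GR open_U CG])
  have lR: "linear (R z)" if "z \<in> U" for z
    by (rule linear_two_sided_inverse[OF lG GR]) (rule that)+
  have "C_k_on (Suc 0) (grad M c r) U"
  proof (rule C_k_on_cong[OF open_U])
    show "C_k_on (Suc 0) (\<lambda>z. \<Sum>b\<in>Basis. (A z b \<bullet> N) *\<^sub>R R z b) U"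
      by (rule C_k_on_sum[OF open_U], rule C_k_on_bilinear[OF open_U bounded_bilinear_scaleR _ CR],
        rule C_k_on_bounded_linear[OF open_U bounded_linear_inner_left CA])
    fix z assume z: "z \<in> U"
    have "G z (grad M c r z) \<bullet> b = (\<Sum>b\<in>Basis. (A z b \<bullet> N) *\<^sub>R b) \<bullet> b" if "b \<in> Basis" for b
      using that by (simp add: G[OF z] metric_grad[OF r z])
    then have "G z (grad M c r z) = (\<Sum>b\<in>Basis. (A z b \<bullet> N) *\<^sub>R b)"
      by (rule euclidean_eqI)
    then have "grad M c r z = R z (\<Sum>b\<in>Basis. (A z b \<bullet> N) *\<^sub>R b)"
      using GR(2)[OF z] by metis
    then show "(\<Sum>b\<in>Basis. (A z b \<bullet> N) *\<^sub>R R z b) = grad M c r z"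
      by (simp add: linear_sum[OF lR[OF z]] linear_scale[OF lR[OF z]])
  qed
  then show ?thesis by (rule C_k_on_Suc_has_derivative[OF open_U _ y])
qed

text \<open>The Hessian of an affine function. Differentiating the identity that defines the
  gradient and inserting \<open>A_christoffel\<close> leaves the pairing of \<open>N\<close> with
  the normal part of \<open>B y w v\<close>.\<close>

lemma metric_cov_deriv_grad:
  assumes r: "affine r N" and y: "y \<in> U"
  shows "metric M c y (cov_deriv M c v (grad M c r) y) w =
    - (1 / 2) * (((A y v ** A y w + A y w ** A y v) ** \<Phi> y) \<bullet> N)"
proof -
  define X where "X = grad M c r"
  define X' where "X' = frechet_derivative X (at y)"
  have X: "(X has_derivative X') (at y)"
    unfolding X_def X'_def by (rule grad_derivative[OF r y])
  have AX: "((\<lambda>z. A z (X z)) has_derivative (\<lambda>h. B y (X y) h + A y (X' h))) (at y)"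
    by (rule has_derivative_linear_family[OF open_U y linear_A A_derivative[OF y] X])
  have "((\<lambda>z. A z (X z) \<bullet> A z w) has_derivative
      (\<lambda>h. A y (X y) \<bullet> B y w h + (B y (X y) h + A y (X' h)) \<bullet> A y w)) (at y)"
    by (rule has_derivative_inner[OF AX A_derivative[OF y]])
  moreover have "((\<lambda>z. A z (X z) \<bullet> A z w) has_derivative (\<lambda>h. 4 * (B y w h \<bullet> N))) (at y)"
  proof (rule has_derivative_transform_within_open[OF _ open_U y])
    show "((\<lambda>z. 4 * (A z w \<bullet> N)) has_derivative (\<lambda>h. 4 * (B y w h \<bullet> N))) (at y)"
      by (intro has_derivative_mult_right has_derivative_inner_left A_derivative y)
    show "4 * (A z w \<bullet> N) = A z (X z) \<bullet> A z w" if "z \<in> U" for z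
      using metric_grad[OF r that, of w] by (simp add: X_def metric_eq[OF that])
  qed
  ultimately have eq: "A y (X y) \<bullet> B y w v + (B y (X y) v + A y (X' v)) \<bullet> A y w = 4 * (B y w v \<bullet> N)"
    by (rule fun_cong[OF has_derivative_unique])
  define p where "p = tangent_proj (\<Phi> y)"
  have p: "p Z \<in> tangent_space (\<Phi> y)" "p Z \<bullet> p W = Z \<bullet> p W" for Z W
    unfolding p_def by (intro tangent_proj_in_tangent_space inner_tangent_proj involution y)+
  have "metric M c y (cov_deriv M c v X y) w =
      1 / 4 * ((A y (X' v) + A y (christoffel M c y v (X y))) \<bullet> A y w)"
    by (simp add: cov_deriv_def X'_def metric_eq[OF y] linear_add[OF linear_A[OF y]])
  also have "\<dots> = 1 / 4 * ((B y (X y) v + A y (X' v)) \<bullet> A y w)"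
    by (simp add: inner_add_left A_christoffel[OF y] B_symmetric[OF y, of v "X y"])
  \<comment> \<open>\<open>eq\<close> is solved for the wanted term, and the remaining
    \<open>A y (X y)\<close> is \<open>4 *\<^sub>R p N\<close>.\<close>
  also have "\<dots> = B y w v \<bullet> N - B y w v \<bullet> p N"
    using eq A_grad[OF r y] by (simp add: X_def p_def inner_commute)
  also have "\<dots> = (B y w v - p (B y w v)) \<bullet> N"
  proof -
    have "B y w v \<bullet> p N = p (B y w v) \<bullet> N"
      using p(2)[of "B y w v" N] p(2)[of N "B y w v"] by (simp add: inner_commute)
    then show ?thesis by (simp add: inner_diff_left)
  qed
  finally show ?thesis
    unfolding X_def p_def B_normal_part[OF y] by simp
qed

lemma divergence_grad:
  assumes r: "affine r N" and y: "y \<in> U"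
  shows "divergence M c (grad M c r) y = - ((real CARD('k + 'k) *\<^sub>R \<Phi> y - t *\<^sub>R mat 1) \<bullet> N)"
proof -
  have "\<exists>u. \<forall>v. metric M c y u v = b \<bullet> v" for b
    using metric_riesz[OF y bounded_linear.linear[OF bounded_linear_inner_right]] by blast
  \<comment> \<open>\<open>s b\<close> is the metric dual of the coordinate functional of
    \<open>b\<close>. It turns the coordinate trace in \<open>divergence\<close> into a metric trace
    of the Hessian.\<close>
  then obtain s where s: "\<And>b v. metric M c y (s b) v = b \<bullet> v" by metis
  have As: "A y (s b) \<bullet> A y v = 4 * (b \<bullet> v)" for b v
    using s[of b v] by (simp add: metric_eq[OF y])
  have A_sum: "(\<Sum>b\<in>Basis. (b \<bullet> v) *\<^sub>R A y b) = A y v" for v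
    using linear_euclidean_sum[OF linear_A[OF y], of v] by (simp add: inner_commute)
  have p4: "4 *\<^sub>R tangent_proj (\<Phi> y) Z \<in> tangent_space (\<Phi> y)" "4 *\<^sub>R tangent_proj (\<Phi> y) Z \<bullet> A y v = 4 * (A y v \<bullet> Z)" for Z v
    using tangent_proj_in_tangent_space[OF involution[OF y], of Z] inner_tangent_proj[OF involution[OF y] A_tangent[OF y, of v], of Z]
    by (simp_all add: tangent_space_def qconj_scaleR adj_scaleR mm.scaleR_left mm.scaleR_right inner_commute)
  have tan: "(\<Sum>b\<in>Basis. f b *\<^sub>R A y (h b)) \<in> tangent_space (\<Phi> y)" for f h
    using A_tangent[OF y, of "\<Sum>b\<in>Basis. f b *\<^sub>R h b"] by (simp add: linear_sum[OF linear_A[OF y]] linear_scale[OF linear_A[OF y]])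
  have frame1: "(\<Sum>b\<in>Basis. (A y b \<bullet> Z) *\<^sub>R A y (s b)) = 4 *\<^sub>R tangent_proj (\<Phi> y) Z" for Z
  proof (rule tangent_eqI[OF y tan p4(1)])
    fix v
    have "(\<Sum>b\<in>Basis. (A y b \<bullet> Z) *\<^sub>R A y (s b)) \<bullet> A y v = 4 * ((\<Sum>b\<in>Basis. (b \<bullet> v) *\<^sub>R A y b) \<bullet> Z)"
      by (simp add: inner_sum_left As sum_distrib_left mult_ac)
    then show "(\<Sum>b\<in>Basis. (A y b \<bullet> Z) *\<^sub>R A y (s b)) \<bullet> A y v = 4 *\<^sub>R tangent_proj (\<Phi> y) Z \<bullet> A y v"
      unfolding A_sum p4(2) .
  qed
  \<comment> \<open>The roles of the dual frames are exchanged; this reduces to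
    \<open>frame1\<close> at the tangent vector \<open>A y v\<close>, which the projection
    fixes.\<close>
  have frame2: "(\<Sum>b\<in>Basis. (A y (s b) \<bullet> Z) *\<^sub>R A y b) = 4 *\<^sub>R tangent_proj (\<Phi> y) Z" for Z
  proof (rule tangent_eqI[OF y tan p4(1)])
    fix v
    have *: "(\<Sum>b\<in>Basis. (A y b \<bullet> A y v) *\<^sub>R A y (s b)) = 4 *\<^sub>R A y v"
      unfolding frame1
    proof (rule tangent_eqI[OF y p4(1)])
      show "4 *\<^sub>R A y v \<in> tangent_space (\<Phi> y)"
        using A_tangent[OF y, of "4 *\<^sub>R v"] by (simp add: linear_scale[OF linear_A[OF y]])
      show "4 *\<^sub>R tangent_proj (\<Phi> y) (A y v) \<bullet> A y w = 4 *\<^sub>R A y v \<bullet> A y w" for w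
        unfolding p4(2) by (simp add: inner_commute)
    qed
    have "(\<Sum>b\<in>Basis. (A y (s b) \<bullet> Z) *\<^sub>R A y b) \<bullet> A y v = (\<Sum>b\<in>Basis. (A y b \<bullet> A y v) *\<^sub>R A y (s b)) \<bullet> Z"
      by (simp add: inner_sum_left mult.commute)
    then show "(\<Sum>b\<in>Basis. (A y (s b) \<bullet> Z) *\<^sub>R A y b) \<bullet> A y v = 4 *\<^sub>R tangent_proj (\<Phi> y) Z \<bullet> A y v"
      unfolding * p4(2) by simp
  qed
  define C where "C = real CARD('k + 'k) *\<^sub>R mat 1 - t *\<^sub>R \<Phi> y"
  have C1: "(\<Sum>b\<in>Basis. A y b ** A y (s b)) = C"
    unfolding C_def by (rule sum_mult_of_tangent_frame[OF involution[OF y] trace_\<Phi>[OF y] frame1])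
  have C2: "(\<Sum>b\<in>Basis. A y (s b) ** A y b) = C"
    unfolding C_def by (rule sum_mult_of_tangent_frame[OF involution[OF y] trace_\<Phi>[OF y] frame2])
  have "divergence M c (grad M c r) y = (\<Sum>b\<in>Basis. metric M c y (cov_deriv M c b (grad M c r) y) (s b))"
  proof -
    have "metric M c y z (s b) = metric M c y (s b) z" for z b
      by (simp add: metric_eq[OF y] inner_commute)
    then show ?thesis by (simp add: divergence_def s inner_commute)
  qed
  also have "\<dots> = (\<Sum>b\<in>Basis. - (1 / 2) * (((A y b ** A y (s b) + A y (s b) ** A y b) ** \<Phi> y) \<bullet> N))"
    by (simp only: metric_cov_deriv_grad[OF r y])
  also have "\<dots> = - (1 / 2) * (((\<Sum>b\<in>Basis. A y b ** A y (s b) + A y (s b) ** A y b) ** \<Phi> y) \<bullet> N)"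
    by (simp only: mm.sum_left inner_sum_left sum_distrib_left)
  also have "\<dots> = - ((C ** \<Phi> y) \<bullet> N)"
    by (simp only: sum.distrib C1 C2 mm.add_left inner_add_left) simp
  \<comment> \<open>Here \<open>\<Phi> y ** \<Phi> y = mat 1\<close> moves the trace from
    \<open>\<Phi> y\<close> to \<open>mat 1\<close>.\<close>
  also have "C ** \<Phi> y = real CARD('k + 'k) *\<^sub>R \<Phi> y - t *\<^sub>R mat 1"
    using involution[OF y] by (simp add: C_def involution_def mm.diff_left mm.scaleR_left)
  finally show ?thesis .
qed

end

section \<open>Charts of the quaternionic Grassmannian\<close>

lemma I_mn_nth: "I_mn $ i $ j = (if i = j then (case i of Inl _ \<Rightarrow> 1 | Inr _ \<Rightarrow> - 1) else 0)"
  by (auto simp: I_mn_def block_def mat_def split: sum.splits)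

lemma I_tilde_nth: "I_tilde $ i $ j = (if i = j then I_mn $ (case i of Inl a \<Rightarrow> a | Inr a \<Rightarrow> a) $ (case i of Inl a \<Rightarrow> a | Inr a \<Rightarrow> a) else 0)"
  by (auto simp: I_tilde_def block_def I_mn_nth split: sum.splits)

lemma involution_I_tilde: "involution (I_tilde :: ('m::finite, 'n::finite) qmat)"
proof -
  let ?d = "\<lambda>i. I_tilde $ i $ i :: complex"
  have sq: "?d i * ?d i = 1" and cnj: "cnj (?d i) = ?d i" for i :: "('m + 'n) + ('m + 'n)"
    by (auto simp: I_tilde_nth I_mn_nth split: sum.splits)
  have off: "I_tilde $ i $ j = 0" if "i \<noteq> j" for i j :: "('m + 'n) + ('m + 'n)"
    using that by (simp add: I_tilde_nth)
  have "(I_tilde ** I_tilde :: ('m, 'n) qmat) $ i $ j = mat 1 $ i $ j" for i j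
  proof -
    have "(I_tilde ** I_tilde :: ('m, 'n) qmat) $ i $ j = (\<Sum>k\<in>UNIV. if k = i then if i = j then 1 else 0 else 0)"
      unfolding matrix_matrix_mult_def vec_lambda_beta
    proof (rule sum.cong[OF refl])
      fix k :: "('m + 'n) + ('m + 'n)"
      show "I_tilde $ i $ k * I_tilde $ k $ j = (if k = i then if i = j then 1 else 0 else 0)"
        by (cases "i = k"; cases "k = j") (simp_all add: sq off)
    qed
    then show ?thesis by (simp add: mat_def)
  qed
  moreover have "adj I_tilde = (I_tilde :: ('m, 'n) qmat)"
    by (auto simp: vec_eq_iff adj_nth I_tilde_nth I_mn_nth split: sum.splits)
  moreover have "qconj I_tilde = (I_tilde :: ('m, 'n) qmat)"
    by (auto simp: vec_eq_iff qconj_def I_tilde_nth I_mn_nth sgi_def swp_def split: sum.splits)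
  ultimately show ?thesis by (simp add: involution_def vec_eq_iff)
qed

lemmas I_tilde_simps = involution_I_tilde[unfolded involution_def, THEN conjunct1]
  involution_I_tilde[unfolded involution_def, THEN conjunct2, THEN conjunct1]
  involution_I_tilde[unfolded involution_def, THEN conjunct2, THEN conjunct2]

lemma I_tilde_cancel: "A ** I_tilde ** I_tilde = A"
  by (simp add: I_tilde_simps flip: matrix_mul_assoc)

lemma trace_I_tilde:
  "\<exists>t. trace (I_tilde :: ('m::finite, 'n::finite) qmat) = of_real t"
proof -
  have "cnj (trace (I_tilde :: ('m, 'n) qmat)) = trace (adj I_tilde :: ('m, 'n) qmat)"
    by (simp add: trace_def adj_nth)
  then have "trace (I_tilde :: ('m, 'n) qmat) \<in> \<real>"
    by (simp add: I_tilde_simps Reals_cnj_iff)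
  then show ?thesis by (auto elim: Reals_cases)
qed

lemma Sp_mult: "q \<in> Sp \<Longrightarrow> k \<in> Sp \<Longrightarrow> q ** k \<in> Sp"
proof -
  assume q: "q \<in> Sp" and k: "k \<in> Sp"
  have "adj k ** adj q ** (q ** k) = adj k ** (adj q ** q) ** k"
    "q ** k ** (adj k ** adj q) = q ** (k ** adj k) ** adj q"
    by (simp_all only: matrix_mul_assoc)
  then show ?thesis using q k by (simp add: Sp_iff qconj_mult adj_mult)
qed

lemma Sp_adj: "q \<in> Sp \<Longrightarrow> adj q \<in> Sp"
  by (simp add: Sp_iff qconj_adj)

lemma Sp_Sp_iff: "k \<in> Sp_Sp \<longleftrightarrow> k \<in> Sp \<and> I_tilde ** k = k ** I_tilde"
proof -
  have "I_tilde ** k ** I_tilde = k \<longleftrightarrow> I_tilde ** k = k ** I_tilde"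
    by (metis I_tilde_cancel)
  then show ?thesis by (simp add: Sp_Sp_def)
qed

lemma Sp_Sp_mult:
  assumes "k \<in> Sp_Sp" "l \<in> Sp_Sp"
  shows "k ** l \<in> Sp_Sp"
proof -
  have "I_tilde ** (k ** l) = k ** (I_tilde ** l)"
    using assms(1) by (simp add: Sp_Sp_iff matrix_mul_assoc)
  also have "\<dots> = k ** l ** I_tilde"
    using assms(2) by (simp add: Sp_Sp_iff matrix_mul_assoc)
  finally show ?thesis using assms by (simp add: Sp_Sp_iff Sp_mult)
qed

lemma Sp_Sp_adj:
  assumes "k \<in> Sp_Sp"
  shows "adj k \<in> Sp_Sp"
proof -
  have "adj (I_tilde ** k) = adj (k ** I_tilde)" using assms by (simp add: Sp_Sp_iff)
  then show ?thesis using assms by (simp add: Sp_Sp_iff Sp_adj adj_mult I_tilde_simps)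
qed

lemma mat_1_in_Sp_Sp: "mat 1 \<in> Sp_Sp"
  by (simp add: Sp_Sp_iff Sp_iff)

lemma natural_proj_mult:
  assumes k: "k \<in> Sp_Sp"
  shows "natural_proj (q ** k) = natural_proj q"
proof -
  have "k ** adj k = mat 1" using k by (simp add: Sp_Sp_iff Sp_iff)
  then have "q ** l = q ** k ** (adj k ** l)" for l
    by (metis matrix_mul_assoc matrix_mul_rid)
  then show ?thesis
    unfolding natural_proj_def image_def
    using Sp_Sp_mult[OF k] Sp_Sp_mult[OF Sp_Sp_adj[OF k]] by (auto simp: matrix_mul_assoc[symmetric]; blast)
qed

text \<open>The orbit of \<open>I_tilde\<close> under conjugation. The matrix with entries
  \<open>psi j \<alpha> q\<close> is the orthogonal projection onto the eigenspace of
  \<open>orbit_map q\<close> for the eigenvalue 1, for \<open>q\<close> in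
  \<open>Sp\<close>.\<close>

definition orbit_map :: "('m::finite, 'n::finite) qmat \<Rightarrow> ('m, 'n) qmat"
  where "orbit_map q = q ** I_tilde ** adj q"

lemma orbit_map_mult: "k \<in> Sp_Sp \<Longrightarrow> orbit_map (q ** k) = orbit_map q"
proof -
  assume k: "k \<in> Sp_Sp"
  have "orbit_map (q ** k) = q ** (k ** I_tilde) ** adj k ** adj q"
    by (simp add: orbit_map_def adj_mult matrix_mul_assoc)
  also have "k ** I_tilde = I_tilde ** k" using k by (simp add: Sp_Sp_iff)
  also have "q ** (I_tilde ** k) ** adj k ** adj q = q ** I_tilde ** (k ** adj k) ** adj q"
    by (simp only: matrix_mul_assoc)
  finally show ?thesis using k by (simp add: orbit_map_def Sp_Sp_iff Sp_iff)
qed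

lemma natural_proj_orbit_map:
  assumes "natural_proj q = natural_proj q'"
  shows "orbit_map q = orbit_map q'"
proof -
  have "q ** mat 1 \<in> natural_proj q" unfolding natural_proj_def using mat_1_in_Sp_Sp by blast
  then show ?thesis using assms orbit_map_mult by (auto simp: natural_proj_def)
qed

lemma Sp_conjugate: "q \<in> Sp \<Longrightarrow> (q ** S ** adj q) ** (q ** T ** adj q) = q ** (S ** T) ** adj q"
proof -
  assume "q \<in> Sp"
  then have qq: "adj q ** q = mat 1" by (simp add: Sp_iff)
  have "(q ** S ** adj q) ** (q ** T ** adj q) = q ** S ** (adj q ** q) ** T ** adj q"
    by (simp only: matrix_mul_assoc)
  then show ?thesis unfolding qq matrix_mul_rid by (simp only: matrix_mul_assoc)
qed

lemma involution_orbit_map: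
  assumes "q \<in> Sp"
  shows "involution (orbit_map q)"
proof -
  have "qconj q = q" "q ** adj q = mat 1" using assms by (auto simp: Sp_iff)
  then show ?thesis
    by (simp add: involution_def orbit_map_def Sp_conjugate[OF assms] qconj_mult qconj_adj I_tilde_simps)
      (simp add: adj_mult I_tilde_simps matrix_mul_assoc)
qed

lemma trace_orbit_map:
  fixes q :: "('m::finite, 'n::finite) qmat"
  assumes "q \<in> Sp"
  shows "trace (orbit_map q) = trace (I_tilde :: ('m, 'n) qmat)"
proof -
  have "trace (orbit_map q) = trace (adj q ** q ** (I_tilde :: ('m, 'n) qmat))"
    unfolding orbit_map_def by (subst trace_mul_sym) (simp only: matrix_mul_assoc)
  then show ?thesis using assms by (simp add: Sp_iff)
qed

lemma psi_hat_natural_proj: "psi_hat j \<alpha> (natural_proj q) = psi j \<alpha> q"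
proof -
  have "psi j \<alpha> p = psi j \<alpha> q" if "p \<in> natural_proj q" for p
  proof -
    obtain k where "k \<in> Sp_Sp" "p = q ** k" using \<open>p \<in> natural_proj q\<close> by (auto simp: natural_proj_def)
    then show ?thesis unfolding psi_def orbit_map_def[symmetric] by (simp only: orbit_map_mult)
  qed
  moreover have "q ** mat 1 \<in> natural_proj q"
    unfolding natural_proj_def by (rule imageI[OF mat_1_in_Sp_Sp])
  then have "q \<in> natural_proj q" by simp
  ultimately have "psi j \<alpha> ` natural_proj q = {psi j \<alpha> q}" by blast
  then show ?thesis by (simp add: psi_hat_def)
qed

text \<open>The submersion provides derivatives only within \<open>Sp\<close>. The Cayley family
  stays in \<open>Sp\<close>, so composing with it gives an unrestricted derivative on a vector
  space, where uniqueness is available.\<close>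

lemma has_derivative_cayley_translate:
  assumes q: "q \<in> Sp" "q \<in> W" "open W" and l: "bounded_linear l" "\<And>e. l e \<in> sp_algebra"
    and f: "(f has_derivative L) (at q within Sp \<inter> W)"
  shows "((\<lambda>e. f (q ** cayley (l e))) has_derivative (\<lambda>h. L (q ** l h))) (at 0)"
proof -
  define G where "G e = q ** cayley (l e)" for e
  have skew: "adj (l e) = - l e" for e using l(2) by (simp add: sp_algebra_iff)
  have l0: "l 0 = 0" by (rule linear_0[OF bounded_linear.linear[OF l(1)]])
  have G: "(G has_derivative (\<lambda>h. q ** l h)) (at 0)"
    unfolding G_def by (rule bounded_linear.has_derivative[OF mm.bounded_linear_right has_derivative_cayley[OF l(1) skew]])
  have cont: "continuous_on UNIV G"
    unfolding G_def
    by (rule bounded_linear.continuous_on[OF mm.bounded_linear_right C_k_on_continuous[OF C_k_on_cayley[OF l(1) skew]]])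
  have G_Sp: "G e \<in> Sp" for e unfolding G_def by (intro Sp_mult q cayley_in_Sp l)
  have G0: "G 0 = q" by (simp add: G_def l0)
  have "open (G -` W)" using cont q(3) by (simp add: continuous_on_open_vimage)
  moreover have "0 \<in> G -` W" using G0 q by simp
  ultimately have within: "at 0 within G -` W = at 0" by (rule at_within_open[rotated])
  have "(f has_derivative L) (at (G 0) within G ` (G -` W))"
    unfolding G0 by (rule has_derivative_subset[OF f]) (use G_Sp in auto)
  from has_derivative_in_compose[OF _ this, of "\<lambda>h. q ** l h"] G
  show ?thesis unfolding within G_def by blast
qed

section \<open>The embedding read in an arbitrary chart of the quotient\<close>

locale grassmannian_chart =
  fixes M :: "(('m::finite, 'n::finite) qmat set, 'e::euclidean_space) riem"
    and c :: "(('m, 'n) qmat set, 'e) chart"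
  assumes grassmannian: "quaternionic_grassmannian M" and c: "c \<in> atlas M"
begin

definition U where "U = crd c ` chart_dom c"

definition D where "D = {q \<in> Sp. natural_proj q \<in> chart_dom c}"

definition F where "F q = crd c (natural_proj q)"

text \<open>The choice of a representative is harmless: \<open>orbit_map\<close> depends on the
  coset only, see \<open>\<Phi>_F\<close>.\<close>

definition \<Phi> where "\<Phi> y = orbit_map (SOME q. q \<in> Sp \<and> natural_proj q = param c y)"

lemma chart: "inj_on (crd c) (chart_dom c)" "open U" "chart_dom c \<subseteq> Sp_quotient"
  using grassmannian c
  unfolding quaternionic_grassmannian_def riemannian_manifold_def smooth_manifold_def U_def by auto

lemma metric_pos: "y \<in> U \<Longrightarrow> u \<noteq> 0 \<Longrightarrow> metric M c y u u > 0"
  using grassmannian c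
  unfolding quaternionic_grassmannian_def riemannian_manifold_def U_def by blast

lemma param_crd: "x \<in> chart_dom c \<Longrightarrow> param c (crd c x) = x"
  unfolding param_def by (rule inv_into_f_f[OF chart(1)])

lemma F_in_U: "q \<in> D \<Longrightarrow> F q \<in> U"
  by (auto simp: D_def F_def U_def)

lemma D_over_U:
  assumes "y \<in> U"
  obtains q where "q \<in> D" "F q = y"
proof -
  obtain x where x: "x \<in> chart_dom c" "y = crd c x" using assms by (auto simp: U_def)
  then obtain q where "q \<in> Sp" "x = natural_proj q" using chart(3) by (auto simp: Sp_quotient_def)
  then show thesis using x that by (auto simp: D_def F_def)
qed

lemma param_F: "q \<in> D \<Longrightarrow> param c (F q) = natural_proj q"
  by (simp add: D_def F_def param_crd)

lemma \<Phi>_F: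
  assumes "q \<in> D"
  shows "\<Phi> (F q) = orbit_map q"
proof -
  have "\<exists>p. p \<in> Sp \<and> natural_proj p = natural_proj q" using assms by (auto simp: D_def)
  then have "natural_proj (SOME p. p \<in> Sp \<and> natural_proj p = natural_proj q) = natural_proj q"
    by (metis (mono_tags, lifting) someI_ex)
  then show ?thesis
    unfolding \<Phi>_def param_F[OF assms] by (rule natural_proj_orbit_map)
qed

lemma submersion:
  shows "openin (top_of_set Sp) D" "smooth_on_submanifold F D"
    and "q \<in> D \<Longrightarrow> \<exists>L. (F has_derivative L) (at q within D) \<and> L ` Sp_tangent q = UNIV \<and>
      (let horizontal = {v \<in> Sp_tangent q. \<forall>u\<in>Sp_tangent q. L u = 0 \<longrightarrow> Sp_metric q v u = 0} in
        \<forall>v\<in>horizontal. \<forall>w\<in>horizontal. metric M c (F q) (L v) (L w) = Sp_metric q v w)"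
proof -
  have F: "F = crd c \<circ> natural_proj" by (auto simp: F_def)
  have *: "let D = {q \<in> Sp. natural_proj q \<in> chart_dom c} in
       openin (top_of_set Sp) D \<and>
       smooth_on_submanifold (crd c \<circ> natural_proj) D \<and>
       (\<forall>q\<in>D. \<exists>L.
          ((crd c \<circ> natural_proj) has_derivative L) (at q within D) \<and>
          L ` Sp_tangent q = UNIV \<and>
          (let horizontal = {v \<in> Sp_tangent q. \<forall>u\<in>Sp_tangent q. L u = 0 \<longrightarrow> Sp_metric q v u = 0} in
           \<forall>v\<in>horizontal. \<forall>w\<in>horizontal.
             metric M c (crd c (natural_proj q)) (L v) (L w) = Sp_metric q v w))"
    using grassmannian c unfolding quaternionic_grassmannian_def riemannian_submersion_def by blast
  note ** = *[unfolded Let_def, folded D_def F F_def]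
  show "openin (top_of_set Sp) D" "smooth_on_submanifold F D"
    using ** by blast+
  show "\<exists>L. (F has_derivative L) (at q within D) \<and> L ` Sp_tangent q = UNIV \<and>
      (let horizontal = {v \<in> Sp_tangent q. \<forall>u\<in>Sp_tangent q. L u = 0 \<longrightarrow> Sp_metric q v u = 0} in
        \<forall>v\<in>horizontal. \<forall>w\<in>horizontal. metric M c (F q) (L v) (L w) = Sp_metric q v w)" if "q \<in> D"
    unfolding Let_def using ** that by blast
qed

lemma D_open: obtains W where "open W" "D = Sp \<inter> W"
  using submersion(1) by (auto simp: openin_open)

text \<open>Near each point \<open>\<Phi>\<close> factors through a smooth local section of the projection, obtained by
  inverting the coordinates along the Cayley transform of a complement of the vertical space.\<close>

lemma smooth_\<Phi>: "smooth_on \<Phi> U"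
proof -
  have "\<exists>V. open V \<and> y \<in> V \<and> C_k_on k \<Phi> V" if y: "y \<in> U" for y k
  proof -
    obtain q where q: "q \<in> D" "F q = y" by (rule D_over_U[OF y])
    obtain L where L: "(F has_derivative L) (at q within D)" "L ` Sp_tangent q = UNIV"
      using submersion(3)[OF q(1)] by blast
    have linL: "linear L" by (rule has_derivative_linear[OF L(1)])
    have qSp: "q \<in> Sp" using q by (simp add: D_def)
    obtain W where W: "open W" "D = Sp \<inter> W" by (rule D_open)
    obtain V F' where "open V \<and> q \<in> V \<and> smooth_on F' V \<and> (\<forall>x\<in>V \<inter> D. F' x = F x)"
      using bspec[OF submersion(2)[unfolded smooth_on_submanifold_def] q(1)] by (elim exE)
    then have V: "open V" "q \<in> V" "smooth_on F' V" "\<And>x. x \<in> V \<inter> D \<Longrightarrow> F' x = F x"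
      by simp_all
    have "\<exists>X. X \<in> sp_algebra \<and> L (q ** X) = b" for b
    proof -
      have "b \<in> L ` Sp_tangent q" using L(2) by simp
      then show ?thesis by (auto simp: Sp_tangent_def)
    qed
    \<comment> \<open>Lifts of the coordinate basis through the surjective differential. Extended
      linearly they give \<open>l\<close> with \<open>L (q ** l h) = h\<close>, so the coordinates
      along the Cayley family have the identity as derivative at 0.\<close>
    then obtain X where X: "\<And>b. X b \<in> sp_algebra" "\<And>b. L (q ** X b) = b" by metis
    define l where "l e = (\<Sum>b\<in>Basis. (e \<bullet> b) *\<^sub>R X b)" for e
    have l: "bounded_linear l"
      unfolding l_def by (intro bounded_linear_sum bounded_linear_scaleR_const bounded_linear_inner_left)
    have l_sp: "l e \<in> sp_algebra" for e
      unfolding l_def by (intro sp_algebra_sum sp_algebra_scaleR X)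
    have skew: "adj (l e) = - l e" for e using l_sp by (simp add: sp_algebra_iff)
    have l0: "l 0 = 0" by (rule linear_0[OF bounded_linear.linear[OF l]])
    have Ll: "L (q ** l h) = h" for h
      by (simp add: l_def mm.sum_right mm.scaleR_right linear_sum[OF linL] linear_scale[OF linL] X(2) euclidean_representation)
    define G where "G e = q ** cayley (l e)" for e
    have G_Sp: "G e \<in> Sp" for e unfolding G_def by (intro Sp_mult qSp cayley_in_Sp l_sp)
    have G0: "G 0 = q" by (simp add: G_def l0)
    have CG: "C_k_on k G UNIV" for k
      unfolding G_def
      by (rule C_k_on_bounded_linear[OF open_UNIV mm.bounded_linear_right C_k_on_cayley[OF l skew]])
    define S where "S = G -` (V \<inter> W)"
    have S: "open S" "0 \<in> S"
      using C_k_on_continuous[OF CG] V W q G0 by (auto simp: S_def continuous_on_open_vimage)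
    \<comment> \<open>\<open>F'\<close> is the smooth ambient extension of \<open>F\<close>, to
      which the chain rule on open sets applies; on \<open>S\<close> it agrees with \<open>F\<close>
      along \<open>G\<close>.\<close>
    define \<phi> where "\<phi> e = F' (G e)" for e
    have \<phi>: "\<phi> e = F (G e)" "G e \<in> D" if "e \<in> S" for e
      using that V(4) G_Sp W(2) by (auto simp: \<phi>_def S_def)
    have "C_k_on k \<phi> S" for k
      unfolding \<phi>_def
      by (rule C_k_on_compose[OF S(1) V(1) _ C_k_on_subset[OF CG subset_UNIV]])
        (use V(3) in \<open>auto simp: S_def smooth_on_def\<close>)
    then have smooth: "smooth_on \<phi> S" by (simp add: smooth_on_def)
    have "((\<lambda>e. F (G e)) has_derivative (\<lambda>h. L (q ** l h))) (at 0)"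
      unfolding G_def using L(1) qSp q(1) W l l_sp by (intro has_derivative_cayley_translate[of q W]) auto
    then have "((\<lambda>e. F (G e)) has_derivative (\<lambda>h. h)) (at 0)" by (simp only: Ll)
    then have d\<phi>: "(\<phi> has_derivative (\<lambda>h. h)) (at 0)"
      by (rule has_derivative_transform_within_open[OF _ S]) (simp only: \<phi>)
    obtain S' N s where N: "open S'" "S' \<subseteq> S" "0 \<in> S'" "open N" "\<phi> 0 \<in> N" "\<And>y. y \<in> N \<Longrightarrow> s y \<in> S'"
      "\<And>y. y \<in> N \<Longrightarrow> \<phi> (s y) = y" "smooth_on s N"
      using smooth_on_local_inverse[OF S smooth d\<phi> bounded_linear_ident refl] by blast
    have "y \<in> N" using N(5) \<phi>(1)[OF S(2)] G0 q(2) by simp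
    moreover have "C_k_on k \<Phi> N"
    proof (rule C_k_on_cong[OF N(4)])
      have "C_k_on k (\<lambda>e. G e ** I_tilde ** adj (G e)) UNIV"
        by (rule C_k_on_bilinear[OF open_UNIV mm.bounded_bilinear_axioms
            C_k_on_bounded_linear[OF open_UNIV mm.bounded_linear_left CG]
            C_k_on_bounded_linear[OF open_UNIV bounded_linear_adj CG]])
      moreover have "C_k_on k s N" using N(8) by (simp add: smooth_on_def)
      ultimately show "C_k_on k (\<lambda>y. G (s y) ** I_tilde ** adj (G (s y))) N"
        using C_k_on_compose[OF N(4) open_UNIV, of k "\<lambda>e. G e ** I_tilde ** adj (G e)" s] by simp
      \<comment> \<open>\<open>G (s z)\<close> is a representative of the coset with coordinates
        \<open>z\<close>, chosen smoothly in \<open>z\<close>.\<close>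
      show "G (s z) ** I_tilde ** adj (G (s z)) = \<Phi> z" if "z \<in> N" for z
      proof -
        have "s z \<in> S" using N(2,6) that by blast
        then have "F (G (s z)) = z" using \<phi>(1) N(7)[OF that] by metis
        with \<Phi>_F[OF \<phi>(2)[OF \<open>s z \<in> S\<close>]] show ?thesis by (simp add: orbit_map_def)
      qed
    qed
    ultimately show ?thesis using N(4) by blast
  qed
  then show ?thesis unfolding smooth_on_def by (intro allI C_k_on_local) blast
qed

text \<open>Along the Cayley curve through \<open>q\<close> in direction \<open>X\<close>, the
  composite of \<open>\<Phi>\<close> and \<open>F\<close> is the orbit map. The chain rule and the
  product rule compute the same derivative; skewness of \<open>X\<close> produces the
  commutator.\<close>

lemma \<Phi>_derivative:
  assumes q: "q \<in> D" and L: "(F has_derivative L) (at q within D)" and X: "X \<in> sp_algebra"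
  shows "frechet_derivative \<Phi> (at (F q)) (L (q ** X)) = q ** (X ** I_tilde - I_tilde ** X) ** adj q"
proof -
  obtain W where W: "open W" "D = Sp \<inter> W" by (rule D_open)
  have qSp: "q \<in> Sp" using q by (simp add: D_def)
  have l: "bounded_linear (\<lambda>t. t *\<^sub>R X)" by (rule bounded_linear_scaleR_left)
  have l_sp: "t *\<^sub>R X \<in> sp_algebra" for t by (rule sp_algebra_scaleR[OF X])
  have aX: "adj X = - X" using X by (simp add: sp_algebra_iff)
  have skew: "adj (t *\<^sub>R X) = - (t *\<^sub>R X)" for t by (simp add: adj_scaleR aX)
  define G where "G t = q ** cayley (t *\<^sub>R X)" for t
  have G_Sp: "G t \<in> Sp" for t unfolding G_def by (intro Sp_mult qSp cayley_in_Sp l_sp)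
  have G0: "G 0 = q" by (simp add: G_def)
  have cont: "continuous_on UNIV G"
    unfolding G_def
    by (rule bounded_linear.continuous_on[OF mm.bounded_linear_right C_k_on_continuous[OF C_k_on_cayley[OF l skew]]])
  define S where "S = G -` W"
  have S: "open S" "0 \<in> S"
    using cont W q G0 by (auto simp: S_def continuous_on_open_vimage)
  have G: "(G has_derivative (\<lambda>h. q ** (h *\<^sub>R X))) (at 0)"
    unfolding G_def by (rule bounded_linear.has_derivative[OF mm.bounded_linear_right has_derivative_cayley[OF l skew]])
  have "((\<lambda>t. F (G t)) has_derivative (\<lambda>h. L (q ** (h *\<^sub>R X)))) (at 0)"
    unfolding G_def using L qSp q W l l_sp by (intro has_derivative_cayley_translate[of q W]) auto
  moreover have "(\<Phi> has_derivative frechet_derivative \<Phi> (at (F q))) (at (F (G 0)))"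
    unfolding G0 by (rule smooth_on_has_derivative[OF chart(2) smooth_\<Phi> F_in_U[OF q]])
  ultimately have "((\<lambda>t. \<Phi> (F (G t))) has_derivative (\<lambda>h. frechet_derivative \<Phi> (at (F q)) (L (q ** (h *\<^sub>R X))))) (at 0)"
    by (rule has_derivative_compose)
  then have 1: "((\<lambda>t. G t ** I_tilde ** adj (G t)) has_derivative
      (\<lambda>h. frechet_derivative \<Phi> (at (F q)) (L (q ** (h *\<^sub>R X))))) (at 0)"
    by (rule has_derivative_transform_within_open[OF _ S])
      (use G_Sp W in \<open>simp add: S_def \<Phi>_F orbit_map_def\<close>)
  have 2: "((\<lambda>t. G t ** I_tilde ** adj (G t)) has_derivative
      (\<lambda>h. G 0 ** I_tilde ** adj (q ** (h *\<^sub>R X)) + q ** (h *\<^sub>R X) ** I_tilde ** adj (G 0))) (at 0)"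
    by (intro mm.FDERIV bounded_linear.has_derivative[OF mm.bounded_linear_left G]
        bounded_linear.has_derivative[OF bounded_linear_adj G])
  have "frechet_derivative \<Phi> (at (F q)) (L (q ** (1 *\<^sub>R X))) =
      G 0 ** I_tilde ** adj (q ** (1 *\<^sub>R X)) + q ** (1 *\<^sub>R X) ** I_tilde ** adj (G 0)"
    by (rule fun_cong[OF has_derivative_unique[OF 1 2], of 1])
  also have "\<dots> = q ** (X ** I_tilde - I_tilde ** X) ** adj q"
    by (simp add: G0 adj_mult aX mm.minus_left mm.minus_right mm.diff_left mm.diff_right matrix_mul_assoc)
  finally show ?thesis by simp
qed

text \<open>For such \<open>Z\<close> the Cayley curve lies in \<open>Sp_Sp\<close>, so
  \<open>F\<close> is constant along its translate by \<open>q\<close>.\<close>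

lemma vertical:
  assumes q: "q \<in> D" and L: "(F has_derivative L) (at q within D)"
    and Z: "Z \<in> sp_algebra" "I_tilde ** Z = Z ** I_tilde"
  shows "L (q ** Z) = 0"
proof -
  obtain W where W: "open W" "D = Sp \<inter> W" by (rule D_open)
  have l_sp: "t *\<^sub>R Z \<in> sp_algebra" for t by (rule sp_algebra_scaleR[OF Z(1)])
  have "((\<lambda>t. F (q ** cayley (t *\<^sub>R Z))) has_derivative (\<lambda>h. L (q ** (h *\<^sub>R Z)))) (at 0)"
    using L q W l_sp by (intro has_derivative_cayley_translate[of q W] bounded_linear_scaleR_left) auto
  moreover have "F (q ** cayley (t *\<^sub>R Z)) = F q" for t
  proof -
    have "I_tilde ** cayley (t *\<^sub>R Z) = cayley (t *\<^sub>R Z) ** I_tilde"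
      by (rule cayley_commute) (use l_sp[of t] Z(2) in \<open>simp_all add: sp_algebra_iff mm.scaleR_left mm.scaleR_right\<close>)
    then have "cayley (t *\<^sub>R Z) \<in> Sp_Sp" by (simp add: Sp_Sp_iff cayley_in_Sp l_sp)
    then show ?thesis by (simp add: F_def natural_proj_mult)
  qed
  ultimately have "((\<lambda>t::real. F q) has_derivative (\<lambda>h. L (q ** (h *\<^sub>R Z)))) (at 0)" by simp
  from fun_cong[OF has_derivative_unique[OF this has_derivative_const], of 1] show ?thesis by simp
qed

text \<open>Conjugation by \<open>I_tilde\<close> is an involution of the Lie algebra. Any lift
  splits into its two eigenparts, and the fixed part is vertical, so it can be discarded.\<close>

lemma horizontal_lift:
  assumes q: "q \<in> D" and L: "(F has_derivative L) (at q within D)" "L ` Sp_tangent q = UNIV"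
  shows "\<exists>X \<in> sp_algebra. I_tilde ** X ** I_tilde = - X \<and> L (q ** X) = u"
proof -
  have "u \<in> L ` Sp_tangent q" using L(2) by simp
  then obtain Y where Y: "Y \<in> sp_algebra" "L (q ** Y) = u" by (auto simp: Sp_tangent_def)
  define T where "T = I_tilde ** Y ** I_tilde"
  have ITI: "I_tilde ** T ** I_tilde = Y"
    unfolding T_def by (simp add: matrix_mul_assoc I_tilde_simps I_tilde_cancel)
  have T_sp: "T \<in> sp_algebra"
    using Y(1) by (simp add: sp_algebra_iff T_def qconj_mult adj_mult I_tilde_simps mm.minus_left mm.minus_right matrix_mul_assoc)
  define X where "X = (1 / 2) *\<^sub>R (Y + (- 1) *\<^sub>R T)"
  define Z where "Z = (1 / 2) *\<^sub>R (Y + T)"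
  have sp: "X \<in> sp_algebra" "Z \<in> sp_algebra"
    unfolding X_def Z_def by (intro sp_algebra_scaleR sp_algebra_add Y T_sp)+
  have "I_tilde ** X ** I_tilde = - X"
    by (simp add: X_def mm.scaleR_left mm.scaleR_right mm.add_left mm.add_right mm.diff_left mm.diff_right ITI T_def[symmetric]
        scaleR_minus_right[symmetric] del: scaleR_minus_right)
  moreover have "I_tilde ** Z ** I_tilde = Z"
    by (simp add: Z_def mm.scaleR_left mm.scaleR_right mm.add_left mm.add_right ITI T_def[symmetric] add.commute)
  then have "I_tilde ** Z = Z ** I_tilde" by (metis I_tilde_cancel)
  then have "L (q ** Z) = 0" by (rule vertical[OF q L(1) sp(2)])
  moreover have "q ** Y = q ** X + q ** Z"
  proof -
    have "Y = X + Z" by (simp add: X_def Z_def scaleR_right_diff_distrib scaleR_right_distrib flip: scaleR_left_distrib)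
    then show ?thesis by (simp add: mm.add_right)
  qed
  ultimately have "L (q ** X) = u" using Y(2) linear_add[OF has_derivative_linear[OF L(1)]] by simp
  then show ?thesis using sp \<open>I_tilde ** X ** I_tilde = - X\<close> by blast
qed

lemma Sp_metric_translate:
  assumes "q \<in> Sp"
  shows "Sp_metric q (q ** X) (q ** Y) = X \<bullet> Y"
  using assms by (simp add: Sp_metric_def inner_eq_Re_trace matrix_mul_assoc Sp_iff)

lemma metric_\<Phi>:
  assumes y: "y \<in> U"
  shows "metric M c y u v = 1 / 4 * (frechet_derivative \<Phi> (at y) u \<bullet> frechet_derivative \<Phi> (at y) v)"
proof -
  obtain q where q: "q \<in> D" "F q = y" by (rule D_over_U[OF y])
  have qSp: "q \<in> Sp" using q by (simp add: D_def)
  have qq: "adj q ** q = mat 1" using qSp by (simp add: Sp_iff)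
  obtain L where L: "(F has_derivative L) (at q within D)" "L ` Sp_tangent q = UNIV"
    and iso: "\<And>v w. v \<in> {v \<in> Sp_tangent q. \<forall>u\<in>Sp_tangent q. L u = 0 \<longrightarrow> Sp_metric q v u = 0} \<Longrightarrow>
      w \<in> {v \<in> Sp_tangent q. \<forall>u\<in>Sp_tangent q. L u = 0 \<longrightarrow> Sp_metric q v u = 0} \<Longrightarrow>
      metric M c (F q) (L v) (L w) = Sp_metric q v w"
    using submersion(3)[OF q(1)] unfolding Let_def by blast
  have cancel: "q ** A ** adj q = 0 \<Longrightarrow> A = 0" for A
  proof -
    assume "q ** A ** adj q = 0"
    then have "adj q ** (q ** A ** adj q) ** q = 0" by (simp add: mm.zero_left mm.zero_right)
    moreover have "adj q ** (q ** A ** adj q) ** q = (adj q ** q) ** A ** (adj q ** q)"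
      by (simp only: matrix_mul_assoc)
    ultimately show "A = 0" by (simp add: qq)
  qed
  \<comment> \<open>If \<open>L\<close> kills \<open>q ** Z\<close>, so does the derivative of
    \<open>\<Phi>\<close>, and \<open>Z\<close> commutes with \<open>I_tilde\<close>. Then
    \<open>X\<close> and \<open>Z\<close> lie in opposite eigenspaces of the symmetric map of
    conjugation by \<open>I_tilde\<close>, hence are orthogonal.\<close>
  have hor: "q ** X \<in> {v \<in> Sp_tangent q. \<forall>u\<in>Sp_tangent q. L u = 0 \<longrightarrow> Sp_metric q v u = 0}"
    if X: "X \<in> sp_algebra" "I_tilde ** X ** I_tilde = - X" for X
  proof -
    have "Sp_metric q (q ** X) (q ** Z) = 0" if Z: "Z \<in> sp_algebra" "L (q ** Z) = 0" for Z
    proof -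
      have "q ** (Z ** I_tilde - I_tilde ** Z) ** adj q = frechet_derivative \<Phi> (at (F q)) 0"
        using \<Phi>_derivative[OF q(1) L(1) Z(1)] Z(2) by simp
      also have "\<dots> = 0"
        by (rule linear_0[OF has_derivative_linear[OF smooth_on_has_derivative[OF chart(2) smooth_\<Phi> F_in_U[OF q(1)]]]])
      finally have "Z ** I_tilde - I_tilde ** Z = 0" by (rule cancel)
      then have IZI: "I_tilde ** Z ** I_tilde = Z" by (metis I_tilde_cancel right_minus_eq)
      have "(I_tilde ** X ** I_tilde) \<bullet> Z = (I_tilde ** X) \<bullet> (Z ** I_tilde)"
        by (simp only: inner_mult_right I_tilde_simps)
      also have "\<dots> = X \<bullet> (I_tilde ** Z ** I_tilde)"
        by (simp only: inner_mult_left I_tilde_simps matrix_mul_assoc)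
      finally have "- (X \<bullet> Z) = X \<bullet> Z" by (simp add: IZI X(2))
      then show ?thesis by (simp add: Sp_metric_translate[OF qSp])
    qed
    then show ?thesis using X(1) by (auto simp: Sp_tangent_def)
  qed
  \<comment> \<open>As \<open>X\<close> anticommutes with \<open>I_tilde\<close>, both terms of the
    commutator agree. The resulting 2, squared, is compensated by the \<open>1 / 4\<close> of the
    claim.\<close>
  have d: "frechet_derivative \<Phi> (at y) (L (q ** X)) = 2 *\<^sub>R (q ** (X ** I_tilde) ** adj q)"
    if X: "X \<in> sp_algebra" "I_tilde ** X ** I_tilde = - X" for X
  proof -
    have "I_tilde ** X = I_tilde ** X ** I_tilde ** I_tilde" by (simp only: I_tilde_cancel)
    then have "I_tilde ** X = - (X ** I_tilde)" by (simp add: X(2) mm.minus_left)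
    then show ?thesis
      using \<Phi>_derivative[OF q(1) L(1) X(1)] unfolding q(2)
      by (simp only: scaleR_2 diff_minus_eq_add mm.add_left mm.add_right)
  qed
  obtain X where X: "X \<in> sp_algebra" "I_tilde ** X ** I_tilde = - X" "L (q ** X) = u"
    using horizontal_lift[OF q(1) L] by blast
  obtain Y where Y: "Y \<in> sp_algebra" "I_tilde ** Y ** I_tilde = - Y" "L (q ** Y) = v"
    using horizontal_lift[OF q(1) L] by blast
  have "(q ** (X ** I_tilde) ** adj q) \<bullet> (q ** (Y ** I_tilde) ** adj q) =
      (q ** (X ** I_tilde)) \<bullet> (q ** (Y ** I_tilde) ** (adj q ** q))"
    by (simp only: inner_mult_right[of _ "adj q"] adj_adj matrix_mul_assoc)
  also have "\<dots> = (X ** I_tilde) \<bullet> (Y ** I_tilde)"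
  proof -
    have "adj q ** (q ** (Y ** I_tilde)) = Y ** I_tilde"
      unfolding matrix_mul_assoc[of "adj q"] qq by simp
    then show ?thesis by (simp only: qq matrix_mul_rid inner_mult_left[of q])
  qed
  also have "\<dots> = X \<bullet> (Y ** I_tilde ** I_tilde)"
    by (simp only: inner_mult_right[of X] I_tilde_simps)
  finally have "(q ** (X ** I_tilde) ** adj q) \<bullet> (q ** (Y ** I_tilde) ** adj q) = X \<bullet> Y"
    by (simp only: I_tilde_cancel)
  moreover have "metric M c y u v = X \<bullet> Y"
    using iso[OF hor[OF X(1,2)] hor[OF Y(1,2)]] by (simp add: X(3) Y(3) q(2) Sp_metric_translate[OF qSp])
  ultimately show ?thesis
    using d[OF X(1,2)] d[OF Y(1,2)] by (simp add: X(3) Y(3))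
qed

lemma range_\<Phi>_derivative:
  assumes y: "y \<in> U"
  shows "range (frechet_derivative \<Phi> (at y)) = tangent_space (\<Phi> y)"
proof -
  obtain q where q: "q \<in> D" "F q = y" by (rule D_over_U[OF y])
  have qSp: "q \<in> Sp" using q by (simp add: D_def)
  have qc: "qconj q = q" "adj q ** q = mat 1" "q ** adj q = mat 1" using qSp by (auto simp: Sp_iff)
  obtain L where L: "(F has_derivative L) (at q within D)" "L ` Sp_tangent q = UNIV"
    using submersion(3)[OF q(1)] by blast
  have P: "\<Phi> y = q ** I_tilde ** adj q" using \<Phi>_F[OF q(1)] by (simp add: q(2) orbit_map_def)
  show ?thesis
  proof (intro equalityI subsetI)
    fix A assume "A \<in> range (frechet_derivative \<Phi> (at y))"
    then obtain u where u: "A = frechet_derivative \<Phi> (at y) u" by blast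
    have "u \<in> L ` Sp_tangent q" using L(2) by simp
    then obtain X where X: "X \<in> sp_algebra" "L (q ** X) = u" by (auto simp: Sp_tangent_def)
    define C where "C = X ** I_tilde - I_tilde ** X"
    have A: "A = q ** C ** adj q"
      using \<Phi>_derivative[OF q(1) L(1) X(1)] by (simp add: u X(2) q(2) C_def)
    have "qconj C = C" "adj C = C"
      using X(1) by (simp_all add: C_def sp_algebra_iff qconj_mult qconj_diff adj_diff adj_mult I_tilde_simps mm.minus_left mm.minus_right)
    moreover have "I_tilde ** C ** I_tilde = - C"
      by (simp add: C_def mm.diff_left mm.diff_right matrix_mul_assoc I_tilde_simps I_tilde_cancel)
    ultimately show "A \<in> tangent_space (\<Phi> y)"
      by (simp add: tangent_space_def A P Sp_conjugate[OF qSp] qconj_mult qconj_adj qc mm.minus_left mm.minus_right)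
        (simp add: adj_mult matrix_mul_assoc)
  next
    fix A assume "A \<in> tangent_space (\<Phi> y)"
    then have A: "qconj A = A" "adj A = A" "\<Phi> y ** A ** \<Phi> y = - A" by (auto simp: tangent_space_def)
    define C where "C = adj q ** A ** q"
    have C: "qconj C = C" "adj C = C"
      by (simp_all add: C_def qconj_mult qconj_adj qc A) (simp add: adj_mult A matrix_mul_assoc)
    have AC: "q ** C ** adj q = A"
    proof -
      have "q ** C ** adj q = (q ** adj q) ** A ** (q ** adj q)" by (simp only: C_def matrix_mul_assoc)
      then show ?thesis by (simp add: qc)
    qed
    have "I_tilde ** C ** I_tilde = (adj q ** q) ** I_tilde ** adj q ** A ** q ** I_tilde ** (adj q ** q)"
      by (simp add: C_def qc matrix_mul_assoc)
    also have "\<dots> = adj q ** (\<Phi> y ** A ** \<Phi> y) ** q" by (simp only: P matrix_mul_assoc)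
    finally have ICI: "I_tilde ** C ** I_tilde = - C" by (simp add: A C_def mm.minus_left mm.minus_right)
    have "I_tilde ** C = I_tilde ** C ** I_tilde ** I_tilde" by (simp only: I_tilde_cancel)
    then have IC: "I_tilde ** C = - (C ** I_tilde)" by (simp add: ICI mm.minus_left)
    \<comment> \<open>This solves \<open>X ** I_tilde - I_tilde ** X = C\<close>, since
      \<open>C\<close> anticommutes with \<open>I_tilde\<close>.\<close>
    define X where "X = (1 / 2) *\<^sub>R (C ** I_tilde)"
    have X: "X \<in> sp_algebra"
      by (simp add: X_def sp_algebra_iff qconj_scaleR qconj_mult adj_scaleR adj_mult C I_tilde_simps IC)
    have "X ** I_tilde - I_tilde ** X = (1 / 2) *\<^sub>R (C - I_tilde ** C ** I_tilde)"
      by (simp add: X_def mm.scaleR_left mm.scaleR_right I_tilde_cancel matrix_mul_assoc scaleR_diff_right)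
    also have "\<dots> = C" by (simp add: ICI flip: scaleR_2)
    finally have "frechet_derivative \<Phi> (at y) (L (q ** X)) = A"
      using \<Phi>_derivative[OF q(1) L(1) X] by (simp add: q(2) AC)
    then show "A \<in> range (frechet_derivative \<Phi> (at y))" by blast
  qed
qed

lemma involution_chart:
  assumes "trace (I_tilde :: ('m, 'n) qmat) = of_real t"
  shows "involution_chart M c U \<Phi> t"
proof
  show "open U" by (rule chart)
  show "smooth_on \<Phi> U" by (rule smooth_\<Phi>)
  fix y assume y: "y \<in> U"
  obtain q where q: "q \<in> D" "F q = y" by (rule D_over_U[OF y])
  then have "q \<in> Sp" "\<Phi> y = orbit_map q" using \<Phi>_F[OF q(1)] by (auto simp: D_def)
  then show "involution (\<Phi> y)" "trace (\<Phi> y) = of_real t"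
    using assms by (simp_all add: involution_orbit_map trace_orbit_map)
  show "range (frechet_derivative \<Phi> (at y)) = tangent_space (\<Phi> y)" by (rule range_\<Phi>_derivative[OF y])
  show "metric M c y u v = 1 / 4 * (frechet_derivative \<Phi> (at y) u \<bullet> frechet_derivative \<Phi> (at y) v)" for u v
    by (rule metric_\<Phi>[OF y])
  show "metric M c y u u > 0" if "u \<noteq> 0" for u by (rule metric_pos[OF y that])
qed

lemma psi_hat_param:
  assumes "y \<in> U"
  shows "psi_hat j \<alpha> (param c y) = 1 / 2 * (\<Phi> y + mat 1) $ j $ \<alpha>"
proof -
  obtain q where q: "q \<in> D" "F q = y" by (rule D_over_U[OF assms])
  have "psi_hat j \<alpha> (param c y) = psi j \<alpha> q"
    using param_F[OF q(1)] by (simp add: q(2) psi_hat_natural_proj)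
  then show ?thesis using \<Phi>_F[OF q(1)] by (simp add: psi_def q(2) orbit_map_def)
qed

end

section \<open>Both operators on the functions \<open>psi_hat\<close>\<close>

lemma tangent_proj_scaleR: "tangent_proj P (r *\<^sub>R N) = r *\<^sub>R tangent_proj P N"
proof -
  define S where "S = N + qconj N + adj N + qconj (adj N)"
  have "r *\<^sub>R N + qconj (r *\<^sub>R N) + adj (r *\<^sub>R N) + qconj (adj (r *\<^sub>R N)) = r *\<^sub>R S"
    by (simp add: S_def qconj_scaleR adj_scaleR scaleR_add_right)
  then show ?thesis
    unfolding tangent_proj_def Let_def S_def[symmetric]
    by (simp add: mm.scaleR_left mm.scaleR_right scaleR_diff_right mult.commute)
qed

context grassmannian_chart
begin

lemma psi_hat_param_off_diagonal:
  assumes "j \<noteq> \<alpha>" "y \<in> U"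
  shows "psi_hat j \<alpha> (param c y) = 1 / 2 * \<Phi> y $ j $ \<alpha>"
  using assms by (simp add: psi_hat_param mat_def)

lemma smooth_psi_hat:
  assumes j: "j \<noteq> \<alpha>"
  shows "smooth_on (psi_hat j \<alpha> \<circ> param c) U"
  unfolding smooth_on_def
proof
  fix k
  have "bounded_linear (\<lambda>A :: ('m, 'n) qmat. 1 / 2 * A $ j $ \<alpha>)"
    by (intro bounded_linear_const_mult bounded_linear_compose[OF bounded_linear_vec_nth bounded_linear_vec_nth])
  moreover have "C_k_on k \<Phi> U" using smooth_\<Phi> by (simp add: smooth_on_def)
  ultimately have "C_k_on k (\<lambda>y. 1 / 2 * \<Phi> y $ j $ \<alpha>) U"
    by (rule C_k_on_bounded_linear[OF chart(2)])
  then show "C_k_on k (psi_hat j \<alpha> \<circ> param c) U"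
    by (rule C_k_on_cong[OF chart(2), rotated]) (simp add: psi_hat_param_off_diagonal[OF j])
qed

lemma psi_hat_operators:
  assumes j: "j \<noteq> \<alpha>" and k: "k \<noteq> \<alpha>" and y: "y \<in> U"
  shows "divergence_complex M c (grad_complex M c (psi_hat j \<alpha>)) y =
      - of_nat CARD(('m + 'n) + ('m + 'n)) * psi_hat j \<alpha> (param c y)"
    and "metric_complex M c y (grad_complex M c (psi_hat j \<alpha>) y) (grad_complex M c (psi_hat k \<alpha>) y) =
      - (psi_hat j \<alpha> (param c y) * psi_hat k \<alpha> (param c y))"
proof -
  obtain t where "trace (I_tilde :: ('m, 'n) qmat) = of_real t" using trace_I_tilde by blast
  then interpret involution_chart M c U \<Phi> t by (rule involution_chart)
  \<comment> \<open>The \<open>1 / 2\<close> is the one in \<open>psi\<close>; \<open>x = 1\<close>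
    and \<open>x = \<i>\<close> give the real and the imaginary part of the function.\<close>
  define N where "N x i = (1 / 2) *\<^sub>R unit_mat x i \<alpha>" for x and i :: "('m + 'n) + ('m + 'n)"
  have inner_N: "A \<bullet> N 1 i = Re (1 / 2 * A $ i $ \<alpha>)" "A \<bullet> N \<i> i = Im (1 / 2 * A $ i $ \<alpha>)" for A i
    by (simp_all add: N_def inner_unit_mat)
  have aff: "affine (Re \<circ> psi_hat i \<alpha>) (N 1 i)" "affine (Im \<circ> psi_hat i \<alpha>) (N \<i> i)" if "i \<noteq> \<alpha>" for i
    unfolding affine_def inner_N
    by (rule exI[of _ 0], simp add: psi_hat_param_off_diagonal[OF that])+
  have div: "divergence M c (grad M c r) y = - (real CARD(('m + 'n) + ('m + 'n)) * (\<Phi> y \<bullet> N x j))"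
    if "affine r (N x j)" for r x
  proof -
    \<comment> \<open>An entry off the diagonal does not see the trace term of the Laplacian, so the
      result is independent of \<open>t\<close>.\<close>
    have "mat 1 \<bullet> N x j = 0" using j by (simp add: N_def inner_unit_mat mat_def)
    then show ?thesis by (simp only: divergence_grad[OF that y] inner_diff_left inner_scaleR_left)
  qed
  have comp: "fst \<circ> grad_complex M c f = grad M c (Re \<circ> f)" "snd \<circ> grad_complex M c f = grad M c (Im \<circ> f)" for f
    by (auto simp: grad_complex_def)
  show "divergence_complex M c (grad_complex M c (psi_hat j \<alpha>)) y =
      - of_nat CARD(('m + 'n) + ('m + 'n)) * psi_hat j \<alpha> (param c y)"
    unfolding divergence_complex_def comp div[OF aff(1)[OF j]] div[OF aff(2)[OF j]] inner_N
      psi_hat_param_off_diagonal[OF j y]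
    by (simp add: complex_eq_iff del: card_sum)
  define p where "p x = tangent_proj (\<Phi> y) (unit_mat x j \<alpha>) $ k $ \<alpha>" for x
  have pN: "tangent_proj (\<Phi> y) (N x j) $ k $ \<alpha> = 1 / 2 * p x" for x
    unfolding N_def p_def tangent_proj_scaleR scaleR_matrix_nth by simp
  \<comment> \<open>The 4 from \<open>metric_grad_grad\<close> is absorbed by the two halves in
    \<open>N\<close>. The complex bilinear extension then combines the four values into
    \<open>p 1 + \<i> * p \<i>\<close>, the shape of \<open>tangent_proj_column\<close>.\<close>
  have g: "metric M c y (grad M c (Re \<circ> psi_hat j \<alpha>) y) (grad M c (Re \<circ> psi_hat k \<alpha>) y) = Re (p 1)"
    "metric M c y (grad M c (Re \<circ> psi_hat j \<alpha>) y) (grad M c (Im \<circ> psi_hat k \<alpha>) y) = Im (p 1)"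
    "metric M c y (grad M c (Im \<circ> psi_hat j \<alpha>) y) (grad M c (Re \<circ> psi_hat k \<alpha>) y) = Re (p \<i>)"
    "metric M c y (grad M c (Im \<circ> psi_hat j \<alpha>) y) (grad M c (Im \<circ> psi_hat k \<alpha>) y) = Im (p \<i>)"
    by (simp_all add: metric_grad_grad[OF aff(1)[OF j] aff(1)[OF k] y] metric_grad_grad[OF aff(1)[OF j] aff(2)[OF k] y]
        metric_grad_grad[OF aff(2)[OF j] aff(1)[OF k] y] metric_grad_grad[OF aff(2)[OF j] aff(2)[OF k] y] inner_N pN)
  have "metric_complex M c y (grad_complex M c (psi_hat j \<alpha>) y) (grad_complex M c (psi_hat k \<alpha>) y) = p 1 + \<i> * p \<i>"
    unfolding metric_complex_def grad_complex_def fst_conv snd_conv g by (simp add: complex_eq_iff)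
  also have "\<dots> = - (1 / 4) * \<Phi> y $ k $ \<alpha> * \<Phi> y $ j $ \<alpha>"
    unfolding p_def by (rule tangent_proj_column[OF involution[OF y] j])
  finally show "metric_complex M c y (grad_complex M c (psi_hat j \<alpha>) y) (grad_complex M c (psi_hat k \<alpha>) y) =
      - (psi_hat j \<alpha> (param c y) * psi_hat k \<alpha> (param c y))"
    by (simp add: psi_hat_param_off_diagonal[OF j y] psi_hat_param_off_diagonal[OF k y])
qed

end

theorem theorem8p21:
  fixes M :: "(('m::finite, 'n::finite) qmat set, 'e::euclidean_space) riem"
    and \<alpha> :: "('m + 'n) + ('m + 'n)"
  assumes "quaternionic_grassmannian M"
  shows "eigenfamily M (E_family \<alpha>) \<and>
    (\<forall>f\<in>E_family \<alpha>. \<forall>x\<in>points M.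
       tension M f x = - 2 * (of_nat CARD('m) + of_nat CARD('n)) * f x) \<and>
    (\<forall>f\<in>E_family \<alpha>. \<forall>h\<in>E_family \<alpha>. \<forall>x\<in>points M.
       conformality M f h x = - (f x * h x))"
proof -
  have chart_at: "chart_at M x \<in> atlas M" "x \<in> chart_dom (chart_at M x)" if "x \<in> points M" for x
  proof -
    have "\<exists>c. c \<in> atlas M \<and> x \<in> chart_dom c"
      using assms that
      unfolding quaternionic_grassmannian_def riemannian_manifold_def smooth_manifold_def by blast
    from someI_ex[OF this] show "chart_at M x \<in> atlas M" "x \<in> chart_dom (chart_at M x)"
      by (simp_all add: chart_at_def)
  qed
  have op: "tension M (psi_hat j \<alpha>) x = - 2 * (of_nat CARD('m) + of_nat CARD('n)) * psi_hat j \<alpha> x"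
    "conformality M (psi_hat j \<alpha>) (psi_hat k \<alpha>) x = - (psi_hat j \<alpha> x * psi_hat k \<alpha> x)"
    if "j \<noteq> \<alpha>" "k \<noteq> \<alpha>" "x \<in> points M" for j k x
  proof -
    interpret grassmannian_chart M "chart_at M x"
      using assms chart_at[OF that(3)] by unfold_locales
    have U: "crd (chart_at M x) x \<in> U" using chart_at(2)[OF that(3)] by (simp add: U_def)
    note op = psi_hat_operators[OF that(1,2) U, unfolded param_crd[OF chart_at(2)[OF that(3)]]]
    show "tension M (psi_hat j \<alpha>) x = - 2 * (of_nat CARD('m) + of_nat CARD('n)) * psi_hat j \<alpha> x"
      \<comment> \<open>The index type \<open>('m + 'n) + ('m + 'n)\<close> has twice
        \<open>CARD('m) + CARD('n)\<close> elements.\<close>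
      unfolding tension_def Let_def op(1) by (simp add: algebra_simps)
    show "conformality M (psi_hat j \<alpha>) (psi_hat k \<alpha>) x = - (psi_hat j \<alpha> x * psi_hat k \<alpha> x)"
      unfolding conformality_def Let_def by (rule op(2))
  qed
  have "smooth_function M (psi_hat j \<alpha>)" if "j \<noteq> \<alpha>" for j
    unfolding smooth_function_def
  proof
    fix c assume "c \<in> atlas M"
    then interpret grassmannian_chart M c using assms by unfold_locales
    show "smooth_on (psi_hat j \<alpha> \<circ> param c) (crd c ` chart_dom c)"
      using smooth_psi_hat[OF that] by (simp only: U_def)
  qed
  then have smooth: "\<forall>f\<in>E_family \<alpha>. smooth_function M f" by (auto simp: E_family_def)
  have tension: "\<forall>f\<in>E_family \<alpha>. \<forall>x\<in>points M.
      tension M f x = - 2 * (of_nat CARD('m) + of_nat CARD('n)) * f x"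
    unfolding E_family_def using op(1) by blast
  have conformality: "\<forall>f\<in>E_family \<alpha>. \<forall>h\<in>E_family \<alpha>. \<forall>x\<in>points M. conformality M f h x = - (f x * h x)"
    unfolding E_family_def using op(2) by blast
  have "eigenfamily M (E_family \<alpha>)"
    unfolding eigenfamily_def
  proof (intro conjI smooth exI ballI)
    fix f h x assume fhx: "f \<in> E_family \<alpha>" "h \<in> E_family \<alpha>" "x \<in> points M"
    show "tension M f x = - 2 * (of_nat CARD('m) + of_nat CARD('n)) * f x"
      using tension fhx by blast
    show "conformality M f h x = (- 1) * (f x * h x)"
      using conformality fhx by simp
  qed
  then show ?thesis using tension conformality by blast
qed

end
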